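(* Let $$\varepsilon_{\pi,n}=\inf\Big\{\varepsilon:\varepsilon\ge-\frac1n\ln\pi(\{p\in\Gamma:D_{\mathrm{KL}}(q\|p)\le\varepsilon\})\Big\}.$$ Given $\rho\in(0,1)$, assume that for every $\varepsilon>0$ the set $\{p\in\Gamma:D_\rho(q\|p)\ge\varepsilon\}$ can be covered by the union of measurable sets $\Gamma_j^\varepsilon$ ($j=1,\dots$) such that $\inf\{D_\rho(q\|p):p\in\bigcup_j\mathrm{co}(\Gamma_j^\varepsilon)\}\ge\varepsilon/2$. For all $s\in[0,1]$, let $$\varepsilon_{\mathrm{conv},n}(s)=\sup\Big\{\varepsilon_0:\varepsilon_0<\frac1n\sup_{\varepsilon\ge\varepsilon_0}\inf_{\{\Gamma_j^\varepsilon\}}\ln\Big(\sum_j\pi(\Gamma_j^\varepsilon)^s+2\Big)\Big\},$$ where $\varepsilon_0$ and $\varepsilon$ range over positive reals and the inner infimum is over all covers $\{\Gamma_j^\varepsilon\}$ of $\{p\in\Gamma:D_\rho(q\|p)\ge\varepsilon\}$ by measurable sets $\Gamma_j^\varepsilon$ ($j=1,\dots$) such that $\inf\{D_\rho(q\|p):p\in\bigcup_j\mathrm{co}(\Gamma_j^\varepsilon)\}\ge\varepsilon/2$. For all $\gamma\ge1$ let $$\varepsilon_n=2\gamma\varepsilon_{\pi,n}+(\gamma-\rho)\,\varepsilon_{\mathrm{conv},n}((\gamma-1)/(\gamma-\rho)).$$ Then for all $t\ge0$ and $\delta\in(0,1)$, with probability at least $1-\delta$ (over $X$), $$\pi\l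eft(\left\{p\in\Gamma:D_\rho(q\|p)\ge\frac{4\varepsilon_n+(8\gamma-4)t}{\rho(1-\rho)\delta}\right\}\Big|X\right)\le\frac{1}{1+e^{nt}}.$$
   Context: $\mathcal{X}$ is a sample space with a measure $\mu$; $q$ is a probability density with respect to $\mu$ (the true density); $X=(X_1,\dots,X_n)$ are $n$ independent samples from $q$; $\mathbf{E}_q$ is expectation over a single $x\sim q$. $\{p(\cdot|\theta):\theta\in\Gamma\}$ is a family of probability densities with respect to $\mu$ ($q$ need not belong to it); the family is also denoted $\Gamma$, so subsets of $\Gamma$ are identified with sets of densities. $\pi$ is a probability measure (prior) on $\Gamma$ not depending on $X$; $\mathrm{co}(A)$ is the convex hull of the densities in $A$. $\pi(A|X)=\int_A\prod_{i=1}^np(X_i|\theta)\,d\pi(\theta)\big/\int_\Gamma\prod_{i=1}^np(X_i|\theta)\,d\pi(\theta)$ is the Bayesian posterior probability of $A\subset\Gamma$. $D_{\mathrm{KL}}(q\|p)=\mathbf{E}_q\ln(q(x)/p(x))$ and, for $\rho\in(0,1)$, $D_\rho(q\|p)=\frac{1}{\rho(1-\rho)}\mathbf{E}_q\big[1-\big(\frac{p(x)}{q(x)}\big)^\rho\big]$. Covers are countable. All quantities are assumed measurable, and the expressions appearing are assumed to be well defined. *)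

theory Defs
  imports "HOL-Probability.Probability"
begin

definition prob_density :: "'a measure \<Rightarrow> ('a \<Rightarrow> real) \<Rightarrow> bool" where
  "prob_density M f \<longleftrightarrow>
     f \<in> borel_measurable M \<and> (\<forall>x\<in>space M. 0 \<le> f x) \<and> (\<integral>\<^sup>+x. ennreal (f x) \<partial>M) = 1"

text \<open>The natural logarithm on $[0,\infty]$, with $\ln 0 = -\infty$ and $\ln\infty = \infty$
  (the library function \<^const>\<open>ln\<close> has \<open>ln (0::real) = 0\<close>).\<close>

definition eln :: "ennreal \<Rightarrow> ereal" where
  "eln a = (if a = 0 then - \<infinity> else if a = \<infinity> then \<infinity> else ereal (ln (enn2real a)))"

text \<open>$D_{\mathrm{KL}}(q\|p) = \mathbf{E}_q \ln (q/p)$ with values in the extended reals, as the integral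
  of the positive part minus that of the negative part. The quotient is taken in
  \<^typ>\<open>ennreal\<close>, so the integrand is $\infty$ where $p = 0 < q$. The library constant
  \<^const>\<open>KL_divergence\<close> is real-valued and takes the value 0 when the integral diverges.\<close>

definition D_KL :: "'a measure \<Rightarrow> ('a \<Rightarrow> real) \<Rightarrow> ('a \<Rightarrow> real) \<Rightarrow> ereal" where
  "D_KL M q f =
     enn2ereal (\<integral>\<^sup>+x. e2ennreal (eln (ennreal (q x) / ennreal (f x))) \<partial>density M q)
     - enn2ereal (\<integral>\<^sup>+x. e2ennreal (- eln (ennreal (q x) / ennreal (f x))) \<partial>density M q)"

definition D_rho :: "real \<Rightarrow> 'a measure \<Rightarrow> ('a \<Rightarrow> real) \<Rightarrow> ('a \<Rightarrow> real) \<Rightarrow> real" where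
  "D_rho \<rho> M q f =
     1 / (\<rho> * (1 - \<rho>)) * (LINT x|density M q. 1 - (f x / q x) powr \<rho>)"

text \<open>Convex hull of a set of functions; the library's \<^const>\<open>convex\<close> \<open>hull\<close> needs the class
  \<^class>\<open>real_vector\<close>, which function types do not instantiate.\<close>

definition co :: "('a \<Rightarrow> real) set \<Rightarrow> ('a \<Rightarrow> real) set" where
  "co F = {f. \<exists>S u. finite S \<and> S \<subseteq> F \<and> (\<forall>g\<in>S. 0 \<le> u g) \<and> (\<Sum>g\<in>S. u g) = 1
                  \<and> f = (\<lambda>x. \<Sum>g\<in>S. u g * g x)}"

text \<open>The family $\Gamma$ is given by a prior \<open>\<pi>\<close> on a parameter space, $\Gamma$ = \<open>space \<pi>\<close>, and
  a map \<open>p\<close> from parameters to densities. Subsets of $\Gamma$ are sets of parameters.\<close>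

definition posterior ::
  "'b measure \<Rightarrow> ('b \<Rightarrow> 'a \<Rightarrow> real) \<Rightarrow> nat \<Rightarrow> (nat \<Rightarrow> 'a) \<Rightarrow> 'b set \<Rightarrow> real" where
  "posterior \<pi> p n X A =
     (LINT \<theta>:A|\<pi>. (\<Prod>i\<in>{1..n}. p \<theta> (X i))) / (LINT \<theta>|\<pi>. (\<Prod>i\<in>{1..n}. p \<theta> (X i)))"

definition D_rho_ge ::
  "real \<Rightarrow> 'a measure \<Rightarrow> ('a \<Rightarrow> real) \<Rightarrow> 'b measure \<Rightarrow> ('b \<Rightarrow> 'a \<Rightarrow> real) \<Rightarrow> ereal \<Rightarrow> 'b set" where
  "D_rho_ge \<rho> M q \<pi> p r = {\<theta> \<in> space \<pi>. ereal (D_rho \<rho> M q (p \<theta>)) \<ge> r}"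

definition eps_pi ::
  "'a measure \<Rightarrow> ('a \<Rightarrow> real) \<Rightarrow> 'b measure \<Rightarrow> ('b \<Rightarrow> 'a \<Rightarrow> real) \<Rightarrow> nat \<Rightarrow> ereal" where
  "eps_pi M q \<pi> p n =
     Inf {ereal \<epsilon> | \<epsilon>. ereal \<epsilon> \<ge>
       - (ereal (1 / real n) * eln (emeasure \<pi> {\<theta> \<in> space \<pi>. D_KL M q (p \<theta>) \<le> ereal \<epsilon>}))}"

text \<open>Countable covers are families indexed by an arbitrary set \<open>J\<close> of naturals, so finite covers
  are allowed. The infimum is taken in \<^typ>\<open>ereal\<close>, hence is $\infty$ over the empty set.\<close>

definition hull_covers ::
  "real \<Rightarrow> 'a measure \<Rightarrow> ('a \<Rightarrow> real) \<Rightarrow> 'b measure \<Rightarrow> ('b \<Rightarrow> 'a \<Rightarrow> real) \<Rightarrow> real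
     \<Rightarrow> (nat set \<times> (nat \<Rightarrow> 'b set)) set" where
  "hull_covers \<rho> M q \<pi> p \<epsilon> =
     {(J, G). (\<forall>j\<in>J. G j \<in> sets \<pi>)
            \<and> D_rho_ge \<rho> M q \<pi> p (ereal \<epsilon>) \<subseteq> (\<Union>j\<in>J. G j)
            \<and> (INF f \<in> (\<Union>j\<in>J. co (p ` G j)). ereal (D_rho \<rho> M q f)) \<ge> ereal (\<epsilon> / 2)}"

text \<open>Powers with $0^0 = 1$ (the library has \<open>0 powr 0 = 0\<close>), so that for $s = 0$ the sum
  $\sum_j \pi(\Gamma_j)^s$ is the number of sets in the cover.\<close>

definition powr1 :: "real \<Rightarrow> real \<Rightarrow> real" where
  "powr1 x s = (if s = 0 then 1 else x powr s)"

definition eps_conv ::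
  "real \<Rightarrow> 'a measure \<Rightarrow> ('a \<Rightarrow> real) \<Rightarrow> 'b measure \<Rightarrow> ('b \<Rightarrow> 'a \<Rightarrow> real) \<Rightarrow> nat \<Rightarrow> real \<Rightarrow> ereal" where
  "eps_conv \<rho> M q \<pi> p n s =
     Sup {ereal \<epsilon>0 | \<epsilon>0. 0 < \<epsilon>0 \<and> ereal \<epsilon>0 <
       ereal (1 / real n) *
         (SUP \<epsilon>\<in>{\<epsilon>0..}. INF (J, G)\<in>hull_covers \<rho> M q \<pi> p \<epsilon>.
            eln ((\<Sum>\<^sub>\<infinity>j\<in>J. ennreal (powr1 (measure \<pi> (G j)) s)) + 2))}"

definition eps_n ::
  "real \<Rightarrow> 'a measure \<Rightarrow> ('a \<Rightarrow> real) \<Rightarrow> 'b measure \<Rightarrow> ('b \<Rightarrow> 'a \<Rightarrow> real) \<Rightarrow> nat \<Rightarrow> real \<Rightarrow> ereal" where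
  "eps_n \<rho> M q \<pi> p n \<gamma> =
     ereal (2 * \<gamma>) * eps_pi M q \<pi> p n
     + ereal (\<gamma> - \<rho>) * eps_conv \<rho> M q \<pi> p n ((\<gamma> - 1) / (\<gamma> - \<rho>))"

end

theory Submission
  imports Defs "HOL-Real_Asymp.Real_Asymp"
begin

text \<open>Write \<open>L\<^sub>\<theta>\<close> for the likelihood ratio of \<open>p(\<cdot>|\<theta>)\<close> to \<open>q\<close> on the whole sample, \<open>D = \<integral> L d\<pi>\<close> for the evidence,
  and \<open>N\<close> for the same integral over the far set \<open>A\<close>. If the posterior mass of \<open>A\<close> exceeds
  \<open>1 / (1 + e\<^sup>n\<^sup>t)\<close>, then \<open>D < (1 + e\<^sup>n\<^sup>t) N\<close>. The theorem holds because \<open>- ln D\<close> cannot have a large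
  expectation while \<open>N\<close> has small moments, so this event must be rare. All estimates are tangent-line
  versions of Jensen's inequality, and the probability \<open>b\<close> of the bad event appears essentially linearly; this
  is why \<open>1 / \<delta>\<close> enters the radius.

  Upper bound: up to arbitrarily small errors, the Kullback-Leibler ball of radius \<open>\<epsilon>\<^sub>\<pi>\<close> has mass at
  least \<open>e\<^sup>-\<^sup>x\<close> for \<open>x = n \<epsilon>\<^sub>\<pi>\<close>, and so \<open>- ln D\<close> has expectation at most \<open>2 x\<close>
  (\<open>expectation_le_of_exp_evidence\<close>).

  Lower bound: on the bad event \<open>- ln D \<ge> - ln N - ln (1 + e\<^sup>n\<^sup>t)\<close>, and elsewhere \<open>- ln D \<ge> 1 - D\<close>
  (\<open>bad_event_probability_bound\<close>). To bound \<open>N\<close>, split \<open>A\<close> along a cover. On the piece \<open>j\<close>, of prior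
  mass \<open>\<pi>\<^sub>j\<close>, the integrated likelihood \<open>N\<^sub>j\<close> has mean at most \<open>\<pi>\<^sub>j\<close> and moment of order \<open>\<rho>\<close> at most
  \<open>c \<pi>\<^sub>j\<^sup>\<rho>\<close>, where \<open>c = exp (- n \<rho> (1 - \<rho>) \<epsilon> / 2)\<close> and \<open>\<epsilon>\<close> is the radius of the far set. The second bound is
  the convex-hull condition, extended from finite convex combinations to mixtures
  (\<open>mixture_moment_le\<close>) and then to samples (\<open>product_mixture_moment_le\<close>).

  With \<open>k = \<gamma> - \<rho>\<close> and \<open>s = (\<gamma> - 1) / k\<close>, the entropy \<open>\<Sum> \<pi>\<^sub>j\<^sup>s\<close> arises from interpolation. For \<open>k \<ge> 1\<close> one has
  \<open>s \<ge> \<rho>\<close> and interpolates each \<open>N\<^sub>j\<close> between the orders \<open>\<rho>\<close> and 1, which yields a bound on the moment of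
  order \<open>s\<close> of \<open>N\<close>. For \<open>k < 1\<close> one has \<open>s < \<rho>\<close> and uses the moment of order \<open>\<rho>\<close>, interpolating
  \<open>\<Sum> \<pi>\<^sub>j\<^sup>\<rho>\<close> between \<open>\<Sum> \<pi>\<^sub>j\<^sup>s\<close> and \<open>\<pi>(A)\<close>. Since \<open>A\<close> misses the Kullback-Leibler ball,
  \<open>\<pi>(A) \<le> 1 - e\<^sup>-\<^sup>x \<le> x\<close>. This gain is essential when \<open>\<rho>\<close> is close to 1 and \<open>\<gamma> = 1\<close>, where the entropy term
  carries almost no weight. Elementary inequalities for logarithms show that the two bounds on the
  expectation of \<open>- ln D\<close> contradict each other when \<open>b > \<delta>\<close> (\<open>rate_contradiction_large\<close>,
  \<open>rate_contradiction_small\<close>).\<close>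

section \<open>Powers of nonnegative and extended nonnegative reals\<close>

lemma powr_add_subadditive:
  fixes x y r :: real
  assumes "0 \<le> x" "0 \<le> y" "0 < r" "r \<le> 1"
  shows "(x + y) powr r \<le> x powr r + y powr r"
proof (cases "x + y = 0")
  case True
  then have "x = 0" "y = 0" using assms by auto
  then show ?thesis by simp
next
  case False
  define s where "s = x + y"
  have s: "0 < s" using False assms by (auto simp: s_def)
  have base: "u \<le> u powr r" if "0 \<le> u" "u \<le> 1" for u :: real
    using powr_mono'[of r 1 u] that assms by (auto simp: powr_one_gt_zero_iff)
  have "1 = x / s + y / s" using s by (simp add: s_def add_divide_distrib[symmetric])
  also have "\<dots> \<le> (x / s) powr r + (y / s) powr r"
    using assms s by (intro add_mono base) (auto simp: s_def)
  finally have "1 * s powr r \<le> ((x / s) powr r + (y / s) powr r) * s powr r"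
    by (intro mult_right_mono) auto
  also have "\<dots> = x powr r + y powr r"
    using assms s by (simp add: powr_divide field_simps)
  finally show ?thesis by (simp add: s_def)
qed

lemma powr_le_add_abs_diff:
  fixes x y r :: real
  assumes "0 \<le> x" "0 \<le> y" "0 < r" "r \<le> 1"
  shows "x powr r \<le> y powr r + \<bar>x - y\<bar> powr r"
proof -
  have "x powr r \<le> (y + \<bar>x - y\<bar>) powr r"
    using assms by (intro powr_mono2) auto
  also have "\<dots> \<le> y powr r + \<bar>x - y\<bar> powr r"
    using assms by (intro powr_add_subadditive) auto
  finally show ?thesis .
qed

text \<open>This weighted arithmetic-geometric mean inequality does the work of Hoelder's inequality below:
  applied pointwise to normalized factors and then integrated or summed, it stays meaningful when
  some of the integrals are infinite.\<close>

lemma powr_product_le_weighted_sum: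
  fixes a b k :: real
  assumes "0 \<le> a" "0 \<le> b" "0 \<le> k" "k \<le> 1"
  shows "a powr k * b powr (1 - k) \<le> k * a + (1 - k) * b"
proof (cases "a = 0 \<or> b = 0")
  case True
  then show ?thesis using assms by auto
next
  case False
  then show ?thesis using Youngs_inequality_0[of k "1 - k" a b] assms by auto
qed

text \<open>Powers of marginal likelihoods have to be integrated before those likelihoods are known to
  be finite. For positive exponents, the value \<open>\<infinity>\<close> at \<open>\<infinity>\<close> makes the function monotone and
  continuous along increasing sequences.\<close>

definition epow :: "ennreal \<Rightarrow> real \<Rightarrow> ennreal" where
  "epow a r = (if a = \<infinity> then \<infinity> else ennreal (enn2real a powr r))"

lemma epow_ennreal [simp]: "0 \<le> x \<Longrightarrow> epow (ennreal x) r = ennreal (x powr r)"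
  by (simp add: epow_def)

lemma epow_infinity [simp]: "epow \<infinity> r = \<infinity>" "epow \<top> r = \<top>"
  by (simp_all add: epow_def)

lemma epow_0 [simp]: "epow 0 r = 0"
  by (simp add: epow_def)

lemma epow_mono: "a \<le> b \<Longrightarrow> 0 \<le> r \<Longrightarrow> epow a r \<le> epow b r"
  unfolding epow_def by (auto simp: top_unique less_top intro!: ennreal_leI powr_mono2 enn2real_mono)

lemma measurable_epow [measurable]:
  assumes [measurable]: "f \<in> borel_measurable M"
  shows "(\<lambda>x. epow (f x) r) \<in> borel_measurable M"
proof -
  have "(\<lambda>x. if f x \<in> {\<infinity>} then \<infinity> else ennreal (enn2real (f x) powr r)) \<in> borel_measurable M"
    by measurable
  then show ?thesis by (simp add: epow_def)
qed

lemma epow_mult: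
  assumes "0 \<le> c" "0 < r"
  shows "epow (ennreal c * a) r = ennreal (c powr r) * epow a r"
proof (cases a)
  case (real x)
  then show ?thesis using assms by (simp add: ennreal_mult'[symmetric] powr_mult)
next
  case top
  then show ?thesis using assms by (cases "c = 0") (auto simp: ennreal_mult_top)
qed

lemma epow_add_le:
  assumes "0 < r" "r \<le> 1"
  shows "epow (a + b) r \<le> epow a r + epow b r"
proof (cases "a = \<top> \<or> b = \<top>")
  case True
  then show ?thesis by auto
next
  case False
  then obtain x y where xy: "a = ennreal x" "b = ennreal y" "0 \<le> x" "0 \<le> y"
    by (metis ennreal_cases)
  then have "epow (a + b) r = ennreal ((x + y) powr r)"
    by (simp add: ennreal_plus[symmetric] del: ennreal_plus)
  also have "\<dots> \<le> ennreal (x powr r + y powr r)"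
    using xy assms by (intro ennreal_leI powr_add_subadditive) auto
  finally show ?thesis using xy by simp
qed

lemma epow_sum_le:
  assumes "0 < r" "r \<le> 1" "finite I"
  shows "epow (\<Sum>i\<in>I. f i) r \<le> (\<Sum>i\<in>I. epow (f i) r)"
  using assms(3)
proof induction
  case (insert i I)
  have "epow (f i + (\<Sum>i\<in>I. f i)) r \<le> epow (f i) r + epow (\<Sum>i\<in>I. f i) r"
    by (rule epow_add_le) fact+
  also have "\<dots> \<le> epow (f i) r + (\<Sum>i\<in>I. epow (f i) r)"
    by (intro add_mono order_refl insert)
  finally show ?case using insert by simp
qed simp

lemma epow_SUP:
  assumes "incseq F" "0 < r"
  shows "epow (SUP i. F i) r = (SUP i::nat. epow (F i) r)"
proof -
  have inc: "incseq (\<lambda>i. epow (F i) r)"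
    using assms by (auto simp: incseq_def intro!: epow_mono)
  have lim: "F \<longlonglongrightarrow> (SUP i. F i)" by (rule LIMSEQ_SUP) fact
  have "(\<lambda>i. epow (F i) r) \<longlonglongrightarrow> epow (SUP i. F i) r"
  proof (cases "SUP i. F i")
    case (real x)
    have fin: "F i \<noteq> \<top>" for i
      using SUP_upper[of i UNIV F] real by (auto simp: top_unique)
    have "(\<lambda>i. enn2real (F i)) \<longlonglongrightarrow> x"
      using tendsto_enn2real[of F x] lim real by simp
    then have "(\<lambda>i. enn2real (F i) powr r) \<longlonglongrightarrow> x powr r"
      using real assms by (intro tendsto_powr') auto
    then show ?thesis using real fin
      by (auto simp: epow_def intro!: tendsto_ennrealI)
  next
    case top
    have "(SUP i. epow (F i) r) = \<top>"
    proof (rule ccontr)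
      assume "(SUP i. epow (F i) r) \<noteq> \<top>"
      then obtain y where y: "0 \<le> y" "(SUP i. epow (F i) r) = ennreal y"
        by (metis ennreal_cases)
      have "F i \<le> ennreal (y powr (1 / r))" for i
      proof -
        have le: "epow (F i) r \<le> ennreal y" using y SUP_upper[of i UNIV "\<lambda>i. epow (F i) r"] by simp
        then obtain z where z: "F i = ennreal z" "0 \<le> z"
          by (cases "F i") (auto simp: top_unique)
        then have "z powr r \<le> y" using le y by simp
        then have "(z powr r) powr (1 / r) \<le> y powr (1 / r)"
          using assms by (intro powr_mono2) auto
        then show ?thesis using z assms by (simp add: powr_powr)
      qed
      then have "(SUP i. F i) \<le> ennreal (y powr (1 / r))" by (intro SUP_least)
      then show False using top by (simp add: top_unique)
    qed
    then have "epow (SUP i. F i) r = (SUP i. epow (F i) r)" by (simp only: top epow_infinity)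
    then show ?thesis using LIMSEQ_SUP[OF inc] by simp
  qed
  then show ?thesis using LIMSEQ_SUP[OF inc] LIMSEQ_unique by blast
qed

lemma epow_suminf_le:
  assumes "0 < r" "r \<le> 1"
  shows "epow (\<Sum>i. f i) r \<le> (\<Sum>i. epow (f i) r)"
proof -
  have "epow (\<Sum>i. f i) r = (SUP n. epow (\<Sum>i<n. f i) r)"
    unfolding suminf_eq_SUP
    using assms by (intro epow_SUP) (auto simp: incseq_def intro!: sum_mono2)
  also have "\<dots> \<le> (\<Sum>i. epow (f i) r)"
  proof (rule SUP_least)
    fix n
    have "epow (\<Sum>i<n. f i) r \<le> (\<Sum>i<n. epow (f i) r)"
      using assms by (intro epow_sum_le) auto
    also have "\<dots> \<le> (\<Sum>i. epow (f i) r)" by (intro sum_le_suminf) auto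
    finally show "epow (\<Sum>i<n. f i) r \<le> (\<Sum>i. epow (f i) r)" .
  qed
  finally show ?thesis .
qed

text \<open>The pointwise form of log-convexity of moments: integrating against a measure with
  \<open>\<integral> a \<le> m\<close> and \<open>\<integral> a\<^sup>r \<le> c m\<^sup>r\<close> turns the bracket into a number at most 1, so that the moment of
  order \<open>al = (1 - w) + w r\<close> is at most \<open>c\<^sup>w m\<^sup>a\<^sup>l\<close>.\<close>

lemma epow_interpolate:
  fixes a :: ennreal
  assumes w: "0 < w" "w \<le> 1" and c: "0 < c" and m: "0 < m" and r: "0 < r"
    and al: "al = (1 - w) + w * r"
  shows "epow a al \<le> ennreal (m powr al * c powr w) *
     (ennreal ((1 - w) / m) * a + ennreal (w / (m powr r * c)) * epow a r)"
proof (cases a)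
  case (real x)
  have *: "x powr al = m powr al * c powr w *
     (((x powr r) / (m powr r * c)) powr w * (x / m) powr (1 - w))"
  proof (cases "x = 0")
    case True
    then show ?thesis by simp
  next
    case False
    then have x: "0 < x" using real by simp
    have 1: "((x powr r) / (m powr r * c)) powr w = x powr (w * r) / (m powr (w * r) * c powr w)"
      using c m x by (simp add: powr_divide powr_mult powr_powr mult.commute)
    have 2: "(x / m) powr (1 - w) = x powr (1 - w) / m powr (1 - w)"
      using m x by (simp add: powr_divide)
    have 3: "x powr al = x powr (1 - w) * x powr (w * r)" "m powr al = m powr (1 - w) * m powr (w * r)"
      by (simp_all add: al powr_add)
    show ?thesis unfolding 1 2 3 using c m by simp
  qed
  have "((x powr r) / (m powr r * c)) powr w * (x / m) powr (1 - w)
     \<le> w * ((x powr r) / (m powr r * c)) + (1 - w) * (x / m)"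
    using c m real w by (intro powr_product_le_weighted_sum) auto
  then have "x powr al \<le> m powr al * c powr w * (w * ((x powr r) / (m powr r * c)) + (1 - w) * (x / m))"
    unfolding * using c m by (intro mult_left_mono) auto
  also have "\<dots> = m powr al * c powr w * ((1 - w) / m * x + w / (m powr r * c) * x powr r)"
    by (simp add: field_simps)
  finally have "ennreal (x powr al) \<le> ennreal \<dots>" by (rule ennreal_leI)
  also have "\<dots> = ennreal (m powr al * c powr w) *
     (ennreal ((1 - w) / m) * a + ennreal (w / (m powr r * c)) * epow a r)"
  proof -
    have nn: "0 \<le> (1 - w) / m" "0 \<le> w / (m powr r * c)" "0 \<le> m powr al * c powr w"
      using w c m by auto
    have fold: "ennreal (A * (B * x + C * y)) = ennreal A * (ennreal B * ennreal x + ennreal C * ennreal y)"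
      if "0 \<le> A" "0 \<le> B" "0 \<le> C" "0 \<le> y" for A B C y :: real
      using that real by (simp add: ennreal_mult)
    show ?thesis using fold[OF nn(3,1,2), of "x powr r"] real by (simp only: epow_ennreal powr_ge_zero)
  qed
  finally show ?thesis using real by simp
next
  case top
  have "0 < w / (m powr r * c)" "0 < m powr al * c powr w" using w m c by auto
  then have "ennreal (w / (m powr r * c)) * \<top> = \<top>" "ennreal (m powr al * c powr w) * \<top> = \<top>"
    by (auto simp: ennreal_mult_eq_top_iff)
  then show ?thesis by (simp only: top epow_infinity) simp
qed

section \<open>Fractional moments of mixtures\<close>

text \<open>A bounded mixture is approximated by finite averages at the dimension-free rate of Maurey's
  lemma, here by a greedy choice instead of random sampling. If \<open>e\<close> is the current error, then
  \<open>\<integral> e (h(\<cdot>, \<theta>) - H) dQ\<close> has mean zero under \<open>\<nu>\<close>, so some \<open>\<theta> \<in> G\<close> makes this inner product nonpositive;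
  adding that \<open>\<theta>\<close> increases the squared norm of the error by at most \<open>K\<^sup>2\<close>.\<close>

lemma greedy_average_L2:
  fixes h :: "'a \<Rightarrow> 'b \<Rightarrow> real"
  assumes Q: "prob_space Q" and \<nu>: "prob_space \<nu>"
    and h_meas: "(\<lambda>(x, \<theta>). h x \<theta>) \<in> borel_measurable (Q \<Otimes>\<^sub>M \<nu>)"
    and h_bd: "\<And>x \<theta>. 0 \<le> h x \<theta>" "\<And>x \<theta>. h x \<theta> \<le> K"
    and G: "AE \<theta> in \<nu>. \<theta> \<in> G"
  defines "H \<equiv> \<lambda>x. LINT \<theta>|\<nu>. h x \<theta>"
  shows "\<exists>\<theta>. (\<forall>i<m. \<theta> i \<in> G \<inter> space \<nu>) \<and> (LINT x|Q. (\<Sum>i<m. h x (\<theta> i) - H x)\<^sup>2) \<le> real m * K\<^sup>2"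
proof -
  interpret Q: prob_space Q by fact
  interpret \<nu>: prob_space \<nu> by fact
  interpret P: pair_prob_space Q \<nu> ..
  have K: "0 \<le> K" using h_bd order_trans by blast
  have h_x[measurable]: "(\<lambda>x. h x \<theta>) \<in> borel_measurable Q" if "\<theta> \<in> space \<nu>" for \<theta>
    using measurable_compose[OF measurable_Pair2'[OF that, of Q] h_meas] by simp
  have h_t[measurable]: "h x \<in> borel_measurable \<nu>" if "x \<in> space Q" for x
    using measurable_compose[OF measurable_Pair1'[OF that, of \<nu>] h_meas] by simp
  have H_meas[measurable]: "H \<in> borel_measurable Q"
    unfolding H_def using h_meas by (intro \<nu>.borel_measurable_lebesgue_integral)
  have h_int: "integrable \<nu> (h x)" if "x \<in> space Q" for x
    using h_bd that K by (intro \<nu>.integrable_const_bound[where B=K]) (auto simp: abs_le_iff intro: order_trans)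
  have H_bd: "0 \<le> H x" "H x \<le> K" if "x \<in> space Q" for x
  proof -
    show "0 \<le> H x" unfolding H_def using h_bd by (intro integral_nonneg_AE) auto
    have "H x \<le> (LINT \<theta>|\<nu>. K)" unfolding H_def using h_bd h_int[OF that] by (intro integral_mono) auto
    then show "H x \<le> K" by (simp add: \<nu>.prob_space)
  qed
  have d_bd: "\<bar>h x \<theta> - H x\<bar> \<le> K" if "x \<in> space Q" for x \<theta>
    using h_bd[of x \<theta>] H_bd[OF that] by (auto simp: abs_le_iff)
  have e_bd: "\<bar>\<Sum>i<m. h x (\<theta> i) - H x\<bar> \<le> real m * K" if "x \<in> space Q" for x \<theta> m
  proof -
    have "\<bar>\<Sum>i<m. h x (\<theta> i) - H x\<bar> \<le> (\<Sum>i<m. \<bar>h x (\<theta> i) - H x\<bar>)" by (rule sum_abs)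
    also have "\<dots> \<le> (\<Sum>i<m. K)" using d_bd[OF that] by (intro sum_mono) auto
    finally show ?thesis by simp
  qed
  show ?thesis
  proof (induction m)
    case 0
    show ?case by simp
  next
    case (Suc m)
    then obtain \<theta> where \<theta>: "\<forall>i<m. \<theta> i \<in> G \<inter> space \<nu>"
      and le: "(LINT x|Q. (\<Sum>i<m. h x (\<theta> i) - H x)\<^sup>2) \<le> real m * K\<^sup>2" by blast
    define e where "e x = (\<Sum>i<m. h x (\<theta> i) - H x)" for x
    have e_meas[measurable]: "e \<in> borel_measurable Q"
      unfolding e_def using \<theta> by (intro borel_measurable_sum borel_measurable_diff h_x H_meas) auto
    have eb: "\<bar>e x\<bar> \<le> real m * K" if "x \<in> space Q" for x
      unfolding e_def by (rule e_bd[OF that])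
    define F where "F t = (LINT x|Q. e x * (h x t - H x))" for t
    have prod_bd: "\<bar>e x * (h x t - H x)\<bar> \<le> real m * K * K" if "x \<in> space Q" for x t
      unfolding abs_mult using eb[OF that] d_bd[OF that] K by (intro mult_mono) auto
    have pint: "integrable (Q \<Otimes>\<^sub>M \<nu>) (\<lambda>(x, t). e x * (h x t - H x))"
    proof (rule P.P.integrable_const_bound[where B="real m * K * K"])
      show "AE z in Q \<Otimes>\<^sub>M \<nu>. norm (case z of (x, t) \<Rightarrow> e x * (h x t - H x)) \<le> real m * K * K"
        using prod_bd by (auto simp: space_pair_measure)
      have [measurable]: "(\<lambda>z. h (fst z) (snd z)) \<in> borel_measurable (Q \<Otimes>\<^sub>M \<nu>)"
        using h_meas by (simp add: split_beta')
      show "(\<lambda>(x, t). e x * (h x t - H x)) \<in> borel_measurable (Q \<Otimes>\<^sub>M \<nu>)"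
        unfolding split_beta' by measurable
    qed
    have F_int: "integrable \<nu> F" unfolding F_def using P.integrable_snd[OF pint] .
    have "(LINT t|\<nu>. F t) = (LINT x|Q. LINT t|\<nu>. e x * (h x t - H x))"
      unfolding F_def using P.Fubini_integral[OF pint] by simp
    also have "\<dots> = (LINT x|Q. 0)"
    proof (rule Bochner_Integration.integral_cong[OF refl])
      fix x assume x: "x \<in> space Q"
      have "(LINT t|\<nu>. e x * (h x t - H x)) = e x * ((LINT t|\<nu>. h x t) - H x)"
        using h_int[OF x] by (simp add: \<nu>.prob_space)
      then show "(LINT t|\<nu>. e x * (h x t - H x)) = 0" by (simp add: H_def)
    qed
    finally have F0: "(LINT t|\<nu>. F t) = 0" by simp
    have "\<exists>t\<in>G \<inter> space \<nu>. F t \<le> 0"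
    proof (rule ccontr)
      assume "\<not> ?thesis"
      then have pos: "AE t in \<nu>. 0 < F t" using G by (auto simp: not_le)
      then have "AE t in \<nu>. 0 \<le> F t" by eventually_elim simp
      then have "AE t in \<nu>. F t = 0"
        using integral_nonneg_eq_0_iff_AE[OF F_int] F0 by blast
      with pos have "AE t in \<nu>. False" by eventually_elim simp
      then show False using \<nu>.AE_False by simp
    qed
    then obtain t where t: "t \<in> G" "t \<in> space \<nu>" "F t \<le> 0" by auto
    note [measurable] = h_x[OF t(2)]
    have i1: "integrable Q (\<lambda>x. (e x)\<^sup>2)"
      using eb by (intro Q.integrable_const_bound[where B="(real m * K)\<^sup>2"]) (auto intro!: AE_I2 abs_le_square_iff[THEN iffD1] simp: K)
    have i2: "integrable Q (\<lambda>x. e x * (h x t - H x))"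
      using prod_bd by (intro Q.integrable_const_bound[where B="real m * K * K"]) auto
    have d2: "(h x t - H x)\<^sup>2 \<le> K\<^sup>2" if "x \<in> space Q" for x
      using d_bd[OF that] K by (intro abs_le_square_iff[THEN iffD1]) auto
    have i3: "integrable Q (\<lambda>x. (h x t - H x)\<^sup>2)"
      using d2 by (intro Q.integrable_const_bound[where B="K\<^sup>2"]) auto
    have "(LINT x|Q. (e x + (h x t - H x))\<^sup>2) = (LINT x|Q. (e x)\<^sup>2 + 2 * (e x * (h x t - H x)) + (h x t - H x)\<^sup>2)"
      by (intro Bochner_Integration.integral_cong) (auto simp: power2_eq_square algebra_simps)
    also have "\<dots> = (LINT x|Q. (e x)\<^sup>2) + 2 * F t + (LINT x|Q. (h x t - H x)\<^sup>2)"
      using i1 i2 i3 by (simp add: F_def)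
    also have "\<dots> \<le> real m * K\<^sup>2 + 2 * 0 + (LINT x|Q. K\<^sup>2)"
      using le t(3) d2 i3 by (intro add_mono integral_mono) (auto simp: e_def)
    finally have "(LINT x|Q. (e x + (h x t - H x))\<^sup>2) \<le> real (Suc m) * K\<^sup>2"
      by (simp add: Q.prob_space algebra_simps)
    then show ?case
      using t \<theta> by (intro exI[of _ "\<theta>(m := t)"]) (auto simp: e_def less_Suc_eq)
  qed
qed

text \<open>The map \<open>f \<mapsto> \<integral> f\<^sup>r dQ\<close> is continuous in \<open>L\<^sup>2\<close>, because \<open>\<bar>u\<^sup>r - v\<^sup>r\<bar> \<le> \<bar>u - v\<bar>\<^sup>r\<close>. Hence the bound for
  finite averages passes to the mixture, with an error of order \<open>(K / \<surd>m)\<^sup>r\<close> that vanishes as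
  \<open>m\<close> grows.\<close>

lemma mixture_moment_le_truncated:
  fixes h :: "'a \<Rightarrow> 'b \<Rightarrow> real"
  assumes Q: "prob_space Q" and \<nu>: "prob_space \<nu>"
    and h_meas: "(\<lambda>(x, \<theta>). h x \<theta>) \<in> borel_measurable (Q \<Otimes>\<^sub>M \<nu>)"
    and h_bd: "\<And>x \<theta>. 0 \<le> h x \<theta>" "\<And>x \<theta>. h x \<theta> \<le> K" and K: "0 < K"
    and G: "AE \<theta> in \<nu>. \<theta> \<in> G"
    and r: "0 < r" "r \<le> 1"
    and avg: "\<And>m \<theta>. 0 < m \<Longrightarrow> (\<And>i. i < m \<Longrightarrow> \<theta> i \<in> G \<inter> space \<nu>) \<Longrightarrow>
      (\<integral>\<^sup>+x. ennreal (((\<Sum>i<m. h x (\<theta> i)) / real m) powr r) \<partial>Q) \<le> c"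
  shows "(\<integral>\<^sup>+x. ennreal ((LINT \<theta>|\<nu>. h x \<theta>) powr r) \<partial>Q) \<le> c"
proof -
  interpret Q: prob_space Q by fact
  interpret \<nu>: prob_space \<nu> by fact
  define H where "H x = (LINT \<theta>|\<nu>. h x \<theta>)" for x
  have h_x: "(\<lambda>x. h x \<theta>) \<in> borel_measurable Q" if "\<theta> \<in> space \<nu>" for \<theta>
    using measurable_compose[OF measurable_Pair2'[OF that, of Q] h_meas] by simp
  have H_meas[measurable]: "H \<in> borel_measurable Q"
    unfolding H_def using h_meas by (intro \<nu>.borel_measurable_lebesgue_integral)
  have H0: "0 \<le> H x" for x unfolding H_def using h_bd by (intro integral_nonneg_AE) auto
  have HK: "H x \<le> K" if "x \<in> space Q" for x
  proof -
    have "h x \<in> borel_measurable \<nu>"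
      using measurable_compose[OF measurable_Pair1'[OF that, of \<nu>] h_meas] by simp
    then have "integrable \<nu> (h x)"
      using h_bd K by (intro \<nu>.integrable_const_bound[where B=K]) auto
    then have "H x \<le> (LINT \<theta>|\<nu>. K)" unfolding H_def using h_bd by (intro integral_mono) auto
    then show "H x \<le> K" by (simp add: \<nu>.prob_space)
  qed
  have main: "(\<integral>\<^sup>+x. ennreal (H x powr r) \<partial>Q) \<le> c + ennreal ((K / sqrt (real (Suc n))) powr r)" for n
  proof -
    define m where "m = Suc n"
    have m: "0 < m" by (simp add: m_def)
    obtain \<theta> where \<theta>: "\<forall>i<m. \<theta> i \<in> G \<inter> space \<nu>"
      and le: "(LINT x|Q. (\<Sum>i<m. h x (\<theta> i) - H x)\<^sup>2) \<le> real m * K\<^sup>2"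
      using greedy_average_L2[OF Q \<nu> h_meas h_bd G, of m] unfolding H_def by blast
    define f where "f x = (\<Sum>i<m. h x (\<theta> i)) / real m" for x
    have f_meas[measurable]: "f \<in> borel_measurable Q"
      unfolding f_def using \<theta> by (intro borel_measurable_divide borel_measurable_sum h_x) auto
    have f0: "0 \<le> f x" for x unfolding f_def using h_bd by (intro divide_nonneg_nonneg sum_nonneg) auto
    have fK: "f x \<le> K" for x
    proof -
      have "(\<Sum>i<m. h x (\<theta> i)) \<le> (\<Sum>i<m. K)" using h_bd by (intro sum_mono)
      then show ?thesis using m by (simp add: f_def divide_le_eq mult.commute)
    qed
    define \<sigma> where "\<sigma> = K / sqrt (real m)"
    have \<sigma>: "0 < \<sigma>" using K m by (simp add: \<sigma>_def)
    have fH: "(\<Sum>i<m. h x (\<theta> i) - H x) = real m * (f x - H x)" for x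
      using m by (simp add: f_def sum_subtractf algebra_simps)
    have "(LINT x|Q. (real m)\<^sup>2 * (f x - H x)\<^sup>2) \<le> real m * K\<^sup>2"
      using le unfolding fH by (simp add: power_mult_distrib)
    then have "(real m)\<^sup>2 * (LINT x|Q. (f x - H x)\<^sup>2) \<le> real m * K\<^sup>2" by simp
    then have "real m * (real m * (LINT x|Q. (f x - H x)\<^sup>2)) \<le> real m * K\<^sup>2"
      by (simp add: power2_eq_square mult.assoc)
    then have l2: "(LINT x|Q. (f x - H x)\<^sup>2) \<le> \<sigma>\<^sup>2"
      using m by (simp add: \<sigma>_def power_divide le_divide_eq mult.commute)
    have i2: "integrable Q (\<lambda>x. (f x - H x)\<^sup>2)"
    proof (rule Q.integrable_const_bound[where B="K\<^sup>2"])
      show "AE x in Q. norm ((f x - H x)\<^sup>2) \<le> K\<^sup>2"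
      proof (rule AE_I2)
        fix x assume "x \<in> space Q"
        then have "\<bar>f x - H x\<bar> \<le> \<bar>K\<bar>" using f0[of x] fK[of x] H0[of x] HK[of x] by linarith
        then have "(f x - H x)\<^sup>2 \<le> K\<^sup>2" by (rule abs_le_square_iff[THEN iffD1])
        then show "norm ((f x - H x)\<^sup>2) \<le> K\<^sup>2" by simp
      qed
    qed measurable
    have d: "\<bar>H x - f x\<bar> powr r \<le> \<sigma> powr r * (r / 2 * ((f x - H x)\<^sup>2 / \<sigma>\<^sup>2) + (1 - r / 2))" for x
    proof -
      have "\<bar>H x - f x\<bar> powr r = \<sigma> powr r * (((f x - H x)\<^sup>2 / \<sigma>\<^sup>2) powr (r / 2) * 1 powr (1 - r / 2))"
      proof (cases "H x = f x")
        case False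
        have "(f x - H x)\<^sup>2 = \<bar>H x - f x\<bar> powr 2" using False by (simp add: power2_commute)
        moreover have "\<sigma>\<^sup>2 = \<sigma> powr 2" using \<sigma> by simp
        ultimately have "((f x - H x)\<^sup>2 / \<sigma>\<^sup>2) powr (r / 2) = \<bar>H x - f x\<bar> powr r / \<sigma> powr r"
          using \<sigma> by (simp only: powr_divide abs_ge_zero powr_ge_zero powr_powr less_imp_le) simp
        then show ?thesis using \<sigma> by simp
      qed simp
      also have "\<dots> \<le> \<sigma> powr r * (r / 2 * ((f x - H x)\<^sup>2 / \<sigma>\<^sup>2) + (1 - r / 2) * 1)"
        using r \<sigma> by (intro mult_left_mono powr_product_le_weighted_sum) auto
      finally show ?thesis by simp
    qed
    have "(\<integral>\<^sup>+x. ennreal (\<bar>H x - f x\<bar> powr r) \<partial>Q)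
       \<le> (\<integral>\<^sup>+x. ennreal (\<sigma> powr r * (r / 2 * ((f x - H x)\<^sup>2 / \<sigma>\<^sup>2) + (1 - r / 2))) \<partial>Q)"
      using d by (intro nn_integral_mono ennreal_leI)
    also have "\<dots> = ennreal (LINT x|Q. \<sigma> powr r * (r / 2 * ((f x - H x)\<^sup>2 / \<sigma>\<^sup>2) + (1 - r / 2)))"
      using i2 r by (intro nn_integral_eq_integral) auto
    also have "(LINT x|Q. \<sigma> powr r * (r / 2 * ((f x - H x)\<^sup>2 / \<sigma>\<^sup>2) + (1 - r / 2)))
       = \<sigma> powr r * (r / 2 * ((LINT x|Q. (f x - H x)\<^sup>2) / \<sigma>\<^sup>2) + (1 - r / 2))"
      using i2 by (simp add: Q.prob_space)
    also have "ennreal \<dots> \<le> ennreal (\<sigma> powr r * (r / 2 * 1 + (1 - r / 2)))"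
      using l2 \<sigma> r by (intro ennreal_leI mult_left_mono add_mono order_refl) auto
    finally have dd: "(\<integral>\<^sup>+x. ennreal (\<bar>H x - f x\<bar> powr r) \<partial>Q) \<le> ennreal (\<sigma> powr r)" by simp
    have "(\<integral>\<^sup>+x. ennreal (H x powr r) \<partial>Q) \<le> (\<integral>\<^sup>+x. ennreal (f x powr r) + ennreal (\<bar>H x - f x\<bar> powr r) \<partial>Q)"
      using powr_le_add_abs_diff[OF H0 f0 r]
      by (intro nn_integral_mono) (simp add: ennreal_plus[symmetric] ennreal_leI del: ennreal_plus)
    also have "\<dots> = (\<integral>\<^sup>+x. ennreal (f x powr r) \<partial>Q) + (\<integral>\<^sup>+x. ennreal (\<bar>H x - f x\<bar> powr r) \<partial>Q)"
      by (intro nn_integral_add) measurable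
    also have "\<dots> \<le> c + ennreal (\<sigma> powr r)"
      using avg[OF m, of \<theta>] \<theta> dd unfolding f_def by (intro add_mono) auto
    finally show ?thesis by (simp add: \<sigma>_def m_def)
  qed
  have "(\<lambda>n. (K / sqrt (real (Suc n)))) \<longlonglongrightarrow> 0"
    by real_asymp
  then have "(\<lambda>n. (K / sqrt (real (Suc n))) powr r) \<longlonglongrightarrow> 0 powr r"
    using r K by (intro tendsto_powr') auto
  then have "(\<lambda>n. c + ennreal ((K / sqrt (real (Suc n))) powr r)) \<longlonglongrightarrow> c + ennreal 0"
    using r by (intro tendsto_add tendsto_const tendsto_ennrealI) simp
  then have "(\<integral>\<^sup>+x. ennreal (H x powr r) \<partial>Q) \<le> c + ennreal 0"
    using main by (intro LIMSEQ_le_const) auto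
  then show ?thesis by (simp add: H_def)
qed

text \<open>A hypothesis on convex hulls speaks of finite convex combinations only, while a posterior
  predictive density is a mixture over infinitely many parameters. A bound on fractional moments
  carries over: truncation of \<open>g\<close> at level \<open>K\<close> decreases the finite averages, so that they still
  obey the bound, and monotone convergence in \<open>K\<close> removes the truncation.\<close>

theorem mixture_moment_le:
  fixes g :: "'a \<Rightarrow> 'b \<Rightarrow> real"
  assumes Q: "prob_space Q" and \<nu>: "prob_space \<nu>"
    and g_meas: "(\<lambda>(x, \<theta>). g x \<theta>) \<in> borel_measurable (Q \<Otimes>\<^sub>M \<nu>)"
    and g_nonneg: "\<And>x \<theta>. 0 \<le> g x \<theta>"
    and G: "AE \<theta> in \<nu>. \<theta> \<in> G"
    and r: "0 < r" "r \<le> 1"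
    and avg: "\<And>m \<theta>. 0 < m \<Longrightarrow> (\<And>i. i < m \<Longrightarrow> \<theta> i \<in> G \<inter> space \<nu>) \<Longrightarrow>
      (\<integral>\<^sup>+x. ennreal (((\<Sum>i<m. g x (\<theta> i)) / real m) powr r) \<partial>Q) \<le> c"
  shows "(\<integral>\<^sup>+x. epow (\<integral>\<^sup>+\<theta>. ennreal (g x \<theta>) \<partial>\<nu>) r \<partial>Q) \<le> c"
proof -
  interpret Q: prob_space Q by fact
  interpret \<nu>: prob_space \<nu> by fact
  define h where "h n x \<theta> = min (g x \<theta>) (real (Suc n))" for n x \<theta>
  have [measurable]: "(\<lambda>z. g (fst z) (snd z)) \<in> borel_measurable (Q \<Otimes>\<^sub>M \<nu>)"
    using g_meas by (simp add: split_beta')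
  have h_meas: "(\<lambda>(x, \<theta>). h n x \<theta>) \<in> borel_measurable (Q \<Otimes>\<^sub>M \<nu>)" for n
    unfolding h_def split_beta' by measurable
  have h_t[measurable]: "h n x \<in> borel_measurable \<nu>" if "x \<in> space Q" for x n
    using measurable_compose[OF measurable_Pair1'[OF that, of \<nu>] h_meas] by simp
  have hb: "0 \<le> h n x \<theta>" "h n x \<theta> \<le> real (Suc n)" for n x \<theta>
    using g_nonneg by (auto simp: h_def)
  have trunc: "(\<integral>\<^sup>+x. ennreal ((LINT \<theta>|\<nu>. h n x \<theta>) powr r) \<partial>Q) \<le> c" for n
  proof (rule mixture_moment_le_truncated[OF Q \<nu> h_meas hb _ G r])
    fix m :: nat and \<theta> :: "nat \<Rightarrow> 'b"
    assume m: "0 < m" and \<theta>: "\<And>i. i < m \<Longrightarrow> \<theta> i \<in> G \<inter> space \<nu>"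
    have "(\<integral>\<^sup>+x. ennreal (((\<Sum>i<m. h n x (\<theta> i)) / real m) powr r) \<partial>Q)
       \<le> (\<integral>\<^sup>+x. ennreal (((\<Sum>i<m. g x (\<theta> i)) / real m) powr r) \<partial>Q)"
      using r hb g_nonneg by (intro nn_integral_mono ennreal_leI powr_mono2 divide_right_mono sum_mono divide_nonneg_nonneg sum_nonneg)
        (auto simp: h_def)
    also have "\<dots> \<le> c" using m \<theta> by (rule avg)
    finally show "(\<integral>\<^sup>+x. ennreal (((\<Sum>i<m. h n x (\<theta> i)) / real m) powr r) \<partial>Q) \<le> c" .
  qed auto
  have h_eq: "ennreal (LINT \<theta>|\<nu>. h n x \<theta>) = (\<integral>\<^sup>+\<theta>. ennreal (h n x \<theta>) \<partial>\<nu>)" if "x \<in> space Q" for n x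
    using hb that by (intro nn_integral_eq_integral[symmetric] \<nu>.integrable_const_bound[where B="real (Suc n)"]) auto
  have int0: "0 \<le> (LINT \<theta>|\<nu>. h n x \<theta>)" for n x using hb by (intro integral_nonneg_AE) auto
  have hinc: "h n x \<theta> \<le> h (Suc n) x \<theta>" for n x \<theta> by (auto simp: h_def)
  have hsup: "(SUP n. ennreal (h n x \<theta>)) = ennreal (g x \<theta>)" for x \<theta>
  proof (rule antisym)
    show "(SUP n. ennreal (h n x \<theta>)) \<le> ennreal (g x \<theta>)"
      by (intro SUP_least ennreal_leI) (simp add: h_def)
    obtain n where "g x \<theta> \<le> real n" using real_arch_simple by blast
    then have "g x \<theta> = h n x \<theta>" by (simp add: h_def)
    then show "ennreal (g x \<theta>) \<le> (SUP n. ennreal (h n x \<theta>))"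
      by (metis SUP_upper UNIV_I)
  qed
  have inc1: "incseq (\<lambda>n. \<integral>\<^sup>+\<theta>. ennreal (h n x \<theta>) \<partial>\<nu>)" for x
    using hinc by (intro incseq_SucI nn_integral_mono ennreal_leI)
  have split: "(\<integral>\<^sup>+\<theta>. ennreal (g x \<theta>) \<partial>\<nu>) = (SUP n. \<integral>\<^sup>+\<theta>. ennreal (h n x \<theta>) \<partial>\<nu>)" if "x \<in> space Q" for x
    unfolding hsup[symmetric] using hinc that
    by (intro nn_integral_monotone_convergence_SUP) (auto simp: incseq_Suc_iff le_fun_def ennreal_leI)
  have "(\<integral>\<^sup>+x. epow (\<integral>\<^sup>+\<theta>. ennreal (g x \<theta>) \<partial>\<nu>) r \<partial>Q)
      = (\<integral>\<^sup>+x. (SUP n. epow (\<integral>\<^sup>+\<theta>. ennreal (h n x \<theta>) \<partial>\<nu>) r) \<partial>Q)"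
    using split r inc1 by (intro nn_integral_cong) (simp add: epow_SUP)
  also have "\<dots> = (SUP n. \<integral>\<^sup>+x. epow (\<integral>\<^sup>+\<theta>. ennreal (h n x \<theta>) \<partial>\<nu>) r \<partial>Q)"
  proof (rule nn_integral_monotone_convergence_SUP)
    show "incseq (\<lambda>n x. epow (\<integral>\<^sup>+\<theta>. ennreal (h n x \<theta>) \<partial>\<nu>) r)"
      using inc1 r by (auto simp: incseq_def le_fun_def intro!: epow_mono)
    fix n
    have "(\<lambda>(x, \<theta>). ennreal (h n x \<theta>)) \<in> borel_measurable (Q \<Otimes>\<^sub>M \<nu>)"
      using h_meas[of n] unfolding split_beta' by measurable
    then have [measurable]: "(\<lambda>x. \<integral>\<^sup>+\<theta>. ennreal (h n x \<theta>) \<partial>\<nu>) \<in> borel_measurable Q"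
      by (rule \<nu>.borel_measurable_nn_integral)
    show "(\<lambda>x. epow (\<integral>\<^sup>+\<theta>. ennreal (h n x \<theta>) \<partial>\<nu>) r) \<in> borel_measurable Q"
      by measurable
  qed
  also have "\<dots> = (SUP n. \<integral>\<^sup>+x. ennreal ((LINT \<theta>|\<nu>. h n x \<theta>) powr r) \<partial>Q)"
    using h_eq int0 by (intro SUP_cong refl nn_integral_cong) (simp flip: h_eq)
  also have "\<dots> \<le> c" using trunc by (intro SUP_least)
  finally show ?thesis .
qed

section \<open>Fractional moments of integrated product likelihoods\<close>

text \<open>Both sides are homogeneous of degree \<open>r\<close> in \<open>\<nu>\<close>, so probability measures suffice. Measures of
  infinite mass have to be admitted, since the reweighted priors of the next induction may be infinite.\<close>

lemma mixture_moment_le_scaled: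
  fixes g :: "'a \<Rightarrow> 'b \<Rightarrow> real"
  assumes Q: "prob_space Q"
    and g_meas: "(\<lambda>(x, \<theta>). g x \<theta>) \<in> borel_measurable (Q \<Otimes>\<^sub>M \<nu>)"
    and g_nonneg: "\<And>x \<theta>. 0 \<le> g x \<theta>"
    and G: "AE \<theta> in \<nu>. \<theta> \<in> G"
    and r: "0 < r" "r \<le> 1" and c: "0 < c"
    and avg: "\<And>m \<theta>. 0 < m \<Longrightarrow> (\<And>i. i < m \<Longrightarrow> \<theta> i \<in> G \<inter> space \<nu>) \<Longrightarrow>
      (\<integral>\<^sup>+x. ennreal (((\<Sum>i<m. g x (\<theta> i)) / real m) powr r) \<partial>Q) \<le> c"
  shows "(\<integral>\<^sup>+x. epow (\<integral>\<^sup>+\<theta>. ennreal (g x \<theta>) \<partial>\<nu>) r \<partial>Q) \<le> c * epow (emeasure \<nu> (space \<nu>)) r"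
proof (cases "emeasure \<nu> (space \<nu>)")
  case top
  then show ?thesis using c by (simp add: ennreal_mult_eq_top_iff)
next
  case (real a)
  show ?thesis
  proof (cases "a = 0")
    case True
    then have "AE \<theta> in \<nu>. False" using real by (auto intro!: AE_I'[of "space \<nu>"] null_setsI)
    then have "(\<integral>\<^sup>+\<theta>. ennreal (g x \<theta>) \<partial>\<nu>) = 0" for x
      by (subst nn_integral_cong_AE[where v="\<lambda>_. 0"]) auto
    then show ?thesis by simp
  next
    case False
    then have a: "0 < a" using real by simp
    define \<nu>' where "\<nu>' = density \<nu> (\<lambda>_. ennreal (1 / a))"
    have sets: "sets \<nu>' = sets \<nu>" and space: "space \<nu>' = space \<nu>" by (simp_all add: \<nu>'_def)
    have pr: "prob_space \<nu>'"
    proof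
      have "emeasure \<nu>' (space \<nu>') = ennreal (1 / a) * ennreal a"
        using real by (simp add: \<nu>'_def emeasure_density nn_integral_cmult_indicator)
      then show "emeasure \<nu>' (space \<nu>') = 1" using a by (simp flip: ennreal_mult)
    qed
    have gm: "(\<lambda>(x, \<theta>). g x \<theta>) \<in> borel_measurable (Q \<Otimes>\<^sub>M \<nu>')"
      using g_meas measurable_cong_sets[OF sets_pair_measure_cong[OF refl sets] refl] by blast
    have G': "AE \<theta> in \<nu>'. \<theta> \<in> G" unfolding \<nu>'_def using G by (subst AE_density) auto
    have "(\<integral>\<^sup>+\<theta>. ennreal (g x \<theta>) \<partial>\<nu>) = ennreal a * (\<integral>\<^sup>+\<theta>. ennreal (g x \<theta>) \<partial>\<nu>')" if "x \<in> space Q" for x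
    proof -
      have [measurable]: "g x \<in> borel_measurable \<nu>"
        using measurable_compose[OF measurable_Pair1'[OF that, of \<nu>] g_meas] by simp
      have "(\<integral>\<^sup>+\<theta>. ennreal (g x \<theta>) \<partial>\<nu>') = ennreal (1 / a) * (\<integral>\<^sup>+\<theta>. ennreal (g x \<theta>) \<partial>\<nu>)"
        unfolding \<nu>'_def by (subst nn_integral_density) (auto simp: nn_integral_cmult)
      then show ?thesis using a by (simp add: mult.assoc[symmetric] ennreal_mult[symmetric])
    qed
    then have "(\<integral>\<^sup>+x. epow (\<integral>\<^sup>+\<theta>. ennreal (g x \<theta>) \<partial>\<nu>) r \<partial>Q)
       = (\<integral>\<^sup>+x. ennreal (a powr r) * epow (\<integral>\<^sup>+\<theta>. ennreal (g x \<theta>) \<partial>\<nu>') r \<partial>Q)"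
      using a r by (intro nn_integral_cong) (simp add: epow_mult)
    also have "\<dots> = ennreal (a powr r) * (\<integral>\<^sup>+x. epow (\<integral>\<^sup>+\<theta>. ennreal (g x \<theta>) \<partial>\<nu>') r \<partial>Q)"
    proof (rule nn_integral_cmult)
      interpret \<nu>': prob_space \<nu>' by fact
      have "(\<lambda>(x, \<theta>). ennreal (g x \<theta>)) \<in> borel_measurable (Q \<Otimes>\<^sub>M \<nu>')"
        using gm unfolding split_beta' by measurable
      then have [measurable]: "(\<lambda>x. \<integral>\<^sup>+\<theta>. ennreal (g x \<theta>) \<partial>\<nu>') \<in> borel_measurable Q"
        by (rule \<nu>'.borel_measurable_nn_integral)
      show "(\<lambda>x. epow (\<integral>\<^sup>+\<theta>. ennreal (g x \<theta>) \<partial>\<nu>') r) \<in> borel_measurable Q" by measurable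
    qed
    also have "\<dots> \<le> ennreal (a powr r) * c"
      using mixture_moment_le[OF Q pr gm g_nonneg G' r, of c] avg unfolding space
      by (intro mult_left_mono) auto
    finally show ?thesis using real by (simp add: mult.commute)
  qed
qed

lemma measurable_product_likelihood:
  fixes g :: "'a \<Rightarrow> 'b \<Rightarrow> real"
  assumes g_meas: "(\<lambda>(x, \<theta>). g x \<theta>) \<in> borel_measurable (Q \<Otimes>\<^sub>M \<nu>)"
  shows "(\<lambda>(x, \<theta>). \<Prod>i\<in>I. g (x i) \<theta>) \<in> borel_measurable (PiM I (\<lambda>_. Q) \<Otimes>\<^sub>M \<nu>)"
proof -
  have "(\<lambda>z. g (fst z i) (snd z)) \<in> borel_measurable (PiM I (\<lambda>_. Q) \<Otimes>\<^sub>M \<nu>)" if "i \<in> I" for i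
  proof -
    have "(\<lambda>z. (fst z i, snd z)) \<in> measurable (PiM I (\<lambda>_. Q) \<Otimes>\<^sub>M \<nu>) (Q \<Otimes>\<^sub>M \<nu>)"
      using that by measurable
    from measurable_compose[OF this g_meas] show ?thesis by simp
  qed
  then show ?thesis unfolding split_beta' by (rule borel_measurable_prod)
qed

text \<open>Le Cam's convex hull argument. Conditionally on the observations seen so far, the likelihood
  of the next one is a mixture over \<open>G\<close> under the prior reweighted by the past likelihood, and its
  fractional moment contributes one more factor \<open>c\<close>. In this way a bound on single observations
  tensorizes, although the integrated likelihood itself does not factorize.\<close>

lemma product_mixture_moment_le:
  fixes g :: "'a \<Rightarrow> 'b \<Rightarrow> real"
  assumes Q: "prob_space Q" and \<nu>: "finite_measure \<nu>"
    and g_meas: "(\<lambda>(x, \<theta>). g x \<theta>) \<in> borel_measurable (Q \<Otimes>\<^sub>M \<nu>)"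
    and g_nonneg: "\<And>x \<theta>. 0 \<le> g x \<theta>"
    and G: "AE \<theta> in \<nu>. \<theta> \<in> G"
    and r: "0 < r" "r \<le> 1" and c: "0 < c"
    and avg: "\<And>m \<theta>. 0 < m \<Longrightarrow> (\<And>i. i < m \<Longrightarrow> \<theta> i \<in> G \<inter> space \<nu>) \<Longrightarrow>
      (\<integral>\<^sup>+x. ennreal (((\<Sum>i<m. g x (\<theta> i)) / real m) powr r) \<partial>Q) \<le> c"
    and I: "finite I"
  shows "(\<integral>\<^sup>+x. epow (\<integral>\<^sup>+\<theta>. ennreal (\<Prod>i\<in>I. g (x i) \<theta>) \<partial>\<nu>) r \<partial>PiM I (\<lambda>_. Q))
    \<le> c ^ card I * epow (emeasure \<nu> (space \<nu>)) r"
  using I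
proof induction
  case empty
  show ?case by (simp add: PiM_empty)
next
  case (insert i I)
  interpret Q: prob_space Q by fact
  interpret \<nu>: finite_measure \<nu> by fact
  interpret product_sigma_finite "\<lambda>_. Q" ..
  let ?L = "\<lambda>I x \<theta>. \<Prod>i\<in>I. g (x i) \<theta>"
  have E_meas[measurable]: "(\<lambda>x. \<integral>\<^sup>+\<theta>. ennreal (?L J x \<theta>) \<partial>\<nu>) \<in> borel_measurable (PiM J (\<lambda>_. Q))" for J
  proof -
    have "(\<lambda>(x, \<theta>). ennreal (?L J x \<theta>)) \<in> borel_measurable (PiM J (\<lambda>_. Q) \<Otimes>\<^sub>M \<nu>)"
      using measurable_product_likelihood[OF g_meas, of J] unfolding split_beta' by measurable
    then show ?thesis by (rule \<nu>.borel_measurable_nn_integral)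
  qed
  have "(\<integral>\<^sup>+x. epow (\<integral>\<^sup>+\<theta>. ennreal (?L (insert i I) x \<theta>) \<partial>\<nu>) r \<partial>PiM (insert i I) (\<lambda>_. Q))
    = (\<integral>\<^sup>+x. \<integral>\<^sup>+y. epow (\<integral>\<^sup>+\<theta>. ennreal (?L (insert i I) (x(i := y)) \<theta>) \<partial>\<nu>) r \<partial>Q \<partial>PiM I (\<lambda>_. Q))"
    using insert by (intro product_nn_integral_insert measurable_epow E_meas)
  also have "\<dots> \<le> (\<integral>\<^sup>+x. c * epow (\<integral>\<^sup>+\<theta>. ennreal (?L I x \<theta>) \<partial>\<nu>) r \<partial>PiM I (\<lambda>_. Q))"
  proof (rule nn_integral_mono)
    fix x assume x: "x \<in> space (PiM I (\<lambda>_. Q))"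
    have [measurable]: "?L I x \<in> borel_measurable \<nu>"
      using measurable_compose[OF measurable_Pair1'[OF x, of \<nu>] measurable_product_likelihood[OF g_meas, of I]] by simp
    \<comment> \<open>Given the coordinates in \<open>I\<close>, the new coordinate sees the parameter under the prior
      reweighted by the likelihood so far.\<close>
    define \<nu>x where "\<nu>x = density \<nu> (\<lambda>\<theta>. ennreal (?L I x \<theta>))"
    have sets: "sets \<nu>x = sets \<nu>" and space: "space \<nu>x = space \<nu>" by (simp_all add: \<nu>x_def)
    have "(\<integral>\<^sup>+\<theta>. ennreal (?L (insert i I) (x(i := y)) \<theta>) \<partial>\<nu>) = (\<integral>\<^sup>+\<theta>. ennreal (g y \<theta>) \<partial>\<nu>x)"
      if y: "y \<in> space Q" for y
    proof -
      have [measurable]: "g y \<in> borel_measurable \<nu>"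
        using measurable_compose[OF measurable_Pair1'[OF y, of \<nu>] g_meas] by simp
      have "?L (insert i I) (x(i := y)) \<theta> = ?L I x \<theta> * g y \<theta>" for \<theta>
      proof -
        have "(\<Prod>j\<in>I. g ((x(i := y)) j) \<theta>) = ?L I x \<theta>"
          using insert by (intro prod.cong) auto
        then show ?thesis using insert by (simp add: mult.commute)
      qed
      then show ?thesis unfolding \<nu>x_def
        by (subst nn_integral_density) (auto simp: ennreal_mult g_nonneg prod_nonneg)
    qed
    then have "(\<integral>\<^sup>+y. epow (\<integral>\<^sup>+\<theta>. ennreal (?L (insert i I) (x(i := y)) \<theta>) \<partial>\<nu>) r \<partial>Q)
      = (\<integral>\<^sup>+y. epow (\<integral>\<^sup>+\<theta>. ennreal (g y \<theta>) \<partial>\<nu>x) r \<partial>Q)"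
      by (intro nn_integral_cong) simp
    also have "\<dots> \<le> c * epow (emeasure \<nu>x (space \<nu>x)) r"
    proof (rule mixture_moment_le_scaled[OF Q _ g_nonneg _ r c])
      show "(\<lambda>(x, \<theta>). g x \<theta>) \<in> borel_measurable (Q \<Otimes>\<^sub>M \<nu>x)"
        using g_meas measurable_cong_sets[OF sets_pair_measure_cong[OF refl sets] refl] by blast
      show "AE \<theta> in \<nu>x. \<theta> \<in> G" unfolding \<nu>x_def using G by (subst AE_density) auto
    qed (use avg space in auto)
    also have "emeasure \<nu>x (space \<nu>x) = (\<integral>\<^sup>+\<theta>. ennreal (?L I x \<theta>) \<partial>\<nu>)"
      unfolding \<nu>x_def by (simp add: emeasure_density cong: nn_integral_cong)
    finally show "(\<integral>\<^sup>+y. epow (\<integral>\<^sup>+\<theta>. ennreal (?L (insert i I) (x(i := y)) \<theta>) \<partial>\<nu>) r \<partial>Q)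
      \<le> c * epow (\<integral>\<^sup>+\<theta>. ennreal (?L I x \<theta>) \<partial>\<nu>) r" .
  qed
  also have "\<dots> = c * (\<integral>\<^sup>+x. epow (\<integral>\<^sup>+\<theta>. ennreal (?L I x \<theta>) \<partial>\<nu>) r \<partial>PiM I (\<lambda>_. Q))"
    by (rule nn_integral_cmult) measurable
  also have "\<dots> \<le> c * (c ^ card I * epow (emeasure \<nu> (space \<nu>)) r)"
    using insert by (intro mult_left_mono) auto
  finally show ?case using insert by (simp add: mult.assoc)
qed

section \<open>Moments of sums over a cover\<close>

text \<open>Here \<open>s \<ge> r\<close>. Each \<open>N j\<close> is controlled in the orders 1 and \<open>r\<close>, hence by interpolation in the
  order \<open>s\<close>, where \<open>1 / k\<close> is the weight of the order \<open>r\<close>. Subadditivity of the power then sums up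
  the pieces.\<close>

lemma sum_moment_le_of_large_exponent:
  assumes N[measurable]: "\<And>j. N j \<in> borel_measurable P"
    and m0: "\<And>j. 0 \<le> m j"
    and EN: "\<And>j. (\<integral>\<^sup>+x. N j x \<partial>P) \<le> ennreal (m j)"
    and ENr: "\<And>j. (\<integral>\<^sup>+x. epow (N j x) r \<partial>P) \<le> ennreal (c * m j powr r)"
    and r: "0 < r" "r \<le> 1" and c: "0 < c" and k: "1 \<le> k"
    and s: "s = 1 - (1 - r) / k"
    and a: "\<And>j. m j powr s \<le> a j" and U: "(\<Sum>j. ennreal (a j)) \<le> ennreal U"
  shows "(\<integral>\<^sup>+x. epow (\<Sum>j. N j x) s \<partial>P) \<le> ennreal (c powr (1 / k) * U)"
proof -
  define w where "w = 1 / k"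
  have w: "0 < w" "w \<le> 1" using k by (auto simp: w_def)
  have sw: "s = (1 - w) + w * r" by (simp add: s w_def diff_divide_distrib)
  have s1: "0 < s" "s \<le> 1"
    using r w mult_left_mono[of r 1 w] by (auto simp: sw add_nonneg_pos)
  have each: "(\<integral>\<^sup>+x. epow (N j x) s \<partial>P) \<le> ennreal (c powr w) * ennreal (m j powr s)" for j
  proof (cases "m j = 0")
    case True
    then have "(\<integral>\<^sup>+x. N j x \<partial>P) = 0" using EN[of j] by simp
    then have "AE x in P. N j x = 0" by (subst (asm) nn_integral_0_iff_AE) auto
    then have "(\<integral>\<^sup>+x. epow (N j x) s \<partial>P) = (\<integral>\<^sup>+x. 0 \<partial>P)"
      by (intro nn_integral_cong_AE) auto
    then show ?thesis by simp
  next
    case False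
    then have m: "0 < m j" using m0[of j] by simp
    have "(\<integral>\<^sup>+x. epow (N j x) s \<partial>P) \<le> (\<integral>\<^sup>+x. ennreal (m j powr s * c powr w) *
       (ennreal ((1 - w) / m j) * N j x + ennreal (w / (m j powr r * c)) * epow (N j x) r) \<partial>P)"
      using w m c r sw by (intro nn_integral_mono epow_interpolate) auto
    also have "\<dots> = ennreal (m j powr s * c powr w) *
       (ennreal ((1 - w) / m j) * (\<integral>\<^sup>+x. N j x \<partial>P) + ennreal (w / (m j powr r * c)) * (\<integral>\<^sup>+x. epow (N j x) r \<partial>P))"
      by (simp add: nn_integral_cmult nn_integral_add)
    also have "\<dots> \<le> ennreal (m j powr s * c powr w) *
       (ennreal ((1 - w) / m j) * ennreal (m j) + ennreal (w / (m j powr r * c)) * ennreal (c * m j powr r))"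
      by (intro mult_left_mono add_mono EN ENr) auto
    also have "\<dots> = ennreal (m j powr s * c powr w) * (ennreal (1 - w) + ennreal w)"
      using m c w by (simp add: ennreal_mult[symmetric])
    also have "\<dots> = ennreal (m j powr s * c powr w)"
      using w by (simp add: ennreal_plus[symmetric] del: ennreal_plus)
    finally show ?thesis by (simp add: ennreal_mult[symmetric] mult.commute)
  qed
  have "(\<integral>\<^sup>+x. epow (\<Sum>j. N j x) s \<partial>P) \<le> (\<integral>\<^sup>+x. (\<Sum>j. epow (N j x) s) \<partial>P)"
    using s1 by (intro nn_integral_mono epow_suminf_le)
  also have "\<dots> = (\<Sum>j. \<integral>\<^sup>+x. epow (N j x) s \<partial>P)"
    by (intro nn_integral_suminf) measurable
  also have "\<dots> \<le> (\<Sum>j. ennreal (c powr w) * ennreal (a j))"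
    using each a by (intro suminf_le) (auto intro!: order_trans[OF each] mult_left_mono ennreal_leI)
  also have "\<dots> = ennreal (c powr w) * (\<Sum>j. ennreal (a j))" by (rule ennreal_suminf_cmult)
  also have "\<dots> \<le> ennreal (c powr w) * ennreal U" by (intro mult_left_mono U) auto
  finally show ?thesis by (simp add: ennreal_mult' w_def)
qed

text \<open>Here \<open>s \<le> r\<close> unless \<open>k = 0\<close>. The moments are summed in the order \<open>r\<close>, and \<open>\<Sum> m\<^sup>r\<close> is interpolated between \<open>\<Sum> m\<^sup>s\<close> and
  \<open>\<Sum> m\<close>. The total mass \<open>V\<close> must be kept in the bound: when \<open>k\<close> is close to 0, all of the saving
  comes from it.\<close>

lemma sum_moment_le_of_small_exponent:
  assumes N[measurable]: "\<And>j. N j \<in> borel_measurable P"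
    and m0: "\<And>j. 0 \<le> m j"
    and ENr: "\<And>j. (\<integral>\<^sup>+x. epow (N j x) r \<partial>P) \<le> ennreal (c * m j powr r)"
    and r: "0 < r" "r \<le> 1" and c: "0 < c" and k: "0 \<le> k" "k \<le> 1"
    and s: "r = s * k + (1 - k)"
    and a: "\<And>j. m j powr s \<le> a j" and U: "(\<Sum>j. ennreal (a j)) \<le> ennreal U" "0 < U"
    and V: "(\<Sum>j. ennreal (m j)) \<le> ennreal V" "0 < V"
  shows "(\<integral>\<^sup>+x. epow (\<Sum>j. N j x) r \<partial>P) \<le> ennreal (c * (U powr k * V powr (1 - k)))"
proof -
  define K where "K = U powr k * V powr (1 - k)"
  have K: "0 < K" using U V by (simp add: K_def)
  have a0: "0 \<le> a j" for j using a[of j] powr_ge_zero[of "m j" s] by linarith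
  have pt: "m j powr r \<le> K * (k / U * a j + (1 - k) / V * m j)" for j
  proof -
    have "m j powr r = (m j powr s) powr k * m j powr (1 - k)"
      by (simp add: s powr_powr powr_add)
    also have "\<dots> \<le> a j powr k * m j powr (1 - k)"
      using a k by (intro mult_right_mono powr_mono2) auto
    also have "\<dots> = K * ((a j / U) powr k * (m j / V) powr (1 - k))"
      using U V a0 m0 by (simp add: K_def powr_divide)
    also have "\<dots> \<le> K * (k * (a j / U) + (1 - k) * (m j / V))"
      using K U V a0 m0 k by (intro mult_left_mono powr_product_le_weighted_sum) auto
    finally show ?thesis by simp
  qed
  have "(\<Sum>j. ennreal (m j powr r)) \<le> (\<Sum>j. ennreal K * (ennreal (k / U) * ennreal (a j) + ennreal ((1 - k) / V) * ennreal (m j)))"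
  proof (rule suminf_le)
    fix j
    show "ennreal (m j powr r) \<le> ennreal K * (ennreal (k / U) * ennreal (a j) + ennreal ((1 - k) / V) * ennreal (m j))"
    proof -
      have "ennreal K * (ennreal (k / U) * ennreal (a j) + ennreal ((1 - k) / V) * ennreal (m j))
        = ennreal (K * (k / U * a j + (1 - k) / V * m j))"
        using K k U V a0[of j] m0[of j]
        by (simp add: ennreal_mult[symmetric] ennreal_plus[symmetric] del: ennreal_plus)
      then show ?thesis using ennreal_leI[OF pt[of j]] by simp
    qed
  qed auto
  also have "\<dots> = ennreal K * (ennreal (k / U) * (\<Sum>j. ennreal (a j)) + ennreal ((1 - k) / V) * (\<Sum>j. ennreal (m j)))"
    by (simp add: suminf_add[symmetric])
  also have "\<dots> \<le> ennreal K * (ennreal (k / U) * ennreal U + ennreal ((1 - k) / V) * ennreal V)"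
    by (intro mult_left_mono add_mono U V) auto
  also have "\<dots> = ennreal K * (ennreal k + ennreal (1 - k))"
    using U V k by (simp add: ennreal_mult[symmetric])
  also have "\<dots> = ennreal K" using k by (simp add: ennreal_plus[symmetric] del: ennreal_plus)
  finally have S: "(\<Sum>j. ennreal (m j powr r)) \<le> ennreal K" .
  have "(\<integral>\<^sup>+x. epow (\<Sum>j. N j x) r \<partial>P) \<le> (\<integral>\<^sup>+x. (\<Sum>j. epow (N j x) r) \<partial>P)"
    using r by (intro nn_integral_mono epow_suminf_le)
  also have "\<dots> = (\<Sum>j. \<integral>\<^sup>+x. epow (N j x) r \<partial>P)"
    by (intro nn_integral_suminf) measurable
  also have "\<dots> \<le> (\<Sum>j. ennreal c * ennreal (m j powr r))"
    using ENr c by (intro suminf_le) (auto simp: ennreal_mult)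
  also have "\<dots> = ennreal c * (\<Sum>j. ennreal (m j powr r))" by (rule ennreal_suminf_cmult)
  also have "\<dots> \<le> ennreal c * ennreal K" by (intro mult_left_mono S) auto
  finally show ?thesis using c by (simp add: ennreal_mult' K_def)
qed

section \<open>Expected log-evidence and the probability of bad events\<close>

text \<open>Let \<open>D = \<integral> L d\<pi>\<close>. Since \<open>e\<^sup>W D \<le> 1\<close>, the double integral of \<open>e\<^sup>W L\<close> is at most 1, so some \<open>\<theta> \<in> B\<close> satisfies
  \<open>\<integral> e\<^sup>W L\<^sub>\<theta> dP \<le> 1 / \<pi>(B)\<close>; Jensen's inequality for the logarithm at this single \<open>\<theta>\<close> is the claim.
  Allowing any minorant \<open>W\<close> of \<open>- ln D\<close> avoids the question whether \<open>ln D\<close> is integrable.\<close>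

lemma expectation_le_of_exp_evidence:
  fixes L :: "'x \<Rightarrow> 'b \<Rightarrow> real"
  assumes P: "prob_space P" and \<pi>: "prob_space \<pi>"
    and L_meas: "(\<lambda>(x, \<theta>). L x \<theta>) \<in> borel_measurable (P \<Otimes>\<^sub>M \<pi>)"
    and W: "integrable P W"
    and WL: "AE x in P. ennreal (exp (W x)) * (\<integral>\<^sup>+\<theta>. ennreal (L x \<theta>) \<partial>\<pi>) \<le> 1"
    and B: "B \<in> sets \<pi>" "0 < measure \<pi> B"
    and pos: "\<And>\<theta>. \<theta> \<in> B \<Longrightarrow> AE x in P. 0 < L x \<theta>"
    and int: "\<And>\<theta>. \<theta> \<in> B \<Longrightarrow> integrable P (\<lambda>x. ln (L x \<theta>))"
    and ln: "\<And>\<theta>. \<theta> \<in> B \<Longrightarrow> - \<kappa> \<le> (LINT x|P. ln (L x \<theta>))"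
  shows "(LINT x|P. W x) \<le> \<kappa> - ln (measure \<pi> B)"
proof -
  interpret P: prob_space P by fact
  interpret \<pi>: prob_space \<pi> by fact
  interpret PP: pair_prob_space P \<pi> ..
  define b where "b = measure \<pi> B"
  have b: "0 < b" using B by (simp add: b_def)
  have [measurable]: "W \<in> borel_measurable P" using W by auto
  have [measurable]: "(\<lambda>z. L (fst z) (snd z)) \<in> borel_measurable (P \<Otimes>\<^sub>M \<pi>)"
    using L_meas by (simp add: split_beta')
  note [measurable] = B(1)
  define R where "R \<theta> = (\<integral>\<^sup>+x. ennreal (exp (W x)) * ennreal (L x \<theta>) \<partial>P)" for \<theta>
  have Rm0: "(\<lambda>(x, \<theta>). ennreal (exp (W x)) * ennreal (L x \<theta>)) \<in> borel_measurable (P \<Otimes>\<^sub>M \<pi>)"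
    unfolding split_beta' by measurable
  have R_meas[measurable]: "R \<in> borel_measurable \<pi>"
    unfolding R_def by (rule P.borel_measurable_nn_integral) (use measurable_pair_swap[OF Rm0] in \<open>simp add: split_beta'\<close>)
  have "(\<integral>\<^sup>+\<theta>. R \<theta> \<partial>\<pi>) = (\<integral>\<^sup>+x. \<integral>\<^sup>+\<theta>. ennreal (exp (W x)) * ennreal (L x \<theta>) \<partial>\<pi> \<partial>P)"
    unfolding R_def using PP.Fubini'[OF Rm0] by simp
  also have "\<dots> = (\<integral>\<^sup>+x. ennreal (exp (W x)) * (\<integral>\<^sup>+\<theta>. ennreal (L x \<theta>) \<partial>\<pi>) \<partial>P)"
  proof (rule nn_integral_cong)
    fix x assume x: "x \<in> space P"
    have "L x \<in> borel_measurable \<pi>"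
      using measurable_compose[OF measurable_Pair1'[OF x, of \<pi>] L_meas] by simp
    then show "(\<integral>\<^sup>+\<theta>. ennreal (exp (W x)) * ennreal (L x \<theta>) \<partial>\<pi>) = ennreal (exp (W x)) * (\<integral>\<^sup>+\<theta>. ennreal (L x \<theta>) \<partial>\<pi>)"
      by (simp add: nn_integral_cmult)
  qed
  also have "\<dots> \<le> (\<integral>\<^sup>+x. 1 \<partial>P)" by (rule nn_integral_mono_AE) (use WL in auto)
  finally have R1: "(\<integral>\<^sup>+\<theta>. R \<theta> \<partial>\<pi>) \<le> 1" by (simp add: P.emeasure_space_1)
  have "\<exists>\<theta>\<in>B. R \<theta> \<le> ennreal (1 / b)"
  proof (rule ccontr)
    assume "\<not> ?thesis"
    then have gt: "ennreal (1 / b) < R \<theta>" if "\<theta> \<in> B" for \<theta> using that by (auto simp: not_le)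
    have eq1: "(\<integral>\<^sup>+\<theta>. ennreal (1 / b) * indicator B \<theta> \<partial>\<pi>) = 1"
      using b by (simp add: nn_integral_cmult_indicator \<pi>.emeasure_eq_measure b_def[symmetric] ennreal_mult[symmetric])
    have "(\<integral>\<^sup>+\<theta>. ennreal (1 / b) * indicator B \<theta> \<partial>\<pi>) < (\<integral>\<^sup>+\<theta>. R \<theta> * indicator B \<theta> \<partial>\<pi>)"
    proof (rule nn_integral_less)
      show "AE \<theta> in \<pi>. ennreal (1 / b) * indicator B \<theta> \<le> R \<theta> * indicator B \<theta>"
        using gt by (intro AE_I2) (auto split: split_indicator intro: less_imp_le)
      show "\<not> (AE \<theta> in \<pi>. R \<theta> * indicator B \<theta> \<le> ennreal (1 / b) * indicator B \<theta>)"
      proof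
        assume "AE \<theta> in \<pi>. R \<theta> * indicator B \<theta> \<le> ennreal (1 / b) * indicator B \<theta>"
        then have "AE \<theta> in \<pi>. \<theta> \<notin> B"
        proof eventually_elim
          case (elim \<theta>)
          then show ?case using gt[of \<theta>] by (auto simp: not_less[symmetric])
        qed
        then have "measure \<pi> B = 0" using B by (simp add: AE_iff_measurable[OF B(1)] \<pi>.prob_eq_0)
        then show False using b by (simp add: b_def)
      qed
      show "(\<integral>\<^sup>+\<theta>. ennreal (1 / b) * indicator B \<theta> \<partial>\<pi>) \<noteq> \<infinity>" using eq1 by simp
    qed measurable
    also have "\<dots> \<le> (\<integral>\<^sup>+\<theta>. R \<theta> \<partial>\<pi>)"
      by (intro nn_integral_mono) (auto split: split_indicator)
    finally show False using R1 eq1 by simp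
  qed
  then obtain \<theta> where \<theta>: "\<theta> \<in> B" and R\<theta>: "R \<theta> \<le> ennreal (1 / b)" by blast
  have \<theta>s: "\<theta> \<in> space \<pi>" using \<theta> B sets.sets_into_space by blast
  have [measurable]: "(\<lambda>x. L x \<theta>) \<in> borel_measurable P"
    using measurable_compose[OF measurable_Pair2'[OF \<theta>s, of P] L_meas] by simp
  have nn: "AE x in P. 0 \<le> exp (W x) * L x \<theta>" using pos[OF \<theta>] by eventually_elim simp
  have Req: "R \<theta> = (\<integral>\<^sup>+x. ennreal (exp (W x) * L x \<theta>) \<partial>P)"
    unfolding R_def by (intro nn_integral_cong) (simp add: ennreal_mult')
  have Rint: "integrable P (\<lambda>x. exp (W x) * L x \<theta>)"
    using R\<theta> nn by (intro integrableI_nonneg) (auto simp: Req[symmetric] intro: le_less_trans)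
  have "ennreal (LINT x|P. exp (W x) * L x \<theta>) \<le> ennreal (1 / b)"
    using R\<theta> nn_integral_eq_integral[OF Rint nn] Req by simp
  then have ER: "(LINT x|P. exp (W x) * L x \<theta>) \<le> 1 / b" using b by simp
  have "(LINT x|P. W x + ln (L x \<theta>)) \<le> (LINT x|P. b * (exp (W x) * L x \<theta>) - 1 - ln b)"
  proof (rule integral_mono_AE)
    show "AE x in P. W x + ln (L x \<theta>) \<le> b * (exp (W x) * L x \<theta>) - 1 - ln b"
      using pos[OF \<theta>]
    proof eventually_elim
      case (elim x)
      have "W x + ln (L x \<theta>) + ln b = ln (b * (exp (W x) * L x \<theta>))"
        using elim b by (simp add: ln_mult)
      also have "\<dots> \<le> b * (exp (W x) * L x \<theta>) - 1"
        using elim b by (intro ln_le_minus_one) simp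
      finally show ?case by simp
    qed
  qed (use W int[OF \<theta>] Rint in auto)
  also have "\<dots> = b * (LINT x|P. exp (W x) * L x \<theta>) - 1 - ln b"
    using Rint by (simp add: P.prob_space)
  also have "\<dots> \<le> b * (1 / b) - 1 - ln b"
    using ER b by (intro diff_right_mono mult_left_mono) auto
  also have "\<dots> = - ln b" using b by simp
  finally have "(LINT x|P. W x) + (LINT x|P. ln (L x \<theta>)) \<le> - ln b"
    using W int[OF \<theta>] by simp
  then show ?thesis using ln[OF \<theta>] by (simp add: b_def)
qed

text \<open>A large event \<open>E\<close> on which the evidence is dominated by a small \<open>N\<close> forces \<open>- ln D\<close> to have a
  large expectation. On \<open>E\<close>, \<open>- ln D \<ge> - ln N - ln a\<close>, and the moment of order \<open>al\<close> bounds \<open>ln N\<close> on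
  average by \<open>ln (C / b) / al\<close>. Off \<open>E\<close>, \<open>- ln D \<ge> 1 - D\<close>, which integrates to at least \<open>- b\<close> because
  \<open>E D \<le> 1\<close>.\<close>

lemma bad_event_probability_bound:
  assumes P: "prob_space P"
    and D[measurable]: "D \<in> borel_measurable P" and N[measurable]: "N \<in> borel_measurable P"
    and ED: "(\<integral>\<^sup>+x. D x \<partial>P) \<le> 1"
    and al: "0 < al" and EN: "(\<integral>\<^sup>+x. epow (N x) al \<partial>P) \<le> ennreal C" and C: "0 < C"
    and E[measurable]: "E \<in> sets P" and b: "0 < measure P E"
    and a: "1 \<le> a"
    and bad: "AE x in P. x \<in> E \<longrightarrow> 0 < N x \<and> D x \<le> ennreal a * N x"
    and evid: "\<And>W. integrable P W \<Longrightarrow> AE x in P. ennreal (exp (W x)) * D x \<le> 1 \<Longrightarrow> (LINT x|P. W x) \<le> \<kappa>"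
  defines "b \<equiv> measure P E"
  shows "- b - b / al * ln (C / b) - b * ln a \<le> \<kappa>"
proof -
  interpret P: prob_space P by fact
  have b0: "0 < b" using b by (simp add: b_def)
  define d where "d x = enn2real (D x)" for x
  define m where "m x = enn2real (epow (N x) al)" for x
  define c where "c = C / b"
  have c: "0 < c" using C b0 by (simp add: c_def)
  have [measurable]: "d \<in> borel_measurable P" "m \<in> borel_measurable P"
    unfolding d_def m_def by measurable
  have D_fin: "AE x in P. D x \<noteq> \<infinity>"
    using ED by (intro nn_integral_PInf_AE) (auto simp: top_unique)
  have "(\<integral>\<^sup>+x. epow (N x) al \<partial>P) \<noteq> \<infinity>" using EN by (auto simp: top_unique)
  then have "AE x in P. epow (N x) al \<noteq> \<infinity>" by (intro nn_integral_PInf_AE) auto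
  then have N_fin: "AE x in P. N x \<noteq> \<top>" by eventually_elim auto
  have d0: "0 \<le> d x" and m0: "0 \<le> m x" for x by (simp_all add: d_def m_def)
  have dle: "(\<integral>\<^sup>+x. ennreal (d x) \<partial>P) \<le> 1"
    using ED by (rule order_trans[rotated], intro nn_integral_mono) (auto simp: d_def ennreal_enn2real_if)
  have d_int: "integrable P d"
    using dle d0 by (intro integrableI_nonneg) (auto intro: le_less_trans)
  have d1: "(LINT x|P. d x) \<le> 1"
    using dle nn_integral_eq_integral[OF d_int] d0 by simp
  have mle: "(\<integral>\<^sup>+x. ennreal (m x) \<partial>P) \<le> ennreal C"
    using EN by (rule order_trans[rotated], intro nn_integral_mono) (auto simp: m_def ennreal_enn2real_if)
  have m_int: "integrable P m"
    using mle m0 by (intro integrableI_nonneg) (auto intro: le_less_trans)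
  have mC: "(LINT x|P. m x) \<le> C"
    using mle nn_integral_eq_integral[OF m_int] m0 C by simp
  \<comment> \<open>Tangent lines of the logarithm replace conditional versions of Jensen's inequality on \<open>E\<close>
    and on its complement; the slope \<open>1 / c\<close> is the optimal one.\<close>
  define W where "W x = indicator E x * (- (1 / al) * (m x / c - 1 + ln c) - ln a - 1 + d x) + (1 - d x)" for x
  have i1: "integrable P (\<lambda>x. indicator E x * m x)" "integrable P (\<lambda>x. indicator E x * d x)"
    using m_int d_int integrable_mult_indicator[OF E, of m] integrable_mult_indicator[OF E, of d] by auto
  have W_eq: "W x = (- (1 / al) / c) * (indicator E x * m x) + (indicator E x * d x)
      + (1 / al - ln c / al - ln a - 1) * indicator E x + (1 - d x)" for x
    using al by (simp add: W_def algebra_simps diff_divide_distrib add_divide_distrib split: split_indicator)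
  have W_int: "integrable P W"
    unfolding W_eq[abs_def] using i1 d_int E
    by (intro Bochner_Integration.integrable_add Bochner_Integration.integrable_diff integrable_mult_right) (auto simp: P.emeasure_eq_measure)
  have "AE x in P. ennreal (exp (W x)) * D x \<le> 1"
    using bad D_fin N_fin
  proof eventually_elim
    case (elim x)
    have Dd: "D x = ennreal (d x)" using elim by (cases "D x") (auto simp: d_def)
    have "exp (W x) * d x \<le> 1"
    proof (cases "x \<in> E")
      case False
      have "d x \<le> exp (d x - 1)" using exp_ge_add_one_self[of "d x - 1"] by simp
      then have "exp (W x) * d x \<le> exp (W x) * exp (d x - 1)" by (intro mult_left_mono) auto
      also have "\<dots> = 1" using False by (simp add: W_def exp_add[symmetric])
      finally show ?thesis .
    next
      case True
      obtain y where y: "N x = ennreal y" "0 \<le> y" using elim by (cases "N x") auto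
      have y0: "0 < y" using elim True y by simp
      have "ennreal (d x) \<le> ennreal (a * y)" using elim True y a Dd by (simp add: ennreal_mult)
      then have dy: "d x \<le> a * y" using a y by (simp add: ennreal_le_iff)
      have my: "m x = y powr al" using y by (simp add: m_def)
      have "ln (m x / c) \<le> m x / c - 1" using y0 c my by (intro ln_le_minus_one) simp
      then have "al * ln y \<le> m x / c - 1 + ln c" using y0 c my by (simp add: ln_div ln_powr)
      then have "ln y \<le> 1 / al * (m x / c - 1 + ln c)" using al by (simp add: field_simps)
      then have "W x \<le> - ln y - ln a" using True by (simp add: W_def)
      then have "exp (W x) \<le> exp (- ln (a * y))" using y0 a by (simp add: ln_mult)
      also have "\<dots> = 1 / (a * y)" using y0 a by (simp add: exp_minus field_simps)
      finally have "exp (W x) * d x \<le> 1 / (a * y) * (a * y)" using dy d0 a y0 by (intro mult_mono) auto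
      then show ?thesis using a y0 by simp
    qed
    then show ?case unfolding Dd using d0[of x] by (simp add: ennreal_mult[symmetric])
  qed
  from evid[OF W_int this] have le: "(LINT x|P. W x) \<le> \<kappa>" .
  have "(LINT x|P. indicator E x * m x) \<le> (LINT x|P. m x)"
    using i1 m_int m0 by (intro integral_mono) (auto split: split_indicator)
  then have mE: "(LINT x|P. indicator E x * m x) \<le> C" using mC by simp
  have dE: "0 \<le> (LINT x|P. indicator E x * d x)"
    using d0 by (intro integral_nonneg_AE) auto
  have "(LINT x|P. W x) = (- (1 / al) / c) * (LINT x|P. indicator E x * m x) + (LINT x|P. indicator E x * d x)
      + (1 / al - ln c / al - ln a - 1) * b + (1 - (LINT x|P. d x))"
    unfolding W_eq using i1 d_int E by (simp add: P.prob_space b_def P.emeasure_eq_measure)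
  moreover have "(- (1 / al) / c) * C \<le> (- (1 / al) / c) * (LINT x|P. indicator E x * m x)"
    using mE al c by (intro mult_left_mono_neg) (auto simp: divide_nonpos_pos)
  ultimately have "(- (1 / al) / c) * C + (1 / al - ln c / al - ln a - 1) * b \<le> (LINT x|P. W x)"
    using dE d1 by linarith
  moreover have "(- (1 / al) / c) * C = - b / al" using C b0 by (simp add: c_def)
  ultimately show ?thesis using le by (simp add: c_def algebra_simps)
qed

section \<open>Comparison of the rates\<close>

lemma entropy_le_two_ln:
  fixes b U :: real
  assumes "0 < b" "b \<le> 1" "0 < U"
  shows "b * (1 + ln 2 + ln U - ln b) \<le> 2 * ln (U + 2)"
proof -
  have "ln (exp 1) \<le> ln ((2::real) ^ 2)" using exp_le by (intro ln_mono) auto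
  also have "\<dots> = 2 * ln 2" by (simp only: ln_realpow)
  finally have ln2: "ln 2 \<le> ln (U + 2)" "1 \<le> 2 * ln (2::real)"
    using assms by (auto intro: ln_mono)
  have key: "- ln b \<le> c / b - 1 - ln c" if "0 < c" for c
    using ln_le_minus_one[of "c / b"] that assms by (simp add: ln_div)
  show ?thesis
  proof (cases "2 * U \<le> 1")
    case True
    have "b * (1 + ln 2 + ln U - ln b) \<le> b * (1 + ln 2 + ln U + (2 * U / b - 1 - ln (2 * U)))"
      using key[of "2 * U"] assms by (intro mult_left_mono) auto
    also have "\<dots> = 2 * U" using assms by (simp add: ln_mult field_simps)
    finally show ?thesis using True ln2 by linarith
  next
    case False
    have "b * (1 + ln 2 + ln U - ln b) \<le> b * (1 + ln 2 + ln U + (1 / b - 1 - ln 1))"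
      using key[of 1] assms by (intro mult_left_mono) auto
    also have "\<dots> = b * ln (2 * U) + 1" using assms by (simp add: ln_mult field_simps)
    also have "\<dots> \<le> 1 * ln (2 * U) + 1"
      using False assms by (intro add_mono mult_right_mono) auto
    also have "\<dots> = ln (exp 1 * (2 * U))" using assms by (simp add: ln_mult)
    also have "\<dots> \<le> ln ((U + 2)\<^sup>2)"
    proof (rule ln_mono)
      have "exp 1 * (2 * U) \<le> 3 * (2 * U)" using exp_le assms by (intro mult_right_mono) auto
      also have "\<dots> \<le> (U + 2)\<^sup>2"
      proof -
        have "(U + 2)\<^sup>2 - 3 * (2 * U) = (U - 1)\<^sup>2 + 3" by (simp add: power2_eq_square algebra_simps)
        then show ?thesis using zero_le_power2[of "U - 1"] by linarith
      qed
      finally show "exp 1 * (2 * U) \<le> (U + 2)\<^sup>2" .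
    qed (use assms in auto)
    also have "\<dots> = 2 * ln (U + 2)" using assms by (simp add: ln_realpow)
    finally show ?thesis .
  qed
qed

lemma ln_one_plus_exp_le:
  fixes t :: real
  assumes "0 \<le> t"
  shows "ln (1 + exp t) \<le> ln 2 + t"
proof -
  have "ln (1 + exp t) \<le> ln (2 * exp t)"
    using assms by (intro ln_mono) (auto simp: add_pos_pos)
  then show ?thesis by (simp add: ln_mult)
qed

text \<open>The rates are incompatible when the moment has order \<open>\<beta> / k\<close> with \<open>\<beta> = \<gamma> - 1 > 0\<close>. After
  multiplication by \<open>\<beta>\<close> the coefficients of \<open>x\<close> and \<open>t\<close> leave room because \<open>\<beta> \<le> \<gamma>\<close>, and the
  remaining logarithms are paid for by \<open>2 k ln (U + 2)\<close>.\<close>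

lemma rate_contradiction_large:
  fixes b U x t k \<gamma> r T :: real
  assumes b: "0 < b" "b \<le> 1" and U: "0 < U" and x: "0 < x" and t: "0 \<le> t"
    and r: "0 < r" "r < 1" and k: "1 \<le> k" "k = \<gamma> - r"
    and T: "4 * \<gamma> * x + 2 * k * ln (U + 2) + (4 * \<gamma> - 2) * t \<le> b * T"
    and le: "- b - b / (1 - (1 - r) / k) * ln (exp (- T) powr (1 / k) * U / b) - b * ln (1 + exp t) \<le> 2 * x"
  shows False
proof -
  define \<beta> where "\<beta> = k - (1 - r)"
  have \<beta>: "0 < \<beta>" "\<beta> \<le> k" "\<beta> \<le> \<gamma>" using k r by (auto simp: \<beta>_def)
  have al: "1 - (1 - r) / k = \<beta> / k" using k by (simp add: \<beta>_def field_simps)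
  have "ln (exp (- T) powr (1 / k) * U / b) = - T / k + ln U - ln b"
    using U b by (simp add: ln_div ln_mult ln_powr)
  with le al have "\<beta> * (- b - b / (\<beta> / k) * (- T / k + ln U - ln b) - b * ln (1 + exp t)) \<le> \<beta> * (2 * x)"
    using \<beta> by (intro mult_left_mono) auto
  moreover have "\<beta> * (- b - b / (\<beta> / k) * (- T / k + ln U - ln b) - b * ln (1 + exp t))
    = - (\<beta> * b) + b * T - k * (b * (ln U - ln b)) - \<beta> * b * ln (1 + exp t)"
    using \<beta> k by (simp add: field_simps)
  ultimately have 1: "b * T \<le> \<beta> * (2 * x) + \<beta> * b + k * (b * (ln U - ln b)) + \<beta> * b * ln (1 + exp t)"
    by simp
  have "\<beta> * b * ln (1 + exp t) \<le> \<beta> * b * (ln 2 + t)"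
    using \<beta> b ln_one_plus_exp_le[OF t] by (intro mult_left_mono) auto
  also have "\<dots> = (\<beta> * b) * ln 2 + (\<beta> * b) * t" by (simp add: algebra_simps)
  finally have 2: "\<beta> * b * ln (1 + exp t) \<le> (\<beta> * b) * ln 2 + (\<beta> * b) * t" .
  have 3: "(\<beta> * b) * ln 2 \<le> (k * b) * ln 2" "\<beta> * b \<le> k * b"
    using \<beta> b by (auto intro!: mult_right_mono)
  have "\<beta> * b \<le> \<gamma> * 1" using \<beta> b k r by (intro mult_mono) auto
  then have "(\<beta> * b) * t \<le> (4 * \<gamma> - 2) * t" using t k r by (intro mult_right_mono) auto
  moreover have "k * (b * (1 + ln 2 + ln U - ln b)) \<le> k * (2 * ln (U + 2))"
    using entropy_le_two_ln[OF b U] k by (intro mult_left_mono) auto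
  moreover have "k * (b * (1 + ln 2 + ln U - ln b)) = k * b + (k * b) * ln 2 + k * (b * (ln U - ln b))"
    by (simp add: algebra_simps)
  moreover have "\<beta> * (2 * x) \<le> \<gamma> * (2 * x)" using \<beta> x by (intro mult_right_mono) auto
  moreover have "0 < \<gamma> * x" using k r x by simp
  ultimately show False using 1 2 3 T by (simp add: algebra_simps)
qed

text \<open>For \<open>k \<le> 1\<close> the logarithms split into a part of weight \<open>k\<close>, paid for by \<open>2 k ln (U + 2)\<close>, and a
  part of weight \<open>1 - k\<close>, paid for by \<open>x\<close>. The latter amounts to \<open>1 + ln 2 + ln y \<le> 2 y\<close> for
  \<open>y = x / b\<close>, with equality at \<open>y = 1 / 2\<close>.\<close>

lemma rate_contradiction_small:
  fixes b U x t k \<gamma> r T :: real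
  assumes b: "0 < b" "b \<le> 1" and U: "0 < U" and x: "0 < x" and t: "0 \<le> t"
    and r: "0 < r" "r < 1" and k: "0 < k" "k \<le> 1" "k = \<gamma> - r" and \<gamma>: "1 \<le> \<gamma>"
    and T: "4 * \<gamma> * x + 2 * k * ln (U + 2) + (4 * \<gamma> - 2) * t \<le> b * T"
    and le: "- b - b / r * ln (exp (- T) * (U powr k * x powr (1 - k)) / b) - b * ln (1 + exp t) \<le> 2 * x"
  shows False
proof -
  have "ln (exp (- T) * (U powr k * x powr (1 - k)) / b) = - T + k * ln U + (1 - k) * ln x - ln b"
    using U b x by (simp add: ln_div ln_mult ln_powr)
  with le have "r * (- b - b / r * (- T + k * ln U + (1 - k) * ln x - ln b) - b * ln (1 + exp t)) \<le> r * (2 * x)"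
    using r by (intro mult_left_mono) auto
  moreover have "r * (- b - b / r * (- T + k * ln U + (1 - k) * ln x - ln b) - b * ln (1 + exp t))
    = - (r * b) + b * T - b * (k * ln U + (1 - k) * ln x - ln b) - r * b * ln (1 + exp t)"
    using r by (simp add: field_simps)
  ultimately have 1: "b * T \<le> r * (2 * x) + r * b + b * (k * ln U + (1 - k) * ln x - ln b) + r * b * ln (1 + exp t)"
    by simp
  have "r * b * ln (1 + exp t) \<le> r * b * (ln 2 + t)"
    using r b ln_one_plus_exp_le[OF t] by (intro mult_left_mono) auto
  also have "\<dots> = (r * b) * ln 2 + (r * b) * t" by (simp add: algebra_simps)
  finally have 2: "r * b * ln (1 + exp t) \<le> (r * b) * ln 2 + (r * b) * t" .
  have "r * b \<le> 1 * 1" using b r by (intro mult_mono) auto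
  then have 3: "(r * b) * t \<le> (4 * \<gamma> - 2) * t" using t \<gamma> by (intro mult_right_mono) auto
  have "ln (2 * x / b) \<le> 2 * x / b - 1" using x b by (intro ln_le_minus_one) auto
  then have "b * ln (2 * x / b) \<le> b * (2 * x / b - 1)" using b by (intro mult_left_mono) auto
  then have "b * (1 + ln 2 + ln x - ln b) \<le> 2 * x" using x b by (simp add: ln_div ln_mult algebra_simps)
  then have 4: "(1 - k) * (b * (1 + ln 2 + ln x - ln b)) \<le> (1 - k) * (2 * x)"
    using k by (intro mult_left_mono) auto
  have 5: "k * (b * (1 + ln 2 + ln U - ln b)) \<le> k * (2 * ln (U + 2))"
    using entropy_le_two_ln[OF b U] k by (intro mult_left_mono) auto
  have 6: "(r * b) * (1 + ln 2) \<le> b * (1 + ln 2)" using r b by (intro mult_right_mono) auto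
  have "(1 - k) * (b * (1 + ln 2 + ln x - ln b)) + k * (b * (1 + ln 2 + ln U - ln b))
    = b * (1 + ln 2) + b * (k * ln U + (1 - k) * ln x - ln b)" by (simp add: algebra_simps)
  with 4 5 6 have 7: "(r * b) * (1 + ln 2) + b * (k * ln U + (1 - k) * ln x - ln b)
    \<le> (1 - k) * (2 * x) + k * (2 * ln (U + 2))" by linarith
  have "r * (2 * x) + (1 - k) * (2 * x) = (r + (1 - k)) * (2 * x)" by (simp add: algebra_simps)
  also have "\<dots> < (2 * \<gamma>) * (2 * x)" using x r k \<gamma> by (intro mult_strict_right_mono) auto
  finally have 8: "r * (2 * x) + (1 - k) * (2 * x) < 4 * \<gamma> * x" by simp
  have "(r * b) * (1 + ln 2) = r * b + (r * b) * ln 2" by (simp add: algebra_simps)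
  then show False using 1 2 3 7 8 T by linarith
qed

section \<open>Densities, divergences and convex hulls\<close>

text \<open>The functions \<open>f i\<close> may repeat, so the weight of a function is the proportion of indices at
  which it occurs.\<close>

lemma average_in_co:
  assumes m: "0 < m" and f: "\<And>i. i < m \<Longrightarrow> f i \<in> F"
  shows "(\<lambda>x. (\<Sum>i<m. f i x) / real m) \<in> co F"
proof -
  define S where "S = f ` {..<m}"
  define u where "u h = real (card {i\<in>{..<m}. f i = h}) / real m" for h
  have S: "finite S" "S \<subseteq> F" using f by (auto simp: S_def)
  have grp: "(\<Sum>h\<in>S. \<Sum>i\<in>{i\<in>{..<m}. f i = h}. k i) = (\<Sum>i<m. k i)" for k :: "nat \<Rightarrow> real"
    unfolding S_def by (rule sum.image_gen[symmetric]) simp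
  have "(\<Sum>h\<in>S. u h) = (\<Sum>h\<in>S. \<Sum>i\<in>{i\<in>{..<m}. f i = h}. 1 / real m)"
    by (simp add: u_def)
  also have "\<dots> = 1" unfolding grp using m by simp
  finally have u1: "(\<Sum>h\<in>S. u h) = 1" .
  have "(\<Sum>i<m. f i x) / real m = (\<Sum>h\<in>S. u h * h x)" for x
  proof -
    have "(\<Sum>i<m. f i x) / real m = (\<Sum>i<m. f i x / real m)" by (rule sum_divide_distrib)
    also have "\<dots> = (\<Sum>h\<in>S. \<Sum>i\<in>{i\<in>{..<m}. f i = h}. f i x / real m)" unfolding grp ..
    also have "\<dots> = (\<Sum>h\<in>S. \<Sum>i\<in>{i\<in>{..<m}. f i = h}. h x / real m)"
      by (intro sum.cong) auto
    also have "\<dots> = (\<Sum>h\<in>S. u h * h x)" by (simp add: u_def)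
    finally show ?thesis .
  qed
  then show ?thesis unfolding co_def using S u1
    by (intro CollectI exI[of _ S] exI[of _ u]) (auto simp: u_def)
qed

lemma prob_space_density_prob_density:
  assumes "prob_density M q"
  shows "prob_space (density M (\<lambda>x. ennreal (q x)))"
  using assms by (intro prob_spaceI) (auto simp: prob_density_def emeasure_density cong: nn_integral_cong)

lemma AE_prob_density_pos:
  assumes "prob_density M q"
  shows "AE x in density M (\<lambda>x. ennreal (q x)). 0 < q x"
  using assms by (subst AE_density) (auto simp: prob_density_def)

lemma nn_integral_ratio_le_1:
  assumes q: "prob_density M q" and f: "f \<in> borel_measurable M" "\<And>x. x \<in> space M \<Longrightarrow> 0 \<le> f x"
    and f1: "(\<integral>\<^sup>+x. ennreal (f x) \<partial>M) \<le> 1"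
  shows "(\<integral>\<^sup>+x. ennreal (f x / q x) \<partial>density M (\<lambda>x. ennreal (q x))) \<le> 1"
proof -
  have [measurable]: "q \<in> borel_measurable M" "f \<in> borel_measurable M" and q0: "\<And>x. x \<in> space M \<Longrightarrow> 0 \<le> q x"
    using q f by (auto simp: prob_density_def)
  have "(\<integral>\<^sup>+x. ennreal (f x / q x) \<partial>density M (\<lambda>x. ennreal (q x))) = (\<integral>\<^sup>+x. ennreal (q x) * ennreal (f x / q x) \<partial>M)"
    by (subst nn_integral_density) auto
  also have "\<dots> \<le> (\<integral>\<^sup>+x. ennreal (f x) \<partial>M)"
  proof (rule nn_integral_mono)
    fix x assume x: "x \<in> space M"
    show "ennreal (q x) * ennreal (f x / q x) \<le> ennreal (f x)"
      using q0[OF x] f(2)[OF x] by (cases "q x = 0") (auto simp: ennreal_mult[symmetric])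
  qed
  finally show ?thesis using f1 by simp
qed

text \<open>\<open>D\<^sub>\<rho>\<close> is an affine function of the fractional moment, and \<open>1 - u \<le> e\<^sup>-\<^sup>u\<close> gives the form that
  multiplies well over independent observations. Integrability comes from \<open>u\<^sup>r \<le> r u + (1 - r)\<close>.\<close>

lemma powr_moment_le_of_D_rho:
  assumes q: "prob_density M q" and f: "f \<in> borel_measurable M" "\<And>x. x \<in> space M \<Longrightarrow> 0 \<le> f x"
    and f1: "(\<integral>\<^sup>+x. ennreal (f x) \<partial>M) \<le> 1"
    and r: "0 < r" "r < 1" and D: "e \<le> D_rho r M q f"
  shows "(\<integral>\<^sup>+x. ennreal ((f x / q x) powr r) \<partial>density M (\<lambda>x. ennreal (q x))) \<le> ennreal (exp (- (r * (1 - r) * e)))"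
proof -
  let ?Q = "density M (\<lambda>x. ennreal (q x))"
  interpret Q: prob_space ?Q by (rule prob_space_density_prob_density[OF q])
  have [measurable]: "q \<in> borel_measurable M" "f \<in> borel_measurable M" and q0: "\<And>x. x \<in> space M \<Longrightarrow> 0 \<le> q x"
    using q f by (auto simp: prob_density_def)
  have nn: "0 \<le> f x / q x" if "x \<in> space ?Q" for x using that q0[of x] f(2)[of x] by simp
  have int: "integrable ?Q (\<lambda>x. f x / q x)"
    using nn nn_integral_ratio_le_1[OF q f f1] by (intro integrableI_nonneg) (auto intro: le_less_trans)
  have intp: "integrable ?Q (\<lambda>x. (f x / q x) powr r)"
  proof (rule Bochner_Integration.integrable_bound)
    show "integrable ?Q (\<lambda>x. r * (f x / q x) + (1 - r) * 1)"
      by (intro Bochner_Integration.integrable_add integrable_mult_right int) simp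
    show "AE x in ?Q. norm ((f x / q x) powr r) \<le> norm (r * (f x / q x) + (1 - r) * 1)"
    proof (rule AE_I2)
      fix x assume "x \<in> space ?Q"
      then show "norm ((f x / q x) powr r) \<le> norm (r * (f x / q x) + (1 - r) * 1)"
        using powr_product_le_weighted_sum[of "f x / q x" 1 r] nn[of x] r by auto
    qed
  qed measurable
  have "D_rho r M q f = 1 / (r * (1 - r)) * (1 - (LINT x|?Q. (f x / q x) powr r))"
    using intp Q.prob_space unfolding D_rho_def by (subst Bochner_Integration.integral_diff) auto
  with D r have "(LINT x|?Q. (f x / q x) powr r) \<le> 1 - r * (1 - r) * e"
    by (simp add: field_simps)
  also have "\<dots> \<le> exp (- (r * (1 - r) * e))" using exp_ge_add_one_self[of "- (r * (1 - r) * e)"] by simp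
  finally show ?thesis using intp by (subst nn_integral_eq_integral) (auto intro: ennreal_leI)
qed

text \<open>Finiteness of \<open>D_KL\<close> makes the positive part of \<open>ln (q / f)\<close> integrable; the negative part always
  is, because \<open>ln (f / q) \<le> f / q\<close>. The last claim integrates \<open>1 - u\<^sup>r \<le> - r ln u\<close> and separates a
  Kullback-Leibler ball from the sets where \<open>D_rho\<close> is large.\<close>

lemma finite_D_KL_properties:
  assumes q: "prob_density M q" and f: "prob_density M f"
    and r: "0 < r" "r < 1" and D: "D_KL M q f \<le> ereal e"
  defines "Q \<equiv> density M (\<lambda>x. ennreal (q x))"
  shows "AE x in Q. 0 < \<bar>f x / q x\<bar>"
    and "integrable Q (\<lambda>x. ln \<bar>f x / q x\<bar>)"
    and "- e \<le> (LINT x|Q. ln \<bar>f x / q x\<bar>)"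
    and "D_rho r M q f \<le> e / (1 - r)"
proof -
  interpret Q: prob_space Q unfolding Q_def by (rule prob_space_density_prob_density[OF q])
  have [measurable]: "q \<in> borel_measurable M" "f \<in> borel_measurable M"
    and f0: "\<And>x. x \<in> space M \<Longrightarrow> 0 \<le> f x" and f1: "(\<integral>\<^sup>+x. ennreal (f x) \<partial>M) \<le> 1"
    using q f by (auto simp: prob_density_def)
  have [measurable]: "q \<in> borel_measurable Q" "f \<in> borel_measurable Q" by (simp_all add: Q_def)
  have qpos: "AE x in Q. 0 < q x" unfolding Q_def by (rule AE_prob_density_pos[OF q])
  have fnn: "AE x in Q. 0 \<le> f x" using f0 by (intro AE_I2) (simp add: Q_def)
  let ?l = "\<lambda>x. eln (ennreal (q x) / ennreal (f x))"
  define P1 where "P1 = (\<integral>\<^sup>+x. e2ennreal (?l x) \<partial>Q)"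
  define P2 where "P2 = (\<integral>\<^sup>+x. e2ennreal (- ?l x) \<partial>Q)"
  have DK: "D_KL M q f = enn2ereal P1 - enn2ereal P2" by (simp add: D_KL_def P1_def P2_def Q_def)
  have l_pos: "?l x = ereal (- ln \<bar>f x / q x\<bar>)" if "0 < f x" "0 < q x" for x
    using that by (simp add: eln_def divide_ennreal ln_div ennreal_eq_0_iff not_le)
  have l_0: "?l x = \<infinity>" if "f x = 0" "0 < q x" for x
    using that by (simp add: eln_def ennreal_divide_zero not_le)
  have [measurable]: "?l \<in> borel_measurable Q"
  proof -
    have "(\<lambda>x. if ennreal (q x) / ennreal (f x) \<in> {0} then - \<infinity> else if ennreal (q x) / ennreal (f x) \<in> {\<infinity>} then \<infinity>
        else ereal (ln (enn2real (ennreal (q x) / ennreal (f x))))) \<in> borel_measurable Q"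
      by measurable
    then show ?thesis by (simp add: eln_def)
  qed
  have P1_fin: "P1 \<noteq> \<infinity>" using D unfolding DK by (cases P1) (auto simp: top_ennreal.rep_eq)
  then have "AE x in Q. e2ennreal (?l x) \<noteq> \<infinity>" unfolding P1_def by (intro nn_integral_PInf_AE) auto
  with qpos fnn have fpos: "AE x in Q. 0 < f x \<and> 0 < q x"
  proof eventually_elim
    case (elim x)
    then show ?case using l_0[of x] by (cases "f x = 0") auto
  qed
  then show pos: "AE x in Q. 0 < \<bar>f x / q x\<bar>" by eventually_elim auto
  have P1: "P1 = (\<integral>\<^sup>+x. ennreal (- ln \<bar>f x / q x\<bar>) \<partial>Q)"
    unfolding P1_def using fpos
    by (intro nn_integral_cong_AE, eventually_elim) (simp add: l_pos del: uminus_ereal.simps)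
  have P2: "P2 = (\<integral>\<^sup>+x. ennreal (ln \<bar>f x / q x\<bar>) \<partial>Q)"
    unfolding P2_def using fpos
    by (intro nn_integral_cong_AE, eventually_elim) (simp add: l_pos)
  have "P2 \<le> (\<integral>\<^sup>+x. ennreal (f x / q x) \<partial>Q)"
    unfolding P2 using fpos
  proof (intro nn_integral_mono_AE, eventually_elim)
    case (elim x)
    then have "ln \<bar>f x / q x\<bar> \<le> f x / q x - 1" using ln_le_minus_one[of "f x / q x"] by simp
    then show ?case by (intro ennreal_leI) simp
  qed
  also have "\<dots> \<le> 1" unfolding Q_def using f0 by (intro nn_integral_ratio_le_1[OF q _ _ f1]) auto
  finally have P2_fin: "P2 \<noteq> \<infinity>" by (auto simp: top_unique)
  show int: "integrable Q (\<lambda>x. ln \<bar>f x / q x\<bar>)"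
    unfolding real_integrable_def using P1_fin P2_fin P1 P2 by simp
  obtain a1 a2 where a: "P1 = ennreal a1" "0 \<le> a1" "P2 = ennreal a2" "0 \<le> a2"
    using P1_fin P2_fin by (metis ennreal_cases infinity_ennreal_def)
  have "(LINT x|Q. ln \<bar>f x / q x\<bar>) = a2 - a1"
    using real_lebesgue_integral_def[OF int] unfolding P1[symmetric] P2[symmetric] a(1,3) using a(2,4) by simp
  then show ge: "- e \<le> (LINT x|Q. ln \<bar>f x / q x\<bar>)" using D a unfolding DK by simp
  have intp: "integrable Q (\<lambda>x. (f x / q x) powr r)"
  proof (rule Bochner_Integration.integrable_bound)
    have nn: "AE x in Q. 0 \<le> f x / q x" using fpos by eventually_elim auto
    have "(\<integral>\<^sup>+x. ennreal (f x / q x) \<partial>Q) \<le> 1"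
      unfolding Q_def using f0 by (intro nn_integral_ratio_le_1[OF q _ _ f1]) auto
    then have "integrable Q (\<lambda>x. f x / q x)"
      using nn by (intro integrableI_nonneg) (auto intro: le_less_trans)
    then show "integrable Q (\<lambda>x. r * (f x / q x) + (1 - r) * 1)"
      by (intro Bochner_Integration.integrable_add integrable_mult_right) simp_all
    show "AE x in Q. norm ((f x / q x) powr r) \<le> norm (r * (f x / q x) + (1 - r) * 1)"
      using nn
    proof eventually_elim
      case (elim x)
      then show ?case using powr_product_le_weighted_sum[of "f x / q x" 1 r] r by auto
    qed
  qed measurable
  have "(LINT x|Q. 1 - (f x / q x) powr r) \<le> (LINT x|Q. - r * ln \<bar>f x / q x\<bar>)"
  proof (rule integral_mono_AE)
    show "AE x in Q. 1 - (f x / q x) powr r \<le> - r * ln \<bar>f x / q x\<bar>"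
      using fpos
    proof eventually_elim
      case (elim x)
      then have "(f x / q x) powr r = exp (r * ln \<bar>f x / q x\<bar>)" by (simp add: powr_def)
      then show ?case using exp_ge_add_one_self[of "r * ln \<bar>f x / q x\<bar>"] by linarith
    qed
  qed (use int intp in auto)
  also have "\<dots> \<le> r * e" using ge r mult_left_mono[OF ge, of r] by simp
  finally have "1 / (r * (1 - r)) * (LINT x|Q. 1 - (f x / q x) powr r) \<le> 1 / (r * (1 - r)) * (r * e)"
    using r by (intro mult_left_mono) auto
  then show "D_rho r M q f \<le> e / (1 - r)"
    using r by (simp add: D_rho_def Q_def)
qed

section \<open>Contradiction from a large bad event\<close>

lemma product_log_expectation:
  fixes l :: "'a \<Rightarrow> real"
  assumes Q: "prob_space Q" and I: "finite I" and l: "integrable Q l"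
  shows "integrable (PiM I (\<lambda>_. Q)) (\<lambda>x. \<Sum>i\<in>I. l (x i))"
    and "(LINT x|PiM I (\<lambda>_. Q). (\<Sum>i\<in>I. l (x i))) = real (card I) * (LINT x|Q. l x)"
proof -
  have lm[measurable]: "l \<in> borel_measurable Q" using l by auto
  have d: "distr (PiM I (\<lambda>_. Q)) Q (\<lambda>x. x i) = Q" if "i \<in> I" for i
    using distr_PiM_component[of I "\<lambda>_. Q" i] Q that by simp
  have int: "integrable (PiM I (\<lambda>_. Q)) (\<lambda>x. l (x i))" if "i \<in> I" for i
    using l that integrable_distr_eq[of "\<lambda>x. x i" "PiM I (\<lambda>_. Q)" Q l] by (simp add: d)
  have eq: "(LINT x|PiM I (\<lambda>_. Q). l (x i)) = (LINT x|Q. l x)" if "i \<in> I" for i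
    using that integral_distr[of "\<lambda>x. x i" "PiM I (\<lambda>_. Q)" Q l] by (simp add: d)
  show "integrable (PiM I (\<lambda>_. Q)) (\<lambda>x. \<Sum>i\<in>I. l (x i))"
    using int by (intro Bochner_Integration.integrable_sum)
  show "(LINT x|PiM I (\<lambda>_. Q). (\<Sum>i\<in>I. l (x i))) = real (card I) * (LINT x|Q. l x)"
    using int eq by (simp add: Bochner_Integration.integral_sum)
qed

text \<open>The core of the argument, for likelihood ratios \<open>g\<close> and a partition \<open>G\<close> of the far set. The
  moment bounds of the pieces and the mass of the ball \<open>B\<close> enter the bound on bad events, and the
  rate inequality contradicts it. The two cases differ in the order of the moment: \<open>(\<gamma> - 1) / k\<close>
  when this is at least \<open>r\<close>, that is for \<open>k \<ge> 1\<close>, and \<open>r\<close> otherwise.\<close>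

theorem no_large_bad_event:
  fixes g :: "'a \<Rightarrow> 'b \<Rightarrow> real" and G :: "nat \<Rightarrow> 'b set"
  assumes Q: "prob_space Q" and \<pi>: "prob_space \<pi>" and I: "finite I"
    and g_meas: "(\<lambda>(x, \<theta>). g x \<theta>) \<in> borel_measurable (Q \<Otimes>\<^sub>M \<pi>)"
    and g_nonneg: "\<And>x \<theta>. 0 \<le> g x \<theta>"
    and g_le1: "\<And>\<theta>. \<theta> \<in> space \<pi> \<Longrightarrow> (\<integral>\<^sup>+x. ennreal (g x \<theta>) \<partial>Q) \<le> 1"
    and G: "range G \<subseteq> sets \<pi>" "disjoint_family G"
    and r: "0 < r" "r < 1" and k: "0 < k" "k = \<gamma> - r" and \<gamma>: "1 \<le> \<gamma>"
    and avg: "\<And>j m \<theta>. 0 < m \<Longrightarrow> (\<And>i. i < m \<Longrightarrow> \<theta> i \<in> G j) \<Longrightarrow>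
      (\<integral>\<^sup>+x. ennreal (((\<Sum>i<m. g x (\<theta> i)) / real m) powr r) \<partial>Q) \<le> ennreal (exp (- e))"
    and a: "\<And>j. measure \<pi> (G j) powr ((\<gamma> - 1) / k) \<le> a j"
    and U: "(\<Sum>j. ennreal (a j)) \<le> ennreal U" "0 < U"
    and x: "0 < x" "measure \<pi> (\<Union>j. G j) \<le> x"
    and B: "B \<in> sets \<pi>" "0 < measure \<pi> B" "- ln (measure \<pi> B) \<le> x"
    and B_pos: "\<And>\<theta>. \<theta> \<in> B \<Longrightarrow> AE y in Q. 0 < g y \<theta>"
    and B_int: "\<And>\<theta>. \<theta> \<in> B \<Longrightarrow> integrable Q (\<lambda>y. ln (g y \<theta>))"
    and B_ln: "\<And>\<theta>. \<theta> \<in> B \<Longrightarrow> - x \<le> real (card I) * (LINT y|Q. ln (g y \<theta>))"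
    and t: "0 \<le> t"
    and E: "E \<in> sets (PiM I (\<lambda>_. Q))"
    and bad: "AE y in PiM I (\<lambda>_. Q). y \<in> E \<longrightarrow>
      0 < (\<integral>\<^sup>+\<theta>. ennreal (\<Prod>i\<in>I. g (y i) \<theta>) * indicator (\<Union>j. G j) \<theta> \<partial>\<pi>) \<and>
      (\<integral>\<^sup>+\<theta>. ennreal (\<Prod>i\<in>I. g (y i) \<theta>) \<partial>\<pi>)
        \<le> ennreal (1 + exp t) * (\<integral>\<^sup>+\<theta>. ennreal (\<Prod>i\<in>I. g (y i) \<theta>) * indicator (\<Union>j. G j) \<theta> \<partial>\<pi>)"
    and b: "0 < measure (PiM I (\<lambda>_. Q)) E"
    and rate: "4 * \<gamma> * x + 2 * k * ln (U + 2) + (4 * \<gamma> - 2) * t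
      \<le> measure (PiM I (\<lambda>_. Q)) E * (real (card I) * e)"
  shows False
proof -
  interpret Q: prob_space Q by fact
  interpret \<pi>: prob_space \<pi> by fact
  interpret product_sigma_finite "\<lambda>_. Q" ..
  let ?P = "PiM I (\<lambda>_. Q)"
  interpret P: prob_space ?P by (intro prob_space_PiM Q)
  interpret PP: pair_prob_space ?P \<pi> ..
  define L where "L y \<theta> = (\<Prod>i\<in>I. g (y i) \<theta>)" for y \<theta>
  define c where "c = exp (- (real (card I) * e))"
  have c: "0 < c" by (simp add: c_def)
  have cn: "ennreal (exp (- e)) ^ card I = ennreal c"
    by (simp add: c_def ennreal_power exp_of_nat_mult[symmetric])
  have L0: "0 \<le> L y \<theta>" for y \<theta> unfolding L_def using g_nonneg by (intro prod_nonneg) auto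
  have L_meas: "(\<lambda>(y, \<theta>). L y \<theta>) \<in> borel_measurable (?P \<Otimes>\<^sub>M \<pi>)"
    unfolding L_def using measurable_product_likelihood[OF g_meas] .
  have L_meas'[measurable]: "(\<lambda>z. L (fst z) (snd z)) \<in> borel_measurable (?P \<Otimes>\<^sub>M \<pi>)"
    using L_meas by (simp add: split_beta')
  have L_t[measurable]: "L y \<in> borel_measurable \<pi>" if "y \<in> space ?P" for y
    using measurable_compose[OF measurable_Pair1'[OF that, of \<pi>] L_meas] by simp
  have Gs[measurable]: "G j \<in> sets \<pi>" for j using G by auto
  define D where "D y = (\<integral>\<^sup>+\<theta>. ennreal (L y \<theta>) \<partial>\<pi>)" for y
  define N where "N j y = (\<integral>\<^sup>+\<theta>. ennreal (L y \<theta>) * indicator (G j) \<theta> \<partial>\<pi>)" for j y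
  have D_meas[measurable]: "D \<in> borel_measurable ?P"
    unfolding D_def by (rule \<pi>.borel_measurable_nn_integral) (simp add: split_beta')
  have N_meas[measurable]: "N j \<in> borel_measurable ?P" for j
    unfolding N_def by (rule \<pi>.borel_measurable_nn_integral) (simp add: split_beta')
  have EL: "(\<integral>\<^sup>+y. ennreal (L y \<theta>) \<partial>?P) \<le> 1" if "\<theta> \<in> space \<pi>" for \<theta>
  proof -
    have [measurable]: "(\<lambda>y. g y \<theta>) \<in> borel_measurable Q"
      using measurable_compose[OF measurable_Pair2'[OF that, of Q] g_meas] by simp
    have "(\<integral>\<^sup>+y. ennreal (L y \<theta>) \<partial>?P) = (\<integral>\<^sup>+y. (\<Prod>i\<in>I. ennreal (g (y i) \<theta>)) \<partial>?P)"
      unfolding L_def using g_nonneg by (simp add: prod_ennreal)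
    also have "\<dots> = (\<Prod>i\<in>I. \<integral>\<^sup>+y. ennreal (g y \<theta>) \<partial>Q)"
      using I by (intro product_nn_integral_prod) auto
    also have "\<dots> \<le> 1"
      using I
    proof induction
      case (insert i F)
      then show ?case using mult_mono[OF g_le1[OF that] insert.IH] by simp
    qed simp
    finally show ?thesis .
  qed
  have swap: "(\<integral>\<^sup>+y. \<integral>\<^sup>+\<theta>. ennreal (L y \<theta>) * indicator H \<theta> \<partial>\<pi> \<partial>?P) \<le> emeasure \<pi> H"
    if [measurable]: "H \<in> sets \<pi>" for H
  proof -
    have "(\<lambda>(y, \<theta>). ennreal (L y \<theta>) * indicator H \<theta>) \<in> borel_measurable (?P \<Otimes>\<^sub>M \<pi>)"
      unfolding split_beta' by measurable
    from PP.Fubini'[OF this]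
    have "(\<integral>\<^sup>+y. \<integral>\<^sup>+\<theta>. ennreal (L y \<theta>) * indicator H \<theta> \<partial>\<pi> \<partial>?P)
      = (\<integral>\<^sup>+\<theta>. \<integral>\<^sup>+y. ennreal (L y \<theta>) * indicator H \<theta> \<partial>?P \<partial>\<pi>)" by simp
    also have "\<dots> \<le> (\<integral>\<^sup>+\<theta>. indicator H \<theta> \<partial>\<pi>)"
    proof (rule nn_integral_mono)
      fix \<theta> assume "\<theta> \<in> space \<pi>"
      then show "(\<integral>\<^sup>+y. ennreal (L y \<theta>) * indicator H \<theta> \<partial>?P) \<le> indicator H \<theta>"
        using EL by (auto split: split_indicator)
    qed
    also have "\<dots> = emeasure \<pi> H" by simp
    finally show ?thesis .
  qed
  have ED: "(\<integral>\<^sup>+y. D y \<partial>?P) \<le> 1"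
  proof -
    have "(\<integral>\<^sup>+y. D y \<partial>?P) = (\<integral>\<^sup>+y. \<integral>\<^sup>+\<theta>. ennreal (L y \<theta>) * indicator (space \<pi>) \<theta> \<partial>\<pi> \<partial>?P)"
      unfolding D_def by (intro nn_integral_cong) simp
    also have "\<dots> \<le> emeasure \<pi> (space \<pi>)" by (rule swap) simp
    finally show ?thesis by (simp add: \<pi>.emeasure_space_1)
  qed
  define m where "m j = measure \<pi> (G j)" for j
  have EN: "(\<integral>\<^sup>+y. N j y \<partial>?P) \<le> ennreal (m j)" for j
    unfolding N_def m_def using swap[OF Gs[of j]] by (simp add: \<pi>.emeasure_eq_measure)
  have ENr: "(\<integral>\<^sup>+y. epow (N j y) r \<partial>?P) \<le> ennreal (c * m j powr r)" for j
  proof -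
    define \<nu> where "\<nu> = density \<pi> (indicator (G j))"
    have sets: "sets \<nu> = sets \<pi>" and space: "space \<nu> = space \<pi>" by (simp_all add: \<nu>_def)
    have mass: "emeasure \<nu> (space \<nu>) = ennreal (m j)"
    proof -
      have "emeasure \<nu> (space \<nu>) = (\<integral>\<^sup>+\<theta>. indicator (G j) \<theta> * indicator (space \<pi>) \<theta> \<partial>\<pi>)"
        unfolding \<nu>_def by (subst emeasure_density) auto
      also have "\<dots> = (\<integral>\<^sup>+\<theta>. indicator (G j) \<theta> \<partial>\<pi>)" by (intro nn_integral_cong) simp
      finally show ?thesis by (simp add: m_def \<pi>.emeasure_eq_measure)
    qed
    have "finite_measure \<nu>" by (intro finite_measureI) (simp add: mass)
    moreover have "(\<lambda>(x, \<theta>). g x \<theta>) \<in> borel_measurable (Q \<Otimes>\<^sub>M \<nu>)"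
      using g_meas measurable_cong_sets[OF sets_pair_measure_cong[OF refl sets] refl] by blast
    moreover have "AE \<theta> in \<nu>. \<theta> \<in> G j"
      unfolding \<nu>_def by (subst AE_density) (auto intro!: AE_I2 split: split_indicator_asm)
    ultimately have "(\<integral>\<^sup>+y. epow (\<integral>\<^sup>+\<theta>. ennreal (\<Prod>i\<in>I. g (y i) \<theta>) \<partial>\<nu>) r \<partial>?P)
       \<le> ennreal (exp (- e)) ^ card I * epow (emeasure \<nu> (space \<nu>)) r"
      using r avg by (intro product_mixture_moment_le[OF Q _ _ g_nonneg _ _ _ _ _ I]) auto
    moreover have "(\<integral>\<^sup>+y. epow (N j y) r \<partial>?P) = (\<integral>\<^sup>+y. epow (\<integral>\<^sup>+\<theta>. ennreal (\<Prod>i\<in>I. g (y i) \<theta>) \<partial>\<nu>) r \<partial>?P)"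
    proof (rule nn_integral_cong)
      fix y assume y: "y \<in> space ?P"
      have "(\<integral>\<^sup>+\<theta>. ennreal (L y \<theta>) \<partial>\<nu>) = N j y"
        unfolding \<nu>_def N_def using y by (subst nn_integral_density) (auto simp: mult.commute)
      then show "epow (N j y) r = epow (\<integral>\<^sup>+\<theta>. ennreal (\<Prod>i\<in>I. g (y i) \<theta>) \<partial>\<nu>) r" by (simp add: L_def)
    qed
    ultimately show ?thesis
      unfolding cn mass using c by (simp add: m_def ennreal_mult)
  qed
  have Nsum: "(\<integral>\<^sup>+\<theta>. ennreal (L y \<theta>) * indicator (\<Union>j. G j) \<theta> \<partial>\<pi>) = (\<Sum>j. N j y)" if y: "y \<in> space ?P" for y
  proof -
    have "(\<integral>\<^sup>+\<theta>. ennreal (L y \<theta>) * indicator (\<Union>j. G j) \<theta> \<partial>\<pi>) = (\<integral>\<^sup>+\<theta>. (\<Sum>j. ennreal (L y \<theta>) * indicator (G j) \<theta>) \<partial>\<pi>)"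
      using suminf_indicator[OF G(2)] by (intro nn_integral_cong) simp
    also have "\<dots> = (\<Sum>j. N j y)" unfolding N_def using y by (intro nn_integral_suminf) measurable
    finally show ?thesis .
  qed
  define NN where "NN y = (\<Sum>j. N j y)" for y
  have [measurable]: "NN \<in> borel_measurable ?P" unfolding NN_def by measurable
  have bad': "AE y in ?P. y \<in> E \<longrightarrow> 0 < NN y \<and> D y \<le> ennreal (1 + exp t) * NN y"
    using bad AE_space
    by eventually_elim (simp add: Nsum[unfolded L_def] NN_def D_def L_def)
  have evid: "(LINT y|?P. W y) \<le> 2 * x"
    if W: "integrable ?P W" "AE y in ?P. ennreal (exp (W y)) * D y \<le> 1" for W
  proof -
    have pos: "AE y in ?P. \<forall>i\<in>I. 0 < g (y i) \<theta>" if "\<theta> \<in> B" for \<theta>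
      using I B_pos[OF that] Q by (intro eventually_ball_finite ballI AE_PiM_component) auto
    have lnL: "AE y in ?P. ln (L y \<theta>) = (\<Sum>i\<in>I. ln (g (y i) \<theta>))" if "\<theta> \<in> B" for \<theta>
      using pos[OF that] by eventually_elim (use I in \<open>auto simp: L_def intro!: ln_prod\<close>)
    have Bs: "\<theta> \<in> space \<pi>" if "\<theta> \<in> B" for \<theta> using B sets.sets_into_space that by blast
    have L_m: "(\<lambda>y. L y \<theta>) \<in> borel_measurable ?P" if "\<theta> \<in> B" for \<theta>
      using measurable_compose[OF measurable_Pair2'[OF Bs[OF that], of ?P] L_meas] by simp
    have "(LINT y|?P. W y) \<le> x - ln (measure \<pi> B)"
    proof (rule expectation_le_of_exp_evidence[OF P.prob_space_axioms \<pi> L_meas W(1) _ B(1,2)])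
      show "AE y in ?P. ennreal (exp (W y)) * (\<integral>\<^sup>+\<theta>. ennreal (L y \<theta>) \<partial>\<pi>) \<le> 1"
        using W(2) by (simp add: D_def)
      fix \<theta> assume \<theta>: "\<theta> \<in> B"
      note pl = product_log_expectation[OF Q I B_int[OF \<theta>]]
      show "AE y in ?P. 0 < L y \<theta>"
        using pos[OF \<theta>] by eventually_elim (auto simp: L_def intro: prod_pos)
      have [measurable]: "(\<lambda>y. L y \<theta>) \<in> borel_measurable ?P" using L_m[OF \<theta>] .
      have lm: "(\<lambda>y. ln (L y \<theta>)) \<in> borel_measurable ?P" by measurable
      show "integrable ?P (\<lambda>y. ln (L y \<theta>))"
        using integrable_cong_AE[OF lm borel_measurable_integrable[OF pl(1)] lnL[OF \<theta>]] pl(1) by simp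
      show "- x \<le> (LINT y|?P. ln (L y \<theta>))"
        using integral_cong_AE[OF lm borel_measurable_integrable[OF pl(1)] lnL[OF \<theta>]] pl(2) B_ln[OF \<theta>] by simp
    qed
    then show ?thesis using B(3) by simp
  qed
  have b1: "measure ?P E \<le> 1" by simp
  have e1: "1 \<le> 1 + exp t" by simp
  show False
  proof (cases "1 \<le> k")
    case True
    define s where "s = (\<gamma> - 1) / k"
    have s: "s = 1 - (1 - r) / k" using k by (simp add: s_def field_simps)
    have s0: "0 < s" using True k r by (simp add: s_def)
    have "(\<integral>\<^sup>+y. epow (NN y) s \<partial>?P) \<le> ennreal (c powr (1 / k) * U)"
      unfolding NN_def
      using r c True a U by (intro sum_moment_le_of_large_exponent[OF N_meas _ EN ENr _ _ _ _ s]) (auto simp: m_def s_def)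
    from bad_event_probability_bound[OF P.prob_space_axioms D_meas _ ED s0 this _ E b e1 bad' evid]
    show False
      using rate_contradiction_large[OF b b1 U(2) x(1) t r True k(2) rate] c U(2) by (simp add: s c_def)
  next
    case False
    have rs: "r = (\<gamma> - 1) / k * k + (1 - k)" using k by simp
    have V: "(\<Sum>j. ennreal (m j)) \<le> ennreal x"
    proof -
      have "(\<Sum>j. ennreal (m j)) = emeasure \<pi> (\<Union>j. G j)"
        unfolding m_def \<pi>.emeasure_eq_measure[symmetric] using G by (intro suminf_emeasure) auto
      then show ?thesis using x by (simp add: \<pi>.emeasure_eq_measure)
    qed
    have "(\<integral>\<^sup>+y. epow (NN y) r \<partial>?P) \<le> ennreal (c * (U powr k * x powr (1 - k)))"
      unfolding NN_def
      using r c k False a U x by (intro sum_moment_le_of_small_exponent[OF N_meas _ ENr _ _ _ _ _ rs _ _ _ V]) (auto simp: m_def)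
    from bad_event_probability_bound[OF P.prob_space_axioms D_meas _ ED r(1) this _ E b e1 bad' evid]
    show False
      using rate_contradiction_small[OF b b1 U(2) x(1) t r k(1) _ k(2) \<gamma> rate] False c U(2) x by (simp add: c_def)
  qed
qed

section \<open>Posterior probabilities and the sets in the statement\<close>

text \<open>A ratio above \<open>1 / a > 0\<close> has a nonzero denominator. Since the integral of a function that is
  not integrable is 0 by convention, both integrals are then genuine. The factor \<open>\<kappa>\<close> is the
  likelihood of the true density, which cancels from the posterior.\<close>

lemma ratio_gt_imp_nn_integral_bound:
  fixes L :: "'b \<Rightarrow> real"
  assumes L: "L \<in> borel_measurable \<pi>" "\<And>\<theta>. 0 \<le> L \<theta>" and A: "A \<in> sets \<pi>"
    and \<kappa>: "0 < \<kappa>" and a: "1 \<le> a"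
    and gt: "1 / a < (LINT \<theta>:A|\<pi>. \<kappa> * L \<theta>) / (LINT \<theta>|\<pi>. \<kappa> * L \<theta>)"
  shows "0 < (\<integral>\<^sup>+\<theta>. ennreal (L \<theta>) * indicator A \<theta> \<partial>\<pi>)"
    and "(\<integral>\<^sup>+\<theta>. ennreal (L \<theta>) \<partial>\<pi>) \<le> ennreal a * (\<integral>\<^sup>+\<theta>. ennreal (L \<theta>) * indicator A \<theta> \<partial>\<pi>)"
proof -
  have "0 < 1 / a" using a by simp
  with gt have "(LINT \<theta>|\<pi>. \<kappa> * L \<theta>) \<noteq> 0" by (auto split: if_splits)
  then have ne: "(LINT \<theta>|\<pi>. L \<theta>) \<noteq> 0" by simp
  then have int: "integrable \<pi> L" using not_integrable_integral_eq by blast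
  have intA: "integrable \<pi> (\<lambda>\<theta>. indicator A \<theta> * L \<theta>)"
    using integrable_mult_indicator[OF A int] by simp
  define d where "d = (LINT \<theta>|\<pi>. L \<theta>)"
  define m where "m = (LINT \<theta>|\<pi>. indicator A \<theta> * L \<theta>)"
  have "0 \<le> d" unfolding d_def using L by (intro integral_nonneg_AE) auto
  then have d: "0 < d" using ne by (simp add: d_def)
  have D: "(\<integral>\<^sup>+\<theta>. ennreal (L \<theta>) \<partial>\<pi>) = ennreal d"
    unfolding d_def using int L by (intro nn_integral_eq_integral) auto
  have "(\<integral>\<^sup>+\<theta>. ennreal (L \<theta>) * indicator A \<theta> \<partial>\<pi>) = (\<integral>\<^sup>+\<theta>. ennreal (indicator A \<theta> * L \<theta>) \<partial>\<pi>)"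
    by (intro nn_integral_cong) (simp split: split_indicator)
  also have "\<dots> = ennreal m"
    unfolding m_def using intA L by (intro nn_integral_eq_integral) auto
  finally have N: "(\<integral>\<^sup>+\<theta>. ennreal (L \<theta>) * indicator A \<theta> \<partial>\<pi>) = ennreal m" .
  have "(LINT \<theta>:A|\<pi>. \<kappa> * L \<theta>) = (LINT \<theta>|\<pi>. \<kappa> * (indicator A \<theta> * L \<theta>))"
    unfolding set_lebesgue_integral_def by (intro Bochner_Integration.integral_cong) auto
  also have "\<dots> = \<kappa> * m" by (simp add: m_def)
  finally have "(LINT \<theta>:A|\<pi>. \<kappa> * L \<theta>) = \<kappa> * m" .
  moreover have "(LINT \<theta>|\<pi>. \<kappa> * L \<theta>) = \<kappa> * d" by (simp add: d_def)
  ultimately have "1 / a < (\<kappa> * m) / (\<kappa> * d)" using gt by (simp only:)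
  then have "1 / a < m / d" using \<kappa> by simp
  then have "d < a * m" using a d by (simp add: field_simps)
  moreover from this have "0 < a * m" using d by simp
  ultimately have m: "d \<le> a * m" "0 < m" using a by (auto simp: zero_less_mult_iff)
  show "0 < (\<integral>\<^sup>+\<theta>. ennreal (L \<theta>) * indicator A \<theta> \<partial>\<pi>)" using m by (simp add: N)
  show "(\<integral>\<^sup>+\<theta>. ennreal (L \<theta>) \<partial>\<pi>) \<le> ennreal a * (\<integral>\<^sup>+\<theta>. ennreal (L \<theta>) * indicator A \<theta> \<partial>\<pi>)"
    unfolding D N using m a by (simp add: ennreal_mult[symmetric] ennreal_leI)
qed

lemma measurable_posterior:
  assumes \<pi>: "prob_space \<pi>" and p_meas: "(\<lambda>(x, \<theta>). p \<theta> x) \<in> borel_measurable (M \<Otimes>\<^sub>M \<pi>)"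
    and A[measurable]: "A \<in> sets \<pi>"
  shows "(\<lambda>y. posterior \<pi> p n y A) \<in> borel_measurable (PiM {1..n} (\<lambda>_. M))"
proof -
  interpret \<pi>: prob_space \<pi> by fact
  let ?P = "PiM {1..n} (\<lambda>_. M)"
  have f: "(\<lambda>(y, \<theta>). \<Prod>i\<in>{1..n}. p \<theta> (y i)) \<in> borel_measurable (?P \<Otimes>\<^sub>M \<pi>)"
    using measurable_product_likelihood[OF p_meas] .
  then have [measurable]: "(\<lambda>z. \<Prod>i\<in>{1..n}. p (snd z) (fst z i)) \<in> borel_measurable (?P \<Otimes>\<^sub>M \<pi>)"
    unfolding split_beta' .
  have 1: "(\<lambda>y. LINT \<theta>|\<pi>. (\<Prod>i\<in>{1..n}. p \<theta> (y i))) \<in> borel_measurable ?P"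
    using f by (rule \<pi>.borel_measurable_lebesgue_integral)
  have 2: "(\<lambda>y. LINT \<theta>|\<pi>. indicator A \<theta> *\<^sub>R (\<Prod>i\<in>{1..n}. p \<theta> (y i))) \<in> borel_measurable ?P"
  proof (rule \<pi>.borel_measurable_lebesgue_integral)
    show "(\<lambda>(y, \<theta>). indicator A \<theta> *\<^sub>R (\<Prod>i\<in>{1..n}. p \<theta> (y i))) \<in> borel_measurable (?P \<Otimes>\<^sub>M \<pi>)"
      unfolding split_beta' by measurable
  qed
  show ?thesis unfolding posterior_def set_lebesgue_integral_def using 1 2 by measurable
qed

lemma D_rho_ge_sets:
  assumes q: "prob_density M q" and \<pi>: "prob_space \<pi>"
    and p_meas: "(\<lambda>(x, \<theta>). p \<theta> x) \<in> borel_measurable (M \<Otimes>\<^sub>M \<pi>)"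
  shows "D_rho_ge \<rho> M q \<pi> p e \<in> sets \<pi>"
proof -
  let ?Q = "density M (\<lambda>x. ennreal (q x))"
  interpret Q: prob_space ?Q by (rule prob_space_density_prob_density[OF q])
  have [measurable]: "q \<in> borel_measurable M" using q by (simp add: prob_density_def)
  have [measurable]: "(\<lambda>z. p (snd z) (fst z)) \<in> borel_measurable (M \<Otimes>\<^sub>M \<pi>)"
    using p_meas by (simp add: split_beta')
  have "(\<lambda>(x, \<theta>). 1 - (p \<theta> x / q x) powr \<rho>) \<in> borel_measurable (M \<Otimes>\<^sub>M \<pi>)"
    unfolding split_beta' by measurable
  then have "(\<lambda>(\<theta>, x). 1 - (p \<theta> x / q x) powr \<rho>) \<in> borel_measurable (\<pi> \<Otimes>\<^sub>M M)"
    by (rule measurable_pair_swap[THEN measurable_cong[THEN iffD1, rotated]]) (auto simp: split_beta')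
  moreover have "sets (\<pi> \<Otimes>\<^sub>M ?Q) = sets (\<pi> \<Otimes>\<^sub>M M)" by (intro sets_pair_measure_cong) auto
  ultimately have "(\<lambda>(\<theta>, x). 1 - (p \<theta> x / q x) powr \<rho>) \<in> borel_measurable (\<pi> \<Otimes>\<^sub>M ?Q)"
    using measurable_cong_sets by blast
  then have [measurable]: "(\<lambda>\<theta>. LINT x|?Q. 1 - (p \<theta> x / q x) powr \<rho>) \<in> borel_measurable \<pi>"
    by (rule Q.borel_measurable_lebesgue_integral)
  show ?thesis unfolding D_rho_ge_def D_rho_def by measurable
qed

section \<open>The prior-mass rate and the convex-hull entropy rate\<close>

lemma suminf_le_infsum_ennreal:
  fixes a :: "nat \<Rightarrow> ennreal"
  assumes "\<And>j. j \<notin> J \<Longrightarrow> a j = 0"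
  shows "(\<Sum>j. a j) \<le> (\<Sum>\<^sub>\<infinity>j\<in>J. a j)"
  unfolding suminf_eq_SUP
proof (rule SUP_least)
  fix n :: nat
  have "(\<Sum>j<n. a j) = (\<Sum>j\<in>J \<inter> {..<n}. a j)"
    using assms by (intro sum.mono_neutral_right) auto
  also have "\<dots> \<le> (\<Sum>\<^sub>\<infinity>j\<in>J. a j)"
    by (subst nonneg_infsum_complete) (auto intro!: SUP_upper)
  finally show "(\<Sum>j<n. a j) \<le> (\<Sum>\<^sub>\<infinity>j\<in>J. a j)" .
qed

lemma eln_less_imp:
  assumes "eln a < ereal y"
  shows "a < ennreal (exp y)"
proof (cases "a = 0")
  case False
  then obtain z where z: "a = ennreal z" "0 < z"
    using assms by (cases a) (auto simp: eln_def less_le split: if_splits)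
  then have "ln z < y" using assms by (simp add: eln_def)
  then have "z < exp y" using z by (metis exp_less_mono exp_ln)
  then show ?thesis using z by (simp add: ennreal_lessI)
qed simp

lemma ln_2_le_eln: "ereal (ln 2) \<le> eln (a + 2)"
proof (cases a)
  case (real x)
  then have "a + 2 = ennreal (x + 2)" by (simp add: ennreal_plus)
  moreover have "ln 2 \<le> ln (x + 2)" using real by (intro ln_mono) auto
  ultimately show ?thesis using real by (simp add: eln_def ennreal_eq_0_iff del: ennreal_plus)
qed (simp add: eln_def)

text \<open>The summand 2 in the logarithm keeps every entropy at least \<open>ln 2\<close>, so the set in the
  definition contains all small positive numbers.\<close>

lemma eps_conv_pos:
  assumes "1 \<le> n"
  shows "0 < eps_conv \<rho> M q \<pi> p n s"
proof -
  let ?F = "\<lambda>\<epsilon>. INF (J, G)\<in>hull_covers \<rho> M q \<pi> p \<epsilon>. eln ((\<Sum>\<^sub>\<infinity>j\<in>J. ennreal (powr1 (measure \<pi> (G j)) s)) + 2)"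
  define \<epsilon>0 where "\<epsilon>0 = ln 2 / (2 * real n)"
  have e0: "0 < \<epsilon>0" using assms by (simp add: \<epsilon>0_def)
  have "ereal (ln 2) \<le> ?F \<epsilon>0" by (intro INF_greatest) (auto simp: ln_2_le_eln split: prod.split)
  also have "\<dots> \<le> (SUP \<epsilon>\<in>{\<epsilon>0..}. ?F \<epsilon>)" by (intro SUP_upper) simp
  finally have "ereal (1 / real n) * ereal (ln 2) \<le> ereal (1 / real n) * (SUP \<epsilon>\<in>{\<epsilon>0..}. ?F \<epsilon>)"
    by (intro ereal_mult_left_mono) auto
  moreover have "ereal \<epsilon>0 < ereal (1 / real n) * ereal (ln 2)"
    using assms by (simp add: \<epsilon>0_def field_simps)
  ultimately have "ereal \<epsilon>0 < ereal (1 / real n) * (SUP \<epsilon>\<in>{\<epsilon>0..}. ?F \<epsilon>)" by (rule less_le_trans[rotated])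
  then have "ereal \<epsilon>0 \<le> eps_conv \<rho> M q \<pi> p n s"
    unfolding eps_conv_def using e0 by (intro Sup_upper) blast
  then show ?thesis using e0 by (metis ereal_less(2) less_le_trans)
qed

text \<open>Beyond the supremum the defining inequality fails, which bounds the infimum over covers at
  every larger radius. Writing the entropy bound as \<open>ln (U + 2) = Y\<close> with \<open>U > 0\<close> makes \<open>U\<close> a
  usable normalization even if the sum over the cover vanishes.\<close>

lemma eps_conv_cover:
  assumes n: "1 \<le> n" and lt: "eps_conv \<rho> M q \<pi> p n s < ereal \<epsilon>0" and e0: "0 < \<epsilon>0" "\<epsilon>0 \<le> \<epsilon>"
    and Y: "real n * \<epsilon>0 < Y"
  obtains J G U where "(J, G) \<in> hull_covers \<rho> M q \<pi> p \<epsilon>"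
    and "(\<Sum>\<^sub>\<infinity>j\<in>J. ennreal (powr1 (measure \<pi> (G j)) s)) \<le> ennreal U" and "0 < U" and "ln (U + 2) = Y"
proof -
  let ?S = "\<lambda>J G. (\<Sum>\<^sub>\<infinity>j\<in>J. ennreal (powr1 (measure \<pi> (G j)) s))"
  let ?F = "\<lambda>\<epsilon>. INF (J, G)\<in>hull_covers \<rho> M q \<pi> p \<epsilon>. eln (?S J G + 2)"
  have "\<not> ereal \<epsilon>0 < ereal (1 / real n) * (SUP \<epsilon>\<in>{\<epsilon>0..}. ?F \<epsilon>)"
  proof
    assume "ereal \<epsilon>0 < ereal (1 / real n) * (SUP \<epsilon>\<in>{\<epsilon>0..}. ?F \<epsilon>)"
    then have "ereal \<epsilon>0 \<le> eps_conv \<rho> M q \<pi> p n s"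
      unfolding eps_conv_def using e0 by (intro Sup_upper) blast
    then show False using lt by simp
  qed
  then have le: "ereal (1 / real n) * (SUP \<epsilon>\<in>{\<epsilon>0..}. ?F \<epsilon>) \<le> ereal \<epsilon>0" by simp
  have "?F \<epsilon> \<le> (SUP \<epsilon>\<in>{\<epsilon>0..}. ?F \<epsilon>)" using e0 by (intro SUP_upper) simp
  then have "ereal (1 / real n) * ?F \<epsilon> \<le> ereal (1 / real n) * (SUP \<epsilon>\<in>{\<epsilon>0..}. ?F \<epsilon>)"
    by (intro ereal_mult_left_mono) auto
  with le have "ereal (1 / real n) * ?F \<epsilon> \<le> ereal \<epsilon>0" by (rule order_trans[rotated])
  then have "?F \<epsilon> \<le> ereal (real n * \<epsilon>0)"
    using n by (cases "?F \<epsilon>") (auto simp: field_simps)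
  also have "\<dots> < ereal Y" using Y by simp
  finally obtain J G where JG: "(J, G) \<in> hull_covers \<rho> M q \<pi> p \<epsilon>" and S: "eln (?S J G + 2) < ereal Y"
    by (auto simp: INF_less_iff)
  from eln_less_imp[OF S] have lt2: "?S J G + 2 < ennreal (exp Y)" .
  obtain z where z: "?S J G = ennreal z" "0 \<le> z" using lt2 by (cases "?S J G") auto
  then have "?S J G + 2 = ennreal (z + 2)" by (simp add: ennreal_plus)
  with lt2 z have "z + 2 < exp Y" by (simp add: ennreal_less_iff del: ennreal_plus)
  then show ?thesis using z JG by (intro that[of J G "exp Y - 2"]) (auto intro: ennreal_leI)
qed

lemma eps_pi_nonneg:
  assumes "prob_space \<pi>"
  shows "0 \<le> eps_pi M q \<pi> p n"
  unfolding eps_pi_def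
proof (rule Inf_greatest, safe)
  interpret prob_space \<pi> by fact
  fix \<epsilon> assume le: "- (ereal (1 / real n) * eln (emeasure \<pi> {\<theta> \<in> space \<pi>. D_KL M q (p \<theta>) \<le> ereal \<epsilon>})) \<le> ereal \<epsilon>"
  have "eln (emeasure \<pi> B) \<le> 0" for B
    by (auto simp: eln_def emeasure_eq_measure intro!: ln_le_zero_iff[THEN iffD2] simp: less_le)
  then have "ereal (1 / real n) * eln (emeasure \<pi> B) \<le> 0" for B
    using ereal_mult_left_mono[of "eln (emeasure \<pi> B)" 0 "ereal (1 / real n)"] by simp
  then have "0 \<le> - (ereal (1 / real n) * eln (emeasure \<pi> {\<theta> \<in> space \<pi>. D_KL M q (p \<theta>) \<le> ereal \<epsilon>}))"
    by simp
  with le show "0 \<le> ereal \<epsilon>" by (rule order_trans[rotated])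
qed

text \<open>A set that is not measurable has \<open>emeasure\<close> 0, for which the right-hand side of the defining
  inequality is infinite. So every real \<open>\<epsilon>\<close> admitted in the infimum has a measurable ball of
  positive mass.\<close>

lemma eps_pi_ball:
  assumes \<pi>: "prob_space \<pi>" and n: "1 \<le> n" and lt: "eps_pi M q \<pi> p n < ereal y"
  obtains \<epsilon> where "\<epsilon> < y"
    and "{\<theta> \<in> space \<pi>. D_KL M q (p \<theta>) \<le> ereal \<epsilon>} \<in> sets \<pi>"
    and "0 < measure \<pi> {\<theta> \<in> space \<pi>. D_KL M q (p \<theta>) \<le> ereal \<epsilon>}"
    and "- ln (measure \<pi> {\<theta> \<in> space \<pi>. D_KL M q (p \<theta>) \<le> ereal \<epsilon>}) \<le> real n * \<epsilon>"
proof -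
  interpret prob_space \<pi> by fact
  obtain \<epsilon> where e: "\<epsilon> < y"
    and le: "- (ereal (1 / real n) * eln (emeasure \<pi> {\<theta> \<in> space \<pi>. D_KL M q (p \<theta>) \<le> ereal \<epsilon>})) \<le> ereal \<epsilon>"
    using lt unfolding eps_pi_def Inf_less_iff by auto
  define B where "B = {\<theta> \<in> space \<pi>. D_KL M q (p \<theta>) \<le> ereal \<epsilon>}"
  have ne: "emeasure \<pi> B \<noteq> 0"
  proof
    assume "emeasure \<pi> B = 0"
    then have "eln (emeasure \<pi> B) = - \<infinity>" by (simp add: eln_def)
    then show False using le n by (simp add: B_def[symmetric])
  qed
  then have sets: "B \<in> sets \<pi>" using emeasure_notin_sets by blast
  have pos: "0 < measure \<pi> B" using ne by (simp add: emeasure_eq_measure less_le)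
  then have "eln (emeasure \<pi> B) = ereal (ln (measure \<pi> B))"
    by (simp add: eln_def emeasure_eq_measure ennreal_eq_0_iff)
  with le have "- (1 / real n * ln (measure \<pi> B)) \<le> \<epsilon>" by (simp add: B_def[symmetric])
  then have "- ln (measure \<pi> B) \<le> real n * \<epsilon>" using n by (simp add: field_simps)
  with e sets pos show ?thesis unfolding B_def by (rule that)
qed

section \<open>Posterior concentration\<close>

text \<open>The average of densities from one set of the cover is a density in its convex hull, where
  \<open>D_rho\<close> is at least half the radius.\<close>

lemma hull_covers_average_moment:
  assumes q: "prob_density M q"
    and p: "\<And>\<theta>. \<theta> \<in> space \<pi> \<Longrightarrow> prob_density M (p \<theta>)"
    and r: "0 < \<rho>" "\<rho> < 1"
    and JG: "(J, G) \<in> hull_covers \<rho> M q \<pi> p \<epsilon>"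
    and m: "0 < m" and j: "j \<in> J" and \<theta>: "\<And>i. i < m \<Longrightarrow> \<theta> i \<in> G j"
  shows "(\<integral>\<^sup>+x. ennreal (((\<Sum>i<m. \<bar>p (\<theta> i) x / q x\<bar>) / real m) powr \<rho>) \<partial>density M (\<lambda>x. ennreal (q x)))
    \<le> ennreal (exp (- (\<rho> * (1 - \<rho>) * (\<epsilon> / 2))))"
proof -
  define f where "f x = (\<Sum>i<m. p (\<theta> i) x) / real m" for x
  have "G j \<in> sets \<pi>" using JG j by (auto simp: hull_covers_def)
  then have \<theta>s: "\<theta> i \<in> space \<pi>" if "i < m" for i using \<theta>[OF that] sets.sets_into_space by blast
  note pd = p[OF \<theta>s, unfolded prob_density_def]
  have "f \<in> co (p ` G j)"
    unfolding f_def using average_in_co[OF m, of "\<lambda>i. p (\<theta> i)"] \<theta> by simp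
  then have "ereal (\<epsilon> / 2) \<le> ereal (D_rho \<rho> M q f)"
    using JG j by (auto simp: hull_covers_def le_INF_iff)
  then have D: "\<epsilon> / 2 \<le> D_rho \<rho> M q f" by simp
  have fm: "f \<in> borel_measurable M"
    unfolding f_def using pd by (intro borel_measurable_divide borel_measurable_sum) auto
  have f0: "0 \<le> f x" if "x \<in> space M" for x
    unfolding f_def using pd that by (intro divide_nonneg_nonneg sum_nonneg) auto
  have "(\<integral>\<^sup>+x. ennreal (f x) \<partial>M) = (\<integral>\<^sup>+x. ennreal (1 / real m) * (\<Sum>i<m. ennreal (p (\<theta> i) x)) \<partial>M)"
  proof (rule nn_integral_cong)
    fix x assume x: "x \<in> space M"
    have "(\<Sum>i<m. ennreal (p (\<theta> i) x)) = ennreal (\<Sum>i<m. p (\<theta> i) x)"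
      using pd x by (intro sum_ennreal) auto
    moreover have "0 \<le> (\<Sum>i<m. p (\<theta> i) x)" using pd x by (intro sum_nonneg) auto
    ultimately show "ennreal (f x) = ennreal (1 / real m) * (\<Sum>i<m. ennreal (p (\<theta> i) x))"
      by (simp add: f_def ennreal_mult[symmetric])
  qed
  also have "\<dots> = ennreal (1 / real m) * (\<Sum>i<m. \<integral>\<^sup>+x. ennreal (p (\<theta> i) x) \<partial>M)"
  proof -
    have pm: "(\<lambda>x. ennreal (p (\<theta> i) x)) \<in> borel_measurable M" if "i \<in> {..<m}" for i
      using pd[of i] that by auto
    have "(\<lambda>x. \<Sum>i<m. ennreal (p (\<theta> i) x)) \<in> borel_measurable M"
      using pm by (rule borel_measurable_sum)
    then show ?thesis using nn_integral_sum[of "{..<m}" "\<lambda>i x. ennreal (p (\<theta> i) x)" M, OF pm] by (simp only: nn_integral_cmult)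
  qed
  also have "\<dots> = ennreal (1 / real m) * (\<Sum>i<m. 1)"
    using pd by (intro arg_cong2[where f="(*)"] sum.cong) auto
  also have "\<dots> = 1" using m by (simp add: ennreal_of_nat_eq_real_of_nat ennreal_mult[symmetric])
  finally have f1: "(\<integral>\<^sup>+x. ennreal (f x) \<partial>M) \<le> 1" by simp
  have "(\<integral>\<^sup>+x. ennreal (((\<Sum>i<m. \<bar>p (\<theta> i) x / q x\<bar>) / real m) powr \<rho>) \<partial>density M (\<lambda>x. ennreal (q x)))
    = (\<integral>\<^sup>+x. ennreal ((f x / q x) powr \<rho>) \<partial>density M (\<lambda>x. ennreal (q x)))"
  proof (rule nn_integral_cong)
    fix x assume "x \<in> space (density M (\<lambda>x. ennreal (q x)))"
    then have x: "x \<in> space M" by simp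
    have "0 \<le> q x" using q x by (simp add: prob_density_def)
    then have "(\<Sum>i<m. \<bar>p (\<theta> i) x / q x\<bar>) = (\<Sum>i<m. p (\<theta> i) x / q x)"
      using pd x by (intro sum.cong) (auto intro!: abs_of_nonneg)
    then have "(\<Sum>i<m. \<bar>p (\<theta> i) x / q x\<bar>) / real m = f x / q x"
      by (simp add: f_def sum_divide_distrib[symmetric])
    then show "ennreal (((\<Sum>i<m. \<bar>p (\<theta> i) x / q x\<bar>) / real m) powr \<rho>) = ennreal ((f x / q x) powr \<rho>)"
      by simp
  qed
  also have "\<dots> \<le> ennreal (exp (- (\<rho> * (1 - \<rho>) * (\<epsilon> / 2))))"
    by (rule powr_moment_le_of_D_rho[OF q fm f0 f1 r D])
  finally show ?thesis .
qed

text \<open>The case of finite rates, for the joint law of the sample. If the bad event had probability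
  \<open>b > \<delta>\<close>, a near-optimal cover and a near-optimal Kullback-Leibler ball would satisfy the hypotheses
  of the preceding contradiction.\<close>

lemma posterior_bad_event_le:
  fixes M :: "'a measure" and q :: "'a \<Rightarrow> real"
    and \<pi> :: "'b measure" and p :: "'b \<Rightarrow> 'a \<Rightarrow> real"
    and n :: nat and \<rho> \<gamma> t \<delta> e1 e2 :: real
  assumes q: "prob_density M q"
    and \<pi>: "prob_space \<pi>"
    and p: "\<And>\<theta>. \<theta> \<in> space \<pi> \<Longrightarrow> prob_density M (p \<theta>)"
    and p_meas: "(\<lambda>(x, \<theta>). p \<theta> x) \<in> borel_measurable (M \<Otimes>\<^sub>M \<pi>)"
    and n: "n \<ge> 1"
    and rho: "0 < \<rho>" "\<rho> < 1"
    and gamma: "\<gamma> \<ge> 1"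
    and t: "t \<ge> 0"
    and delta: "0 < \<delta>"
    and e1: "eps_pi M q \<pi> p n = ereal e1"
    and e2: "eps_conv \<rho> M q \<pi> p n ((\<gamma> - 1) / (\<gamma> - \<rho>)) = ereal e2"
  defines "Q \<equiv> density M (\<lambda>x. ennreal (q x))"
  defines "A \<equiv> D_rho_ge \<rho> M q \<pi> p (ereal ((4 * (2 * \<gamma> * e1 + (\<gamma> - \<rho>) * e2) + (8 * \<gamma> - 4) * t) / (\<rho> * (1 - \<rho>) * \<delta>)))"
  shows "measure (PiM {1..n} (\<lambda>_. Q)) {y \<in> space (PiM {1..n} (\<lambda>_. Q)).
    \<not> posterior \<pi> p n y A \<le> 1 / (1 + exp (real n * t))} \<le> \<delta>"
    (is "measure ?P ?E \<le> \<delta>")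
proof (rule ccontr)
  assume "\<not> measure ?P ?E \<le> \<delta>"
  interpret \<pi>: prob_space \<pi> by fact
  have Qp: "prob_space Q" unfolding Q_def by (rule prob_space_density_prob_density[OF q])
  interpret Q: prob_space Q by fact
  interpret P: prob_space ?P by (intro prob_space_PiM Qp)
  have sQ: "sets Q = sets M" "space Q = space M" by (simp_all add: Q_def)
  have [measurable]: "q \<in> borel_measurable M" and q0: "\<And>x. x \<in> space M \<Longrightarrow> 0 \<le> q x"
    using q by (auto simp: prob_density_def)
  define E where "E = ?E"
  define b where "b = measure ?P E"
  define k where "k = \<gamma> - \<rho>"
  define N where "N = real n"
  have "\<delta> < b" using \<open>\<not> measure ?P ?E \<le> \<delta>\<close> by (simp only: b_def E_def not_le)
  moreover have "b \<le> 1" unfolding b_def by (rule P.prob_le_1)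
  ultimately have b: "\<delta> < b" "b \<le> 1" .
  have b0: "0 < b" using b delta by simp
  have k: "0 < k" "1 - \<rho> \<le> k" using gamma rho by (auto simp: k_def)
  have N: "1 \<le> N" using n by (simp add: N_def)
  have "0 \<le> ereal e1" using eps_pi_nonneg[OF \<pi>, of M q p n] e1 by simp
  then have e1_0: "0 \<le> e1" by simp
  have "0 < ereal e2" using eps_conv_pos[OF n, of \<rho> M q \<pi> p] e2 by metis
  then have e2_0: "0 < e2" by simp
  define R where "R = 4 * \<gamma> * (N * e1) + 2 * k * (N * e2) + (4 * \<gamma> - 2) * (N * t)"
  define thr where "thr = (4 * (2 * \<gamma> * e1 + (\<gamma> - \<rho>) * e2) + (8 * \<gamma> - 4) * t) / (\<rho> * (1 - \<rho>) * \<delta>)"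
  have "\<rho> * (1 - \<rho>) \<le> 1 * (1 - \<rho>)" using rho by (intro mult_right_mono) auto
  then have rr: "0 < \<rho> * (1 - \<rho>)" "\<rho> * (1 - \<rho>) \<le> k" "\<rho> * (1 - \<rho>) \<le> 1 - \<rho>"
    using rho k by (auto simp only: mult_1 mult_pos_pos diff_gt_0_iff_gt intro: order_trans)
  have thr_R: "\<rho> * (1 - \<rho>) * \<delta> * N * thr = 2 * R"
  proof -
    define d where "d = \<rho> * (1 - \<rho>) * \<delta>"
    have "0 < d" using rr delta by (simp add: d_def)
    then have "d * N * thr = N * (4 * (2 * \<gamma> * e1 + (\<gamma> - \<rho>) * e2) + (8 * \<gamma> - 4) * t)"
      by (simp add: thr_def d_def[symmetric])
    then show ?thesis unfolding d_def by (simp add: R_def k_def algebra_simps)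
  qed
  have R_ge: "4 * \<gamma> * (N * e1) + 2 * k * (N * e2) \<le> R"
    using gamma N t by (simp add: R_def)
  \<comment> \<open>Since \<open>\<delta> < b\<close>, the exponents in the rate inequality may exceed those in the radius by a
    factor up to \<open>b / \<delta>\<close>; this room absorbs that infima and suprema need not be attained.\<close>
  define \<beta> where "\<beta> = b / \<delta>"
  define s where "s = (1 + \<beta>) / 2"
  define s' where "s' = (1 + s) / 2"
  have \<beta>: "1 < \<beta>" using b delta by (simp add: \<beta>_def)
  have s: "1 < s'" "s' < s" "s < \<beta>" using \<beta> by (auto simp: s_def s'_def)
  define h where "h = k * (N * e2) * (\<beta> - s) / (2 * \<gamma>)"
  define x where "x = N * e1 + h"
  define Y where "Y = N * (e2 * s)"
  have h: "0 < h" unfolding h_def using k N e2_0 s gamma by (intro divide_pos_pos mult_pos_pos) auto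
  have x: "0 < x" using h N e1_0 by (simp add: x_def add_nonneg_pos)
  have rate: "4 * \<gamma> * x + 2 * k * Y + (4 * \<gamma> - 2) * (N * t) \<le> R * \<beta>"
  proof -
    have "4 * \<gamma> * x + 2 * k * Y + (4 * \<gamma> - 2) * (N * t)
      = (4 * \<gamma> * (N * e1) + (4 * \<gamma> - 2) * (N * t)) * 1 + 2 * k * (N * e2) * \<beta>"
      using gamma by (simp add: x_def h_def Y_def field_simps)
    also have "\<dots> \<le> (4 * \<gamma> * (N * e1) + (4 * \<gamma> - 2) * (N * t)) * \<beta> + 2 * k * (N * e2) * \<beta>"
      using \<beta> gamma N e1_0 t by (intro add_right_mono mult_left_mono) auto
    also have "\<dots> = R * \<beta>" by (simp add: R_def algebra_simps)
    finally show ?thesis .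
  qed
  have "0 \<le> 4 * \<gamma> * e1 + (4 * \<gamma> - 2) * t" using gamma e1_0 t by simp
  then have thr_ge: "4 * k * e2 / (\<rho> * (1 - \<rho>) * \<delta>) \<le> thr"
    unfolding thr_def k_def[symmetric] using rr delta gamma e1_0 t
    by (intro divide_right_mono) (auto simp: algebra_simps intro: add_nonneg_nonneg mult_nonneg_nonneg)
  have e0_le: "e2 * s' \<le> thr"
  proof -
    have "s' \<le> 1 / \<delta>" using s b delta divide_right_mono[of b 1 \<delta>] by (simp add: \<beta>_def)
    then have "e2 * s' \<le> e2 * (1 / \<delta>)" using e2_0 by (intro mult_left_mono) auto
    also have "\<dots> \<le> 4 * k * e2 / (\<rho> * (1 - \<rho>) * \<delta>)"
    proof -
      have "e2 * (\<rho> * (1 - \<rho>)) \<le> e2 * (4 * k)" using rr k e2_0 by (intro mult_left_mono) auto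
      then have "e2 * (\<rho> * (1 - \<rho>)) / (\<rho> * (1 - \<rho>) * \<delta>) \<le> 4 * k * e2 / (\<rho> * (1 - \<rho>) * \<delta>)"
        using rr(1) delta by (intro divide_right_mono) (auto simp: mult_ac)
      moreover have "e2 * c / (c * \<delta>) = e2 * (1 / \<delta>)" if "0 < c" for c
        using that by simp
      note this[OF rr(1)]
      ultimately show ?thesis by (simp only:)
    qed
    finally show ?thesis using thr_ge by simp
  qed
  \<comment> \<open>A cover at the radius \<open>thr\<close> whose entropy is close to the convex-hull entropy.\<close>
  have lt: "eps_conv \<rho> M q \<pi> p n ((\<gamma> - 1) / (\<gamma> - \<rho>)) < ereal (e2 * s')" using e2 s e2_0 by simp
  have Y_gt: "real n * (e2 * s') < Y" using s e2_0 N by (simp add: Y_def N_def)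
  have "0 < e2 * s'" using e2_0 s by simp
  from eps_conv_cover[OF n lt this e0_le Y_gt]
  obtain J G0 U where JG: "(J, G0) \<in> hull_covers \<rho> M q \<pi> p thr"
    and SU: "(\<Sum>\<^sub>\<infinity>j\<in>J. ennreal (powr1 (measure \<pi> (G0 j)) ((\<gamma> - 1) / (\<gamma> - \<rho>)))) \<le> ennreal U"
    and U: "0 < U" "ln (U + 2) = Y" by blast
  have A_sets: "A \<in> sets \<pi>" unfolding A_def by (rule D_rho_ge_sets[OF q \<pi> p_meas])
  have A_thr: "A = D_rho_ge \<rho> M q \<pi> p (ereal thr)" by (simp add: A_def thr_def)
  define G1 where "G1 j = (if j \<in> J then G0 j else {})" for j
  define G where "G j = A \<inter> disjointed G1 j" for j
  have G1s: "G1 j \<in> sets \<pi>" for j using JG by (auto simp: G1_def hull_covers_def)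
  have GG1: "G j \<subseteq> G1 j" for j using disjointed_subset[of G1 j] by (auto simp: G_def)
  have G_sets: "range G \<subseteq> sets \<pi>"
    using A_sets sets.range_disjointed_sets[of G1 \<pi>] G1s by (auto simp: G_def)
  have G_disj: "disjoint_family G"
    using disjoint_family_disjointed[of G1] by (auto simp: disjoint_family_on_def G_def)
  have G_un: "(\<Union>j. G j) = A"
  proof -
    have "A \<subseteq> (\<Union>j. G1 j)" using JG by (force simp: G1_def hull_covers_def A_thr)
    then show ?thesis using UN_disjointed_eq[of G1] by (auto simp: G_def)
  qed
  define a where "a j = (if j \<in> J then powr1 (measure \<pi> (G0 j)) ((\<gamma> - 1) / k) else 0)" for j
  have a: "measure \<pi> (G j) powr ((\<gamma> - 1) / k) \<le> a j" for j
  proof (cases "j \<in> J")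
    case False
    then have "G j = {}" using GG1[of j] by (simp add: G1_def)
    then show ?thesis using False by (simp add: a_def)
  next
    case True
    have le: "measure \<pi> (G j) \<le> measure \<pi> (G0 j)"
      using GG1[of j] True G1s[of j] by (intro \<pi>.finite_measure_mono) (auto simp: G1_def)
    show ?thesis
    proof (cases "\<gamma> = 1")
      case True
      then show ?thesis using \<open>j \<in> J\<close> by (simp add: a_def powr1_def)
    next
      case False
      then show ?thesis using \<open>j \<in> J\<close> gamma k le by (simp add: a_def powr1_def powr_mono2)
    qed
  qed
  have aU: "(\<Sum>j. ennreal (a j)) \<le> ennreal U"
  proof -
    have "(\<Sum>j. ennreal (a j)) \<le> (\<Sum>\<^sub>\<infinity>j\<in>J. ennreal (a j))"
      by (rule suminf_le_infsum_ennreal) (simp add: a_def)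
    also have "\<dots> = (\<Sum>\<^sub>\<infinity>j\<in>J. ennreal (powr1 (measure \<pi> (G0 j)) ((\<gamma> - 1) / (\<gamma> - \<rho>))))"
      by (intro infsum_cong) (simp add: a_def k_def)
    finally show ?thesis using SU by simp
  qed
  \<comment> \<open>A Kullback-Leibler ball of prior mass at least \<open>exp (- x)\<close>; it does not meet \<open>A\<close>.\<close>
  have "eps_pi M q \<pi> p n < ereal (e1 + h / N)" using e1 h N by simp
  from eps_pi_ball[OF \<pi> n this] obtain \<epsilon> where eps: "\<epsilon> < e1 + h / N"
    and B0: "{\<theta> \<in> space \<pi>. D_KL M q (p \<theta>) \<le> ereal \<epsilon>} \<in> sets \<pi>"
      "0 < measure \<pi> {\<theta> \<in> space \<pi>. D_KL M q (p \<theta>) \<le> ereal \<epsilon>}"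
      "- ln (measure \<pi> {\<theta> \<in> space \<pi>. D_KL M q (p \<theta>) \<le> ereal \<epsilon>}) \<le> real n * \<epsilon>" by blast
  define B where "B = {\<theta> \<in> space \<pi>. D_KL M q (p \<theta>) \<le> ereal \<epsilon>}"
  have ne_x: "N * \<epsilon> \<le> x"
  proof -
    have "N * \<epsilon> \<le> N * (e1 + h / N)" using eps N by (intro mult_left_mono) auto
    then show ?thesis using N by (simp add: x_def algebra_simps)
  qed
  have B: "B \<in> sets \<pi>" "0 < measure \<pi> B" "- ln (measure \<pi> B) \<le> x"
    using B0 ne_x by (auto simp: B_def[symmetric] N_def)
  have B_D: "D_rho \<rho> M q (p \<theta>) < thr" if "\<theta> \<in> B" for \<theta>
  proof -
    have "D_rho \<rho> M q (p \<theta>) \<le> \<epsilon> / (1 - \<rho>)"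
      using finite_D_KL_properties(4)[OF q p rho] that by (simp add: B_def)
    also have "\<dots> < thr"
    proof -
      have "4 * \<gamma> * x \<le> R * \<beta>"
      proof -
        have "0 \<le> 2 * k * Y" "0 \<le> (4 * \<gamma> - 2) * (N * t)"
          using k N e2_0 s gamma t by (auto simp: Y_def intro!: mult_nonneg_nonneg)
        with rate show ?thesis by linarith
      qed
      then have "\<delta> * (4 * \<gamma> * x) \<le> \<delta> * (R * \<beta>)" using delta by (intro mult_left_mono) auto
      also have "\<dots> = R * b" using delta by (simp add: \<beta>_def)
      also have "\<dots> \<le> R * 1"
      proof (rule mult_left_mono[OF b(2)])
        have "0 \<le> 4 * \<gamma> * (N * e1) + 2 * k * (N * e2)"
          using k N e1_0 e2_0 gamma by (intro add_nonneg_nonneg mult_nonneg_nonneg) auto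
        then show "0 \<le> R" using R_ge by linarith
      qed
      finally have 1: "4 * \<gamma> * (\<delta> * x) \<le> R" by (simp add: mult_ac)
      have dx: "0 < \<delta> * x" using delta x by simp
      have "\<rho> * (\<delta> * x) \<le> 1 * (\<delta> * x)" using rho dx by (intro mult_right_mono) auto
      also have "\<dots> \<le> \<gamma> * (\<delta> * x)" using gamma dx by (intro mult_right_mono) auto
      finally have "\<rho> * (\<delta> * x) < 2 * R" using 1 dx mult_pos_pos[of \<gamma> "\<delta> * x"] gamma by linarith
      then have "\<rho> * \<delta> * x < \<rho> * \<delta> * ((1 - \<rho>) * N * thr)" using thr_R by (simp add: mult_ac)
      then have "x < (1 - \<rho>) * N * thr" using rho delta by simp
      with ne_x have "N * \<epsilon> < N * ((1 - \<rho>) * thr)" by (simp add: mult_ac)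
      then have "\<epsilon> < (1 - \<rho>) * thr" using N by simp
      then show ?thesis using rho by (simp add: divide_less_eq mult.commute)
    qed
    finally show ?thesis .
  qed
  have mA: "measure \<pi> A \<le> x"
  proof -
    have False if "\<theta> \<in> A" "\<theta> \<in> B" for \<theta>
      using B_D[OF that(2)] that(1) by (simp add: A_thr D_rho_ge_def)
    then have "A \<inter> B = {}" by blast
    then have "measure \<pi> A + measure \<pi> B = measure \<pi> (A \<union> B)"
      using A_sets B by (intro \<pi>.finite_measure_Union[symmetric]) auto
    then have "measure \<pi> A \<le> 1 - measure \<pi> B" using \<pi>.prob_le_1[of "A \<union> B"] by linarith
    also have "\<dots> \<le> - ln (measure \<pi> B)" using ln_le_minus_one[OF B(2)] by simp
    finally show ?thesis using B(3) by simp
  qed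
  \<comment> \<open>The absolute value only makes the ratio nonnegative off the sample space.\<close>
  define g where "g y \<theta> = \<bar>p \<theta> y / q y\<bar>" for y \<theta>
  have g_meas: "(\<lambda>(y, \<theta>). g y \<theta>) \<in> borel_measurable (Q \<Otimes>\<^sub>M \<pi>)"
  proof -
    have [measurable]: "(\<lambda>z. p (snd z) (fst z)) \<in> borel_measurable (M \<Otimes>\<^sub>M \<pi>)"
      using p_meas by (simp add: split_beta')
    have "(\<lambda>(y, \<theta>). g y \<theta>) \<in> borel_measurable (M \<Otimes>\<^sub>M \<pi>)"
      unfolding g_def split_beta' by measurable
    then show ?thesis
      using measurable_cong_sets[OF sets_pair_measure_cong[OF sQ(1) refl] refl] by blast
  qed
  have g1: "(\<integral>\<^sup>+y. ennreal (g y \<theta>) \<partial>Q) \<le> 1" if "\<theta> \<in> space \<pi>" for \<theta>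
  proof -
    have pp: "p \<theta> \<in> borel_measurable M" "\<And>x. x \<in> space M \<Longrightarrow> 0 \<le> p \<theta> x" "(\<integral>\<^sup>+x. ennreal (p \<theta> x) \<partial>M) \<le> 1"
      using p[OF that] by (auto simp: prob_density_def)
    have "(\<integral>\<^sup>+y. ennreal (g y \<theta>) \<partial>Q) = (\<integral>\<^sup>+y. ennreal (p \<theta> y / q y) \<partial>Q)"
      using pp(2) q0 by (intro nn_integral_cong) (simp add: g_def sQ)
    then show ?thesis using nn_integral_ratio_le_1[OF q pp] by (simp add: Q_def)
  qed
  define e where "e = \<rho> * (1 - \<rho>) * (thr / 2)"
  have avg: "(\<integral>\<^sup>+y. ennreal (((\<Sum>i<m. g y (\<theta> i)) / real m) powr \<rho>) \<partial>Q) \<le> ennreal (exp (- e))"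
    if m: "0 < m" and \<theta>: "\<And>i. i < m \<Longrightarrow> \<theta> i \<in> G j" for j m \<theta>
  proof -
    have "\<theta> 0 \<in> G1 j" using \<theta>[of 0] m GG1[of j] by blast
    then have j: "j \<in> J" by (auto simp: G1_def split: if_splits)
    then have "\<theta> i \<in> G0 j" if "i < m" for i using \<theta>[OF that] GG1[of j] by (auto simp: G1_def)
    from hull_covers_average_moment[OF q p rho JG m j this] show ?thesis
      by (simp add: g_def Q_def e_def)
  qed
  have sP: "sets ?P = sets (PiM {1..n} (\<lambda>_. M))"
    by (intro sets_PiM_cong) (auto simp: sQ)
  have post_meas[measurable]: "(\<lambda>y. posterior \<pi> p n y A) \<in> borel_measurable ?P"
    using measurable_posterior[OF \<pi> p_meas A_sets, of n] measurable_cong_sets[OF sP refl] by blast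
  have E_sets: "E \<in> sets ?P" unfolding E_def by measurable
  have qpos: "AE y in ?P. \<forall>i\<in>{1..n}. 0 < q (y i)"
    using AE_prob_density_pos[OF q, folded Q_def] Qp
    by (intro eventually_ball_finite ballI AE_PiM_component) auto
  have bad: "AE y in ?P. y \<in> E \<longrightarrow>
      0 < (\<integral>\<^sup>+\<theta>. ennreal (\<Prod>i\<in>{1..n}. g (y i) \<theta>) * indicator (\<Union>j. G j) \<theta> \<partial>\<pi>) \<and>
      (\<integral>\<^sup>+\<theta>. ennreal (\<Prod>i\<in>{1..n}. g (y i) \<theta>) \<partial>\<pi>)
        \<le> ennreal (1 + exp (N * t)) * (\<integral>\<^sup>+\<theta>. ennreal (\<Prod>i\<in>{1..n}. g (y i) \<theta>) * indicator (\<Union>j. G j) \<theta> \<partial>\<pi>)"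
    using qpos AE_space
  proof eventually_elim
    case (elim y)
    show ?case
    proof (rule impI)
      assume "y \<in> E"
      then have gt: "1 / (1 + exp (N * t)) < posterior \<pi> p n y A" by (simp add: E_def N_def)
      define L where "L \<theta> = (\<Prod>i\<in>{1..n}. g (y i) \<theta>)" for \<theta>
      define \<kappa> where "\<kappa> = (\<Prod>i\<in>{1..n}. q (y i))"
      have \<kappa>: "0 < \<kappa>" unfolding \<kappa>_def using elim by (intro prod_pos) auto
      have L_meas: "L \<in> borel_measurable \<pi>"
        unfolding L_def
        using measurable_compose[OF measurable_Pair1'[OF elim(2), of \<pi>] measurable_product_likelihood[OF g_meas, of "{1..n}"]] by simp
      have L0: "0 \<le> L \<theta>" for \<theta> unfolding L_def by (intro prod_nonneg) (simp add: g_def)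
      have yM: "y i \<in> space M" if "i \<in> {1..n}" for i
        using elim(2) that by (auto simp: space_PiM sQ)
      have eq: "(\<Prod>i\<in>{1..n}. p \<theta> (y i)) = \<kappa> * L \<theta>" if \<theta>: "\<theta> \<in> space \<pi>" for \<theta>
        unfolding \<kappa>_def L_def prod.distrib[symmetric]
      proof (rule prod.cong[OF refl])
        fix i assume i: "i \<in> {1..n}"
        have "0 \<le> p \<theta> (y i)" using p[OF \<theta>] yM[OF i] by (simp add: prob_density_def)
        moreover have "0 < q (y i)" using elim(1) i by blast
        ultimately show "p \<theta> (y i) = q (y i) * g (y i) \<theta>" by (simp add: g_def)
      qed
      have "posterior \<pi> p n y A = (LINT \<theta>:A|\<pi>. \<kappa> * L \<theta>) / (LINT \<theta>|\<pi>. \<kappa> * L \<theta>)"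
        unfolding posterior_def set_lebesgue_integral_def
        using eq by (intro arg_cong2[where f="(/)"] Bochner_Integration.integral_cong) auto
      with gt have "1 / (1 + exp (N * t)) < (LINT \<theta>:A|\<pi>. \<kappa> * L \<theta>) / (LINT \<theta>|\<pi>. \<kappa> * L \<theta>)" by simp
      from ratio_gt_imp_nn_integral_bound[OF L_meas L0 A_sets \<kappa> _ this]
      show "0 < (\<integral>\<^sup>+\<theta>. ennreal (\<Prod>i\<in>{1..n}. g (y i) \<theta>) * indicator (\<Union>j. G j) \<theta> \<partial>\<pi>) \<and>
        (\<integral>\<^sup>+\<theta>. ennreal (\<Prod>i\<in>{1..n}. g (y i) \<theta>) \<partial>\<pi>)
          \<le> ennreal (1 + exp (N * t)) * (\<integral>\<^sup>+\<theta>. ennreal (\<Prod>i\<in>{1..n}. g (y i) \<theta>) * indicator (\<Union>j. G j) \<theta> \<partial>\<pi>)"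
        unfolding G_un L_def[symmetric] by simp
    qed
  qed
  have Bs: "\<theta> \<in> space \<pi>" "D_KL M q (p \<theta>) \<le> ereal \<epsilon>" if "\<theta> \<in> B" for \<theta>
    using that by (auto simp: B_def)
  note KL = finite_D_KL_properties[OF q p[OF Bs(1)] rho Bs(2), folded Q_def]
  have B_ln: "- x \<le> real (card {1..n}) * (LINT y|Q. ln (g y \<theta>))" if "\<theta> \<in> B" for \<theta>
  proof -
    have "N * (- \<epsilon>) \<le> N * (LINT y|Q. ln (g y \<theta>))"
      unfolding g_def using KL(3)[OF that that] N by (intro mult_left_mono) auto
    then show ?thesis using ne_x by (simp add: N_def)
  qed
  have e_eq: "measure ?P E * (real (card {1..n}) * e) = R * \<beta>"
  proof -
    have "N * e * \<delta> = R" using thr_R by (simp add: e_def mult_ac)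
    then have "N * e = R / \<delta>" using delta by (simp add: field_simps)
    moreover have "real (card {1..n}) = N" by (simp add: N_def)
    ultimately show ?thesis by (simp only: b_def[symmetric] \<beta>_def) simp
  qed
  show False
  proof (rule no_large_bad_event[OF Qp \<pi> _ g_meas _ g1 G_sets G_disj rho k(1) k_def gamma avg a aU U(1) x _ B _ _ B_ln _ E_sets bad])
    show "4 * \<gamma> * x + 2 * k * ln (U + 2) + (4 * \<gamma> - 2) * (N * t) \<le> measure ?P E * (real (card {1..n}) * e)"
      unfolding e_eq U(2) by (rule rate)
    show "measure \<pi> (\<Union>j. G j) \<le> x" using mA G_un by simp
    show "0 < measure ?P E" using b0 by (simp add: b_def)
    show "AE y in Q. 0 < g y \<theta>" "integrable Q (\<lambda>y. ln (g y \<theta>))" if "\<theta> \<in> B" for \<theta>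
      using KL(1,2)[OF that that] by (simp_all add: g_def)
  qed (use N t in \<open>auto simp: g_def\<close>)
qed

theorem corollary5p3:
  fixes M :: "'a measure" and q :: "'a \<Rightarrow> real"
    and \<pi> :: "'b measure" and p :: "'b \<Rightarrow> 'a \<Rightarrow> real"
    and P :: "'w measure" and X :: "nat \<Rightarrow> 'w \<Rightarrow> 'a"
    and n :: nat and \<rho> \<gamma> t \<delta> :: real
  assumes q: "prob_density M q"
    and prior: "prob_space \<pi>"
    and p: "\<And>\<theta>. \<theta> \<in> space \<pi> \<Longrightarrow> prob_density M (p \<theta>)"
    and p_meas: "(\<lambda>(x, \<theta>). p \<theta> x) \<in> borel_measurable (M \<Otimes>\<^sub>M \<pi>)"
    and P: "prob_space P"
    and n: "n \<ge> 1"
    and X_indep: "prob_space.indep_vars P (\<lambda>_. M) X {1..n}"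
    and X_distr: "\<And>i. i \<in> {1..n} \<Longrightarrow> distributed P M (X i) (\<lambda>x. ennreal (q x))"
    and rho: "0 < \<rho>" "\<rho> < 1"
    and covers: "\<And>\<epsilon>. \<epsilon> > 0 \<Longrightarrow> hull_covers \<rho> M q \<pi> p \<epsilon> \<noteq> {}"
    and gamma: "\<gamma> \<ge> 1"
    and t: "t \<ge> 0"
    and delta: "0 < \<delta>" "\<delta> < 1"
  shows "measure P {\<omega> \<in> space P.
           posterior \<pi> p n (\<lambda>i. X i \<omega>)
             (D_rho_ge \<rho> M q \<pi> p
               ((4 * eps_n \<rho> M q \<pi> p n \<gamma> + ereal ((8 * \<gamma> - 4) * t)) / ereal (\<rho> * (1 - \<rho>) * \<delta>)))
           \<le> 1 / (1 + exp (real n * t))} \<ge> 1 - \<delta>"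
proof -
  interpret P: prob_space P by fact
  let ?s = "(\<gamma> - 1) / (\<gamma> - \<rho>)"
  let ?thr = "(4 * eps_n \<rho> M q \<pi> p n \<gamma> + ereal ((8 * \<gamma> - 4) * t)) / ereal (\<rho> * (1 - \<rho>) * \<delta>)"
  have rd: "0 < \<rho> * (1 - \<rho>) * \<delta>" using rho delta by simp
  have k: "0 < \<gamma> - \<rho>" using rho gamma by simp
  have pi0: "0 \<le> eps_pi M q \<pi> p n" by (rule eps_pi_nonneg[OF prior])
  have conv0: "0 < eps_conv \<rho> M q \<pi> p n ?s" by (rule eps_conv_pos[OF n])
  show ?thesis
  proof (cases "eps_pi M q \<pi> p n = \<infinity> \<or> eps_conv \<rho> M q \<pi> p n ?s = \<infinity>")
    case True
    have "eps_n \<rho> M q \<pi> p n \<gamma> = \<infinity>"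
      using True pi0 conv0 gamma k unfolding eps_n_def
      by (cases "eps_pi M q \<pi> p n"; cases "eps_conv \<rho> M q \<pi> p n ?s") auto
    moreover have "\<infinity> / ereal d = \<infinity>" if "0 < d" for d using that by (simp add: divide_ereal_def)
    ultimately have "?thr = \<infinity>" using rd by simp
    then have "D_rho_ge \<rho> M q \<pi> p ?thr = {}" by (simp add: D_rho_ge_def)
    then have "{\<omega> \<in> space P. posterior \<pi> p n (\<lambda>i. X i \<omega>) (D_rho_ge \<rho> M q \<pi> p ?thr)
      \<le> 1 / (1 + exp (real n * t))} = space P"
      by (auto simp: posterior_def set_lebesgue_integral_def add_pos_pos)
    then show ?thesis using delta by (simp only: P.prob_space)
  next
    case False
    then obtain e1 e2 where e1: "eps_pi M q \<pi> p n = ereal e1" and e2: "eps_conv \<rho> M q \<pi> p n ?s = ereal e2"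
      using pi0 conv0 by (cases "eps_pi M q \<pi> p n"; cases "eps_conv \<rho> M q \<pi> p n ?s") auto
    define thr where "thr = (4 * (2 * \<gamma> * e1 + (\<gamma> - \<rho>) * e2) + (8 * \<gamma> - 4) * t) / (\<rho> * (1 - \<rho>) * \<delta>)"
    have thr: "?thr = ereal thr"
    proof -
      have "?thr = ereal (4 * (2 * \<gamma> * e1 + (\<gamma> - \<rho>) * e2) + (8 * \<gamma> - 4) * t) / ereal (\<rho> * (1 - \<rho>) * \<delta>)"
        by (simp add: eps_n_def e1 e2)
      also have "\<dots> = ereal thr"
        using rd unfolding thr_def by (subst ereal_divide) auto
      finally show ?thesis .
    qed
    define A where "A = D_rho_ge \<rho> M q \<pi> p (ereal thr)"
    define Q where "Q = density M (\<lambda>x. ennreal (q x))"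
    let ?I = "{1..n}"
    let ?PQ = "PiM ?I (\<lambda>_. Q)"
    let ?c = "1 / (1 + exp (real n * t))"
    define \<Phi> where "\<Phi> \<omega> = (\<lambda>i\<in>?I. X i \<omega>)" for \<omega>
    have Xm: "X i \<in> measurable P M" and Xd: "distr P M (X i) = Q" if "i \<in> ?I" for i
      using X_distr[OF that] by (auto simp: distributed_def Q_def)
    have "distr P (PiM ?I (\<lambda>_. M)) \<Phi> = PiM ?I (\<lambda>i. distr P M (X i))"
      using P.indep_vars_iff_distr_eq_PiM'[where I = ?I and M' = "\<lambda>_. M" and X = X] X_indep Xm n
      unfolding \<Phi>_def by auto
    also have "\<dots> = ?PQ" using Xd by (intro PiM_cong) auto
    finally have law: "distr P (PiM ?I (\<lambda>_. M)) \<Phi> = ?PQ" .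
    have \<Phi>m: "\<Phi> \<in> measurable P (PiM ?I (\<lambda>_. M))"
      unfolding \<Phi>_def using Xm by (intro measurable_restrict) auto
    have Qp: "prob_space Q" unfolding Q_def by (rule prob_space_density_prob_density[OF q])
    interpret PQ: prob_space ?PQ by (intro prob_space_PiM Qp)
    have A_sets: "A \<in> sets \<pi>" unfolding A_def by (rule D_rho_ge_sets[OF q prior p_meas])
    have [measurable]: "(\<lambda>y. posterior \<pi> p n y A) \<in> borel_measurable (PiM ?I (\<lambda>_. M))"
      by (rule measurable_posterior[OF prior p_meas A_sets])
    have good_sets: "{y \<in> space (PiM ?I (\<lambda>_. M)). posterior \<pi> p n y A \<le> ?c} \<in> sets (PiM ?I (\<lambda>_. M))"
      by measurable
    have sp: "space ?PQ = space (PiM ?I (\<lambda>_. M))" "sets ?PQ = sets (PiM ?I (\<lambda>_. M))"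
      unfolding law[symmetric] by simp_all
    have cong: "posterior \<pi> p n (\<lambda>i. X i \<omega>) A = posterior \<pi> p n (\<Phi> \<omega>) A" for \<omega>
    proof -
      have "(\<Prod>i\<in>?I. p \<theta> (X i \<omega>)) = (\<Prod>i\<in>?I. p \<theta> (\<Phi> \<omega> i))" for \<theta>
        by (intro prod.cong) (auto simp: \<Phi>_def)
      then show ?thesis unfolding posterior_def by (simp only:)
    qed
    have "measure P {\<omega> \<in> space P. posterior \<pi> p n (\<lambda>i. X i \<omega>) A \<le> ?c}
      = measure ?PQ {y \<in> space (PiM ?I (\<lambda>_. M)). posterior \<pi> p n y A \<le> ?c}"
      unfolding law[symmetric] cong measure_distr[OF \<Phi>m good_sets]
      using measurable_space[OF \<Phi>m] by (intro arg_cong[where f="measure P"]) auto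
    also have "\<dots> = 1 - measure ?PQ {y \<in> space ?PQ. \<not> posterior \<pi> p n y A \<le> ?c}"
    proof -
      have "{y \<in> space (PiM ?I (\<lambda>_. M)). posterior \<pi> p n y A \<le> ?c} \<in> sets ?PQ" using good_sets sp by simp
      from PQ.prob_neg[OF this[folded sp(1)]] show ?thesis unfolding sp(1) by linarith
    qed
    finally have "measure P {\<omega> \<in> space P. posterior \<pi> p n (\<lambda>i. X i \<omega>) A \<le> ?c}
      = 1 - measure ?PQ {y \<in> space ?PQ. \<not> posterior \<pi> p n y A \<le> ?c}" .
    moreover have "measure ?PQ {y \<in> space ?PQ. \<not> posterior \<pi> p n y A \<le> ?c} \<le> \<delta>"
      using posterior_bad_event_le[OF q prior p p_meas n rho gamma t delta(1) e1 e2]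
      unfolding A_def thr_def Q_def .
    ultimately show ?thesis unfolding thr A_def[symmetric] by simp
  qed
qed

end
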